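(* For any integers $c,d\geq 1$ with $\gcd(c,d)=1$, let $\mathcal{N}_{c/d}$ be the space of null geodesics of the spacetime $\left(\mathbb{S}^2\times\mathbb{S}^1,\ g_{c/d}=g_\circ-\frac{d^2}{c^2}dt^2\right)$. Then there is a diffeomorphism $$\mathcal{N}_{c/d}\cong L(2c,1).$$
   Context: All manifolds and maps are smooth. A spacetime is a connected Lorentzian manifold $(M,g)$ of dimension $\geq 3$ together with a time-orientation (equivalently, a choice of a global timelike vector field); a nonzero vector $v$ is null if $g(v,v)=0$. Let $C^+\subset TM$ denote the bundle of future-pointing null vectors. The space of null geodesics is $\mathcal{N}=\{\gamma(I) \mid \gamma:I\to M \text{ a maximal geodesic with } \dot\gamma\subset C^+\}$; it is identified with the leaf space $C^+/\langle X_g,\Delta\rangle$, where $X_g$ is the geodesic spray and $\Delta$ is the Euler vector field (the generator of fibrewise scaling $v\mapsto e^s v$) on $TM$, and it carries the corresponding quotient smooth structure. Here $g_\circ$ is the round metric on the unit sphere $\mathbb{S}^2$, $t$ is the angle coordinate (period $2\pi$) on $\mathbb{S}^1$, and $\mathbb{S}^2\times\mathbb{S}^1$ is time-oriented by $\partial_t$. For a positive integer $p$, the lens space $L(p,1)$ is the quotient $\mathbb{S}^3/\mathbb{Z}_p$ of $\mathbb{S}^3\subset\mathbb{C}^2$ by the $\mathbb{Z}_p$-action generated by $(z_0,z_1)\mapsto(e^{2\pi i/p}z_0,e^{2\pi i/p}z_1)$. *)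

theory Defs
  imports "HOL-Analysis.Analysis"
begin

section \<open>Smooth maps\<close>

text \<open>For open \<open>S\<close>, \<open>Ck_on k S f\<close> says that \<open>f\<close> is of class \<open>C\<^sup>k\<close> on \<open>S\<close>.\<close>

primrec Ck_on :: "nat \<Rightarrow> 'a::euclidean_space set \<Rightarrow> ('a \<Rightarrow> 'b::euclidean_space) \<Rightarrow> bool" where
  "Ck_on 0 S f \<longleftrightarrow> continuous_on S f"
| "Ck_on (Suc k) S f \<longleftrightarrow> (\<forall>x\<in>S. f differentiable (at x)) \<and>
     (\<forall>v. Ck_on k S (\<lambda>x. frechet_derivative f (at x) v))"

definition Cinf_on :: "'a::euclidean_space set \<Rightarrow> ('a \<Rightarrow> 'b::euclidean_space) \<Rightarrow> bool" where
  "Cinf_on S f \<longleftrightarrow> (\<forall>k. Ck_on k S f)"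

text \<open>Smoothness on an arbitrary subset \<open>S\<close> of a Euclidean space: local extendability to smooth
  maps on open sets. On an open set, and on an embedded submanifold, this is the usual notion.\<close>

definition smooth_on :: "'a::euclidean_space set \<Rightarrow> ('a \<Rightarrow> 'b::euclidean_space) \<Rightarrow> bool" where
  "smooth_on S f \<longleftrightarrow>
     (\<forall>x\<in>S. \<exists>U F. open U \<and> x \<in> U \<and> Cinf_on U F \<and> (\<forall>y\<in>U \<inter> S. F y = f y))"


section \<open>Manifolds and diffeomorphisms\<close>

type_synonym ('q, 'n) chart = "'q set \<times> ('q \<Rightarrow> real ^ 'n)"

type_synonym ('q, 'n) mfd = "'q topology \<times> ('q, 'n) chart set"

definition smooth_manifold :: "('q, 'n::finite) mfd \<Rightarrow> bool" where
  "smooth_manifold = (\<lambda>(X, A).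
     Hausdorff_space X \<and>
     (\<exists>B. countable B \<and> (\<forall>V\<in>B. openin X V) \<and>
        (\<forall>U x. openin X U \<and> x \<in> U \<longrightarrow> (\<exists>V\<in>B. x \<in> V \<and> V \<subseteq> U))) \<and>
     (\<forall>(U, \<phi>)\<in>A. openin X U \<and> open (\<phi> ` U) \<and>
        homeomorphic_map (subtopology X U) (top_of_set (\<phi> ` U)) \<phi>) \<and>
     topspace X = (\<Union>(U, \<phi>)\<in>A. U) \<and>
     (\<forall>(U, \<phi>)\<in>A. \<forall>(V, \<psi>)\<in>A. smooth_on (\<phi> ` (U \<inter> V)) (\<psi> \<circ> inv_into U \<phi>)))"

definition smooth_map :: "('q, 'n::finite) mfd \<Rightarrow> ('r, 'm::finite) mfd \<Rightarrow> ('q \<Rightarrow> 'r) \<Rightarrow> bool" where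
  "smooth_map = (\<lambda>(X, A) (Y, B) f.
     continuous_map X Y f \<and>
     (\<forall>(U, \<phi>)\<in>A. \<forall>(V, \<psi>)\<in>B.
        smooth_on (\<phi> ` {x \<in> U. f x \<in> V}) (\<psi> \<circ> f \<circ> inv_into U \<phi>)))"

definition diffeomorphism ::
    "('q, 'n::finite) mfd \<Rightarrow> ('r, 'm::finite) mfd \<Rightarrow> ('q \<Rightarrow> 'r) \<Rightarrow> bool" where
  "diffeomorphism M N f \<longleftrightarrow> smooth_map M N f \<and>
     (\<exists>g. smooth_map N M g \<and>
        (\<forall>x\<in>topspace (fst M). g (f x) = x) \<and> (\<forall>y\<in>topspace (fst N). f (g y) = y))"

definition diffeomorphic :: "('q, 'n::finite) mfd \<Rightarrow> ('r, 'm::finite) mfd \<Rightarrow> bool" where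
  "diffeomorphic M N \<longleftrightarrow>
     smooth_manifold M \<and> smooth_manifold N \<and> (\<exists>f. diffeomorphism M N f)"


section \<open>Embedded submanifolds and their quotients\<close>

definition tangent_space :: "'a::euclidean_space set \<Rightarrow> 'a \<Rightarrow> 'a set" where
  "tangent_space M x = {vector_derivative \<gamma> (at 0) | \<gamma>::real \<Rightarrow> 'a.
     smooth_on {-1<..<1} \<gamma> \<and> \<gamma> ` {-1<..<1} \<subseteq> M \<and> \<gamma> 0 = x}"

definition submanifold_charts :: "'a::euclidean_space set \<Rightarrow> ('a, 'n::finite) chart set" where
  "submanifold_charts M = {(U, \<phi>). openin (top_of_set M) U \<and> open (\<phi> ` U) \<and> inj_on \<phi> U \<and>
     smooth_on U \<phi> \<and> smooth_on (\<phi> ` U) (inv_into U \<phi>)}"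

definition submersion_on :: "'a::euclidean_space set \<Rightarrow> ('a \<Rightarrow> 'b::euclidean_space) \<Rightarrow> bool" where
  "submersion_on S f \<longleftrightarrow>
     (\<forall>x\<in>S. \<exists>U F. open U \<and> x \<in> U \<and> Cinf_on U F \<and> (\<forall>y\<in>U \<inter> S. F y = f y) \<and>
        frechet_derivative F (at x) ` tangent_space S x = UNIV)"

text \<open>The quotient smooth structure on \<open>Q\<close> induced by a projection \<open>\<pi>\<close> from an embedded submanifold
  \<open>X\<close> onto \<open>Q\<close> is the (unique) one for which \<open>\<pi>\<close> is a submersion. Its underlying topology is the
  quotient topology and its charts are the homeomorphisms \<open>\<phi>\<close> from open subsets of \<open>Q\<close> onto open
  subsets of \<open>\<real>\<^sup>n\<close> for which \<open>\<phi> \<circ> \<pi>\<close> is a submersion. Such charts are automatically compatible with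
  each other; the quotient is a manifold (modelled on \<open>\<real>\<^sup>n\<close>) iff they cover \<open>Q\<close> and the topology is
  Hausdorff and second countable.\<close>

definition quotient_top :: "'a::euclidean_space set \<Rightarrow> ('a \<Rightarrow> 'q) \<Rightarrow> 'q set \<Rightarrow> 'q topology" where
  "quotient_top X \<pi> Q = topology (\<lambda>U. U \<subseteq> Q \<and> openin (top_of_set X) {x \<in> X. \<pi> x \<in> U})"

lemma openin_quotient_top:
  "openin (quotient_top X \<pi> Q) U \<longleftrightarrow> U \<subseteq> Q \<and> openin (top_of_set X) {x \<in> X. \<pi> x \<in> U}"
proof -
  have "istopology (\<lambda>U. U \<subseteq> Q \<and> openin (top_of_set X) {x \<in> X. \<pi> x \<in> U})"
    unfolding istopology_def
  proof (intro conjI allI impI)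
    fix S T
    assume "S \<subseteq> Q \<and> openin (top_of_set X) {x \<in> X. \<pi> x \<in> S}"
      and "T \<subseteq> Q \<and> openin (top_of_set X) {x \<in> X. \<pi> x \<in> T}"
    moreover have "{x \<in> X. \<pi> x \<in> S \<inter> T} = {x \<in> X. \<pi> x \<in> S} \<inter> {x \<in> X. \<pi> x \<in> T}"
      by auto
    ultimately show "openin (top_of_set X) {x \<in> X. \<pi> x \<in> S \<inter> T}" "S \<inter> T \<subseteq> Q"
      by (auto simp: openin_Int)
  next
    fix \<K>
    assume *: "\<forall>K\<in>\<K>. K \<subseteq> Q \<and> openin (top_of_set X) {x \<in> X. \<pi> x \<in> K}"
    have "{x \<in> X. \<pi> x \<in> \<Union>\<K>} = \<Union>((\<lambda>K. {x \<in> X. \<pi> x \<in> K}) ` \<K>)"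
      by auto
    moreover have "openin (top_of_set X) (\<Union>((\<lambda>K. {x \<in> X. \<pi> x \<in> K}) ` \<K>))"
      using * by (intro openin_Union) auto
    ultimately show "openin (top_of_set X) {x \<in> X. \<pi> x \<in> \<Union>\<K>}" by metis
    show "\<Union>\<K> \<subseteq> Q" using * by auto
  qed
  then show ?thesis
    by (simp add: quotient_top_def topology_inverse')
qed

definition quotient_charts ::
    "'a::euclidean_space set \<Rightarrow> ('a \<Rightarrow> 'q) \<Rightarrow> 'q set \<Rightarrow> ('q, 'n::finite) chart set" where
  "quotient_charts X \<pi> Q = {(U, \<phi>). openin (quotient_top X \<pi> Q) U \<and> open (\<phi> ` U) \<and>
     homeomorphic_map (subtopology (quotient_top X \<pi> Q) U) (top_of_set (\<phi> ` U)) \<phi> \<and>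
     submersion_on {x \<in> X. \<pi> x \<in> U} (\<phi> \<circ> \<pi>)}"

definition quotient_mfd ::
    "'a::euclidean_space set \<Rightarrow> ('a \<Rightarrow> 'q) \<Rightarrow> 'q set \<Rightarrow> ('q, 'n::finite) mfd" where
  "quotient_mfd X \<pi> Q = (quotient_top X \<pi> Q, quotient_charts X \<pi> Q)"


section \<open>Geodesics of a Lorentzian metric\<close>

text \<open>The data of a time-oriented Lorentzian manifold, realised as an embedded submanifold of the
  Euclidean space \<open>'a\<close>. The metric \<open>metric S x v w\<close> is only relevant for \<open>x\<close> in \<open>points S\<close> and
  \<open>v, w\<close> tangent to \<open>points S\<close> at \<open>x\<close>. Signature convention: \<open>(+,\<dots>,+,-)\<close>.\<close>

record ('a, 'n::finite) lorentz =
  points :: "'a set"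
  atlas :: "('a, 'n) chart set"
  metric :: "'a \<Rightarrow> 'a \<Rightarrow> 'a \<Rightarrow> real"
  time_field :: "'a \<Rightarrow> 'a"

definition partial_deriv :: "'n::finite \<Rightarrow> (real ^ 'n \<Rightarrow> 'b::real_normed_vector) \<Rightarrow> real ^ 'n \<Rightarrow> 'b" where
  "partial_deriv i F u = frechet_derivative F (at u) (axis i 1)"

definition metric_matrix ::
    "('a::euclidean_space, 'n::finite) lorentz \<Rightarrow> ('a, 'n) chart \<Rightarrow> real ^ 'n \<Rightarrow> real ^ 'n ^ 'n" where
  "metric_matrix S = (\<lambda>(U, \<phi>) u. \<chi> i j.
     metric S (inv_into U \<phi> u)
       (partial_deriv i (inv_into U \<phi>) u) (partial_deriv j (inv_into U \<phi>) u))"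

definition christoffel ::
    "('a::euclidean_space, 'n::finite) lorentz \<Rightarrow> ('a, 'n) chart \<Rightarrow>
     real ^ 'n \<Rightarrow> 'n \<Rightarrow> 'n \<Rightarrow> 'n \<Rightarrow> real" where
  "christoffel S \<kappa> u k i j =
     (1/2) * (\<Sum>l\<in>UNIV. matrix_inv (metric_matrix S \<kappa> u) $ k $ l *
       (partial_deriv i (\<lambda>w. metric_matrix S \<kappa> w $ l $ j) u
        + partial_deriv j (\<lambda>w. metric_matrix S \<kappa> w $ l $ i) u
        - partial_deriv l (\<lambda>w. metric_matrix S \<kappa> w $ i $ j) u))"

definition velocity :: "(real \<Rightarrow> 'a::real_normed_vector) \<Rightarrow> real \<Rightarrow> 'a" where
  "velocity \<gamma> t = vector_derivative \<gamma> (at t)"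

definition geodesic ::
    "('a::euclidean_space, 'n::finite) lorentz \<Rightarrow> real set \<Rightarrow> (real \<Rightarrow> 'a) \<Rightarrow> bool" where
  "geodesic S I \<gamma> \<longleftrightarrow>
     open I \<and> is_interval I \<and> I \<noteq> {} \<and> smooth_on I \<gamma> \<and> \<gamma> ` I \<subseteq> points S \<and>
     (\<forall>(U, \<phi>)\<in>atlas S. \<forall>t\<in>I. \<gamma> t \<in> U \<longrightarrow>
        (\<forall>k. velocity (velocity (\<phi> \<circ> \<gamma>)) t $ k
           + (\<Sum>i\<in>UNIV. \<Sum>j\<in>UNIV. christoffel S (U, \<phi>) (\<phi> (\<gamma> t)) k i j
                * velocity (\<phi> \<circ> \<gamma>) t $ i * velocity (\<phi> \<circ> \<gamma>) t $ j) = 0))"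

definition maximal_geodesic ::
    "('a::euclidean_space, 'n::finite) lorentz \<Rightarrow> real set \<Rightarrow> (real \<Rightarrow> 'a) \<Rightarrow> bool" where
  "maximal_geodesic S I \<gamma> \<longleftrightarrow> geodesic S I \<gamma> \<and>
     (\<forall>J \<eta>. geodesic S J \<eta> \<and> I \<subseteq> J \<and> (\<forall>t\<in>I. \<eta> t = \<gamma> t) \<longrightarrow> J = I)"


section \<open>The space of null geodesics\<close>

text \<open>The bundle \<open>C\<^sup>+\<close>, as a subset of \<open>TM \<subseteq> 'a \<times> 'a\<close>. A null vector is future-pointing iff its product
  with the timelike field is negative.\<close>

definition future_null :: "('a::euclidean_space, 'n::finite) lorentz \<Rightarrow> ('a \<times> 'a) set" where
  "future_null S = {(x, v). x \<in> points S \<and> v \<in> tangent_space (points S) x \<and> v \<noteq> 0 \<and>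
     metric S x v v = 0 \<and> metric S x v (time_field S x) < 0}"

definition null_geodesics :: "('a::euclidean_space, 'n::finite) lorentz \<Rightarrow> 'a set set" where
  "null_geodesics S = {\<gamma> ` I | I \<gamma>. maximal_geodesic S I \<gamma> \<and>
     (\<forall>t\<in>I. (\<gamma> t, velocity \<gamma> t) \<in> future_null S)}"

text \<open>Two points of \<open>C\<^sup>+\<close> lie in the same leaf of the foliation spanned by the geodesic spray and the
  Euler field iff they are joined by finitely many integral curves of these two fields. The integral
  curves of the spray are the velocity curves of geodesics; those of the Euler field are
  \<open>s \<mapsto> (x, e\<^sup>s v)\<close>.\<close>

inductive same_leaf :: "('a::euclidean_space, 'n::finite) lorentz \<Rightarrow> 'a \<times> 'a \<Rightarrow> 'a \<times> 'a \<Rightarrow> bool"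
  for S :: "('a, 'n) lorentz" where
  refl: "p \<in> future_null S \<Longrightarrow> same_leaf S p p"
| spray: "same_leaf S p (\<gamma> s, velocity \<gamma> s) \<Longrightarrow> geodesic S I \<gamma> \<Longrightarrow> s \<in> I \<Longrightarrow> t \<in> I \<Longrightarrow>
    same_leaf S p (\<gamma> t, velocity \<gamma> t)"
| euler: "same_leaf S p (x, v) \<Longrightarrow> same_leaf S p (x, exp s *\<^sub>R v)"

definition leaf :: "('a::euclidean_space, 'n::finite) lorentz \<Rightarrow> 'a \<times> 'a \<Rightarrow> ('a \<times> 'a) set" where
  "leaf S p = {q. same_leaf S p q}"

text \<open>A leaf is identified with the null geodesic \<open>\<gamma>(I)\<close> obtained by projecting it to the base, so
  that the quotient structure of the leaf space becomes the structure on the set of null geodesics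
  defined by the projection sending \<open>p\<close> in \<open>C\<^sup>+\<close> to the base projection of its leaf. (In the spacetimes
  below a leaf is determined by its base projection, since a null geodesic has only one future
  direction at each of its points; hence the fibres of this map are exactly the leaves.) The dimension
  \<open>'m\<close> of the model space is independent of that of the spacetime.\<close>

definition null_geodesic_space ::
    "('a::euclidean_space, 'n::finite) lorentz \<Rightarrow> ('a set, 'm::finite) mfd" where
  "null_geodesic_space S =
     quotient_mfd (future_null S) (\<lambda>p. fst ` leaf S p) (null_geodesics S)"


section \<open>The spacetimes on the product of the 2-sphere and the circle\<close>

text \<open>\<open>dt\<close> for the angle coordinate \<open>z = e\<^bsup>it\<^esup>\<close> on the unit circle, on vectors \<open>a\<close> tangent at \<open>z\<close>; the
  coordinate field is \<open>\<partial>\<^sub>t = iz\<close>.\<close>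

definition d_angle :: "complex \<Rightarrow> complex \<Rightarrow> real" where
  "d_angle z a = Im (cnj z * a)"

text \<open>The round metric is the one induced from \<open>\<real>\<^sup>3\<close>.\<close>

definition S2xS1 :: "nat \<Rightarrow> nat \<Rightarrow> ((real ^ 3) \<times> complex, 3) lorentz" where
  "S2xS1 c d =
     \<lparr> points = sphere 0 1 \<times> sphere 0 1,
       atlas = submanifold_charts (sphere 0 1 \<times> sphere 0 1),
       metric = (\<lambda>(x, z) (v, a) (w, b).
         v \<bullet> w - (real d ^ 2 / real c ^ 2) * (d_angle z a * d_angle z b)),
       time_field = (\<lambda>(x, z). (0, \<i> * z)) \<rparr>"


section \<open>Lens spaces\<close>

definition lens_orbit :: "nat \<Rightarrow> complex \<times> complex \<Rightarrow> (complex \<times> complex) set" where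
  "lens_orbit p z =
     {(exp (2 * of_real pi * \<i> / of_nat p) ^ k * fst z,
       exp (2 * of_real pi * \<i> / of_nat p) ^ k * snd z) | k::nat. True}"

text \<open>The lens space \<open>L(p,1)\<close>, for \<open>p > 0\<close>.\<close>

definition lens_space :: "nat \<Rightarrow> ((complex \<times> complex) set, 3) mfd" where
  "lens_space p = quotient_mfd (sphere 0 1) (lens_orbit p) (lens_orbit p ` sphere 0 1)"

end

theory Submission
  imports Defs "HOL-Complex_Analysis.Cauchy_Integral_Formula"
begin

text \<open>
  Along a null geodesic of \<open>g\<^bsub>c/d\<^esub>\<close> the component in \<open>S\<^sup>2\<close> runs through a great circle while the
  phase \<open>z\<close> in \<open>S\<^sup>1\<close> turns \<open>c/d\<close> times as fast. A null geodesic is therefore an orthonormal pair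
  \<open>(x, w)\<close> in \<open>\<real>\<^sup>3\<close> together with a phase, modulo simultaneous rotation of \<open>(x, w)\<close> by \<open>\<theta>\<close> and of \<open>z\<close> by
  \<open>c\<theta>/d\<close>. Each of them meets \<open>z = 1\<close>, and returns there after the rotations by multiples of \<open>2\<pi>d/c\<close>;
  as \<open>c\<close> and \<open>d\<close> are coprime, these are the multiples of \<open>2\<pi>/c\<close>, so that the quotient is \<open>SO(3)/\<int>\<^sub>c\<close>.
  Under the double covering \<open>S\<^sup>3 \<rightarrow> SO(3)\<close> multiplication by \<open>e\<^bsup>i\<alpha>\<^esup>\<close> becomes rotation by \<open>2\<alpha>\<close>, which
  turns \<open>SO(3)/\<int>\<^sub>c\<close> into \<open>S\<^sup>3/\<int>\<^bsub>2c\<^esub>\<close>.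

  A quotient smooth structure is determined by local smooth lifts: if a bijection of two quotients
  lifts, locally and in both directions, to smooth maps with prescribed values at one point, then it
  carries the charts of one quotient to those of the other. Hence only the lens space needs charts.
  The geodesic equation is reduced to the statement that the acceleration is normal, since the metric
  is the restriction of a constant bilinear form on the ambient space.
\<close>

section \<open>Calculus of smooth maps\<close>

text \<open>Quotient charts are recognised by a surjective derivative on tangent vectors, so the
  lifts have to transport this surjectivity. A lift and a reverse lift need not be inverse to each
  other: it is enough that both respect the projections and that they exchange two prescribed
  points. This is what lets the fibres have different dimensions, two for the leaves in C^+ and zero
  for the orbits in S^3. A null geodesic is only a set of points here, so its direction of travel
  has to be recovered from that set. The pairs (x, w) and (x, -w) trace the same great circle, and a
  parity argument separates the resulting sets. Coprimality enters through one Bezout identity: each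
  rotation by a multiple of 2 pi/c agrees with one whose phase shift is trivial. The double covering
  has no global smooth inverse. Locally the inverse is read off from the matrix q q^T, which is
  linear in the isotropic vector x - iw. A branch of the square root removes the remaining scalar
  factor, and its sign is harmless because -1 lies in the group of order 2c.\<close>

lemma Ck_on_imp_continuous_on: "Ck_on k S f \<Longrightarrow> continuous_on S f"
  by (cases k) (auto intro!: continuous_at_imp_continuous_on differentiable_imp_continuous_within)

lemma Ck_on_Suc_imp: "Ck_on (Suc k) S f \<Longrightarrow> Ck_on k S f"
proof (induction k arbitrary: f)
  case 0
  then show ?case using Ck_on_imp_continuous_on[of "Suc 0" S f] by simp
next
  case (Suc k)
  then show ?case using Ck_on.simps(2) by blast
qed

lemma Ck_on_subset: "Ck_on k S f \<Longrightarrow> T \<subseteq> S \<Longrightarrow> Ck_on k T f"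
  by (induction k arbitrary: f) (auto intro: continuous_on_subset)

lemma Ck_on_cong:
  assumes "open S" "\<And>x. x \<in> S \<Longrightarrow> f x = g x"
  shows "Ck_on k S f \<Longrightarrow> Ck_on k S g"
  using assms(2)
proof (induction k arbitrary: f g)
  case 0
  then show ?case using continuous_on_cong by (metis Ck_on.simps(1))
next
  case (Suc k)
  have D: "(g has_derivative frechet_derivative f (at x)) (at x)" if "x \<in> S" for x
  proof (rule has_derivative_transform_within_open[OF _ assms(1) that])
    show "(f has_derivative frechet_derivative f (at x)) (at x)"
      using Suc.prems(1) that by (simp add: frechet_derivative_works[symmetric])
  qed (use Suc.prems in auto)
  have "Ck_on k S (\<lambda>x. frechet_derivative g (at x) v)" for v
  proof (rule Suc.IH)
    show "Ck_on k S (\<lambda>x. frechet_derivative f (at x) v)" using Suc.prems(1) by simp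
    show "frechet_derivative f (at x) v = frechet_derivative g (at x) v" if "x \<in> S" for x
      using frechet_derivative_at[OF D[OF that]] by simp
  qed
  moreover have "g differentiable (at x)" if "x \<in> S" for x
    using D[OF that] differentiable_def by blast
  ultimately show ?case by simp
qed

text \<open>Any derivative given pointwise may serve; by uniqueness it agrees on the open set with
  \<open>frechet_derivative\<close>, which is defined by choice.\<close>

lemma Ck_on_SucI:
  assumes "open S" "\<And>x. x \<in> S \<Longrightarrow> (f has_derivative f' x) (at x)"
    and "\<And>v. Ck_on k S (\<lambda>x. f' x v)"
  shows "Ck_on (Suc k) S f"
proof -
  have "Ck_on k S (\<lambda>x. frechet_derivative f (at x) v)" for v
    using assms(3)[of v] by (rule Ck_on_cong[OF assms(1), rotated]) (metis assms(2) frechet_derivative_at)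
  moreover have "f differentiable (at x)" if "x \<in> S" for x
    using assms(2)[OF that] differentiable_def by blast
  ultimately show ?thesis by simp
qed

lemma Ck_on_SucD:
  assumes "Ck_on (Suc k) S f"
  shows "x \<in> S \<Longrightarrow> (f has_derivative frechet_derivative f (at x)) (at x)"
    and "Ck_on k S (\<lambda>x. frechet_derivative f (at x) v)"
  using assms by (auto simp: frechet_derivative_works[symmetric])

lemma Ck_on_const: "open S \<Longrightarrow> Ck_on k S (\<lambda>x. c)"
  by (induction k arbitrary: c) auto

lemma Ck_on_bounded_linear:
  assumes "bounded_linear h" "open S"
  shows "Ck_on k S f \<Longrightarrow> Ck_on k S (\<lambda>x. h (f x))"
proof (induction k arbitrary: f)
  case 0
  then show ?case using assms(1) bounded_linear.continuous_on by auto
next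
  case (Suc k)
  show ?case
    by (rule Ck_on_SucI[OF assms(2) bounded_linear.has_derivative[OF assms(1) Ck_on_SucD(1)[OF Suc.prems]]])
      (auto intro!: Suc.IH Ck_on_SucD(2)[OF Suc.prems])
qed

lemma Ck_on_id: "open S \<Longrightarrow> Ck_on k S (\<lambda>x. x)"
  by (cases k) (use Ck_on_const in \<open>auto simp: continuous_on_id\<close>)

lemma Ck_on_add:
  assumes "open S"
  shows "Ck_on k S f \<Longrightarrow> Ck_on k S g \<Longrightarrow> Ck_on k S (\<lambda>x. f x + g x)"
proof (induction k arbitrary: f g)
  case 0
  then show ?case by (auto intro: continuous_intros)
next
  case (Suc k)
  show ?case
    by (rule Ck_on_SucI[OF assms has_derivative_add[OF Ck_on_SucD(1)[OF Suc.prems(1)] Ck_on_SucD(1)[OF Suc.prems(2)]]])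
      (auto intro!: Suc.IH Ck_on_SucD(2)[OF Suc.prems(1)] Ck_on_SucD(2)[OF Suc.prems(2)])
qed

lemma Ck_on_sum:
  assumes "open S" "\<And>i. i \<in> I \<Longrightarrow> Ck_on k S (f i)"
  shows "Ck_on k S (\<lambda>x. \<Sum>i\<in>I. f i x)"
  using assms(2)
  by (induction I rule: infinite_finite_induct) (auto intro: Ck_on_add Ck_on_const assms(1))

lemma Ck_on_bilinear:
  assumes "bounded_bilinear h" "open S"
  shows "Ck_on k S f \<Longrightarrow> Ck_on k S g \<Longrightarrow> Ck_on k S (\<lambda>x. h (f x) (g x))"
proof (induction k arbitrary: f g)
  case 0
  then show ?case using bounded_bilinear.continuous_on[OF assms(1)] by auto
next
  case (Suc k)
  show ?case
    by (rule Ck_on_SucI[OF assms(2) bounded_bilinear.FDERIV[OF assms(1) Ck_on_SucD(1)[OF Suc.prems(1)] Ck_on_SucD(1)[OF Suc.prems(2)]]])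
      (auto intro!: Ck_on_add assms(2) Suc.IH Ck_on_SucD(2)[OF Suc.prems(1)] Ck_on_SucD(2)[OF Suc.prems(2)]
        Ck_on_Suc_imp[OF Suc.prems(1)] Ck_on_Suc_imp[OF Suc.prems(2)])
qed

lemma Ck_on_compose:
  assumes "open S" "open T" "f ` S \<subseteq> T"
  shows "Ck_on k T g \<Longrightarrow> Ck_on k S f \<Longrightarrow> Ck_on k S (\<lambda>x. g (f x))"
proof (induction k arbitrary: g)
  case 0
  then show ?case using assms(3) by (auto intro: continuous_on_compose2)
next
  case (Suc k)
  let ?Df = "\<lambda>x. frechet_derivative f (at x)" and ?Dg = "\<lambda>x. frechet_derivative g (at x)"
  \<comment> \<open>The chain rule is expanded in the basis: the induction hypothesis handles
    derivatives of \<open>g\<close> in a fixed direction, whereas the direction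
    \<open>?Df x v\<close> varies with x.\<close>
  have D: "((\<lambda>x. g (f x)) has_derivative (\<lambda>v. \<Sum>b\<in>Basis. (?Df x v \<bullet> b) *\<^sub>R ?Dg (f x) b)) (at x)"
    if "x \<in> S" for x
  proof -
    have g: "(g has_derivative ?Dg (f x)) (at (f x))"
      using Ck_on_SucD(1)[OF Suc.prems(1)] assms(3) that by auto
    have "?Dg (f x) w = (\<Sum>b\<in>Basis. (w \<bullet> b) *\<^sub>R ?Dg (f x) b)" for w
      using linear_sum[OF has_derivative_linear[OF g], of "\<lambda>b. (w \<bullet> b) *\<^sub>R b" Basis]
      by (simp add: linear_scale[OF has_derivative_linear[OF g]] euclidean_representation)
    then show ?thesis
      by (rule has_derivative_eq_rhs[OF has_derivative_compose[OF Ck_on_SucD(1)[OF Suc.prems(2) that] g] ext])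
  qed
  show ?case
    by (rule Ck_on_SucI[OF assms(1) D])
      (assumption, intro Ck_on_sum Ck_on_bilinear[OF bounded_bilinear_scaleR] assms(1)
        Suc.IH[OF Ck_on_SucD(2)[OF Suc.prems(1)] Ck_on_Suc_imp[OF Suc.prems(2)]]
        Ck_on_bounded_linear[OF bounded_linear_inner_left] Ck_on_SucD(2)[OF Suc.prems(2)])
qed

lemma Cinf_on_imp_continuous_on: "Cinf_on S f \<Longrightarrow> continuous_on S f"
  using Ck_on_imp_continuous_on by (auto simp: Cinf_on_def)

lemma Cinf_on_open_preimage: "Cinf_on S f \<Longrightarrow> open S \<Longrightarrow> open T \<Longrightarrow> open (S \<inter> f -` T)"
  by (rule continuous_open_preimage[OF Cinf_on_imp_continuous_on])

lemma Cinf_on_subset: "Cinf_on S f \<Longrightarrow> T \<subseteq> S \<Longrightarrow> Cinf_on T f"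
  by (auto simp: Cinf_on_def intro: Ck_on_subset)

lemma Cinf_on_cong: "Cinf_on S f \<Longrightarrow> open S \<Longrightarrow> (\<And>x. x \<in> S \<Longrightarrow> f x = g x) \<Longrightarrow> Cinf_on S g"
  unfolding Cinf_on_def by (blast intro: Ck_on_cong[of S f g])

lemma Cinf_on_has_derivative:
  "Cinf_on S f \<Longrightarrow> x \<in> S \<Longrightarrow> (f has_derivative frechet_derivative f (at x)) (at x)"
  unfolding Cinf_on_def using Ck_on_SucD(1) by blast

lemma Cinf_on_frechet_derivative: "Cinf_on S f \<Longrightarrow> Cinf_on S (\<lambda>x. frechet_derivative f (at x) v)"
  unfolding Cinf_on_def using Ck_on_SucD(2) by blast

lemma Cinf_on_const: "open S \<Longrightarrow> Cinf_on S (\<lambda>x. c)"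
  and Cinf_on_id: "open S \<Longrightarrow> Cinf_on S (\<lambda>x. x)"
  by (auto simp: Cinf_on_def Ck_on_const Ck_on_id)

lemma Cinf_on_bounded_linear:
  "bounded_linear h \<Longrightarrow> open S \<Longrightarrow> Cinf_on S f \<Longrightarrow> Cinf_on S (\<lambda>x. h (f x))"
  by (auto simp: Cinf_on_def intro: Ck_on_bounded_linear)

lemma Cinf_on_bilinear:
  "bounded_bilinear h \<Longrightarrow> open S \<Longrightarrow> Cinf_on S f \<Longrightarrow> Cinf_on S g \<Longrightarrow> Cinf_on S (\<lambda>x. h (f x) (g x))"
  by (auto simp: Cinf_on_def intro: Ck_on_bilinear)

lemma Cinf_on_compose:
  "Cinf_on T g \<Longrightarrow> Cinf_on S f \<Longrightarrow> open S \<Longrightarrow> open T \<Longrightarrow> f ` S \<subseteq> T \<Longrightarrow> Cinf_on S (\<lambda>x. g (f x))"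
  by (auto simp: Cinf_on_def intro: Ck_on_compose)

lemma Cinf_on_add:
  "open S \<Longrightarrow> Cinf_on S f \<Longrightarrow> Cinf_on S g \<Longrightarrow> Cinf_on S (\<lambda>x. f x + g x)"
  by (auto simp: Cinf_on_def intro: Ck_on_add)

lemma Cinf_on_uminus: "open S \<Longrightarrow> Cinf_on S f \<Longrightarrow> Cinf_on S (\<lambda>x. - f x)"
  by (rule Cinf_on_bounded_linear) (auto intro: bounded_linear_minus bounded_linear_ident)

lemma Cinf_on_diff:
  "open S \<Longrightarrow> Cinf_on S f \<Longrightarrow> Cinf_on S g \<Longrightarrow> Cinf_on S (\<lambda>x. f x - g x)"
  using Cinf_on_add[of S f "\<lambda>x. - g x"] Cinf_on_uminus by auto

lemma Cinf_on_sum: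
  "open S \<Longrightarrow> (\<And>i. i \<in> I \<Longrightarrow> Cinf_on S (f i)) \<Longrightarrow> Cinf_on S (\<lambda>x. \<Sum>i\<in>I. f i x)"
  by (auto simp: Cinf_on_def intro: Ck_on_sum)

lemma Cinf_on_componentwise:
  assumes "open S" "\<And>b. b \<in> Basis \<Longrightarrow> Cinf_on S (\<lambda>x. f x \<bullet> b)"
  shows "Cinf_on S f"
proof (rule Cinf_on_cong[OF _ assms(1)])
  show "Cinf_on S (\<lambda>x. \<Sum>b\<in>Basis. (f x \<bullet> b) *\<^sub>R b)"
    by (intro Cinf_on_sum assms Cinf_on_bounded_linear[OF bounded_linear_scaleR_left])
qed (simp add: euclidean_representation)

lemmas Cinf_on_mult = Cinf_on_bilinear[OF bounded_bilinear_mult]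
  and Cinf_on_scaleR = Cinf_on_bilinear[OF bounded_bilinear_scaleR]
  and Cinf_on_inner = Cinf_on_bilinear[OF bounded_bilinear_inner]
  and Cinf_on_fst = Cinf_on_bounded_linear[OF bounded_linear_fst]
  and Cinf_on_snd = Cinf_on_bounded_linear[OF bounded_linear_snd]
  and Cinf_on_Re = Cinf_on_bounded_linear[OF bounded_linear_Re]
  and Cinf_on_Im = Cinf_on_bounded_linear[OF bounded_linear_Im]
  and Cinf_on_cnj = Cinf_on_bounded_linear[OF bounded_linear_cnj]
  and Cinf_on_of_real = Cinf_on_bounded_linear[OF bounded_linear_of_real]
  and Cinf_on_vec_nth = Cinf_on_bounded_linear[OF bounded_linear_vec_nth]

lemma Cinf_on_Pair:
  assumes "open S" "Cinf_on S f" "Cinf_on S g"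
  shows "Cinf_on S (\<lambda>x. (f x, g x))"
proof -
  have "Cinf_on S (\<lambda>x. (f x, 0) + (0, g x))"
    by (intro Cinf_on_add assms Cinf_on_bounded_linear[OF bounded_linear_Pair]
        Cinf_on_bounded_linear[of "\<lambda>x. (x, 0)"] Cinf_on_bounded_linear[of "\<lambda>x. (0, x)"]
        bounded_linear_Pair bounded_linear_ident bounded_linear_zero)
  then show ?thesis by simp
qed

lemma Cinf_on_vec_lambda:
  fixes f :: "'a::euclidean_space \<Rightarrow> 'n::finite \<Rightarrow> 'b::euclidean_space"
  assumes "open S" "\<And>i. Cinf_on S (\<lambda>x. f x i)"
  shows "Cinf_on S (\<lambda>x. \<chi> i. f x i)"
proof (rule Cinf_on_componentwise[OF assms(1)])
  fix b :: "'b^'n" assume "b \<in> Basis"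
  then obtain i u where b: "b = axis i u" by (auto simp: Basis_vec_def)
  show "Cinf_on S (\<lambda>x. (\<chi> i. f x i) \<bullet> b)"
    unfolding b inner_axis using Cinf_on_bounded_linear[OF bounded_linear_inner_left assms(1) assms(2)] by simp
qed

lemma Cinf_on_prod:
  fixes f :: "'i \<Rightarrow> 'a::euclidean_space \<Rightarrow> real"
  assumes "open S" "\<And>i. i \<in> I \<Longrightarrow> Cinf_on S (f i)"
  shows "Cinf_on S (\<lambda>x. \<Prod>i\<in>I. f i x)"
  using assms(2)
  by (induction I rule: infinite_finite_induct) (auto intro: Cinf_on_mult Cinf_on_const assms(1))

lemma Cinf_on_power:
  fixes f :: "'a::euclidean_space \<Rightarrow> 'b::{euclidean_space, real_normed_algebra_1}"
  shows "open S \<Longrightarrow> Cinf_on S f \<Longrightarrow> Cinf_on S (\<lambda>x. f x ^ n)"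
  by (induction n) (auto intro: Cinf_on_mult Cinf_on_const)

text \<open>The real derivative in direction v multiplies v by the complex derivative, which is
  again holomorphic, so the induction stays within holomorphic functions. Through real and imaginary
  parts this is also the source of smoothness of real quotients, square roots, sine and
  cosine.\<close>

lemma holomorphic_imp_Cinf_on:
  assumes "f holomorphic_on S" "open S"
  shows "Cinf_on S f"
proof -
  have "Ck_on k S f" for k
    using assms(1)
  proof (induction k arbitrary: f)
    case 0
    then show ?case by (simp add: holomorphic_on_imp_continuous_on)
  next
    case (Suc k)
    have "(f has_derivative (\<lambda>v. deriv f x * v)) (at x)" if "x \<in> S" for x
      using holomorphic_derivI[OF Suc.prems assms(2) that, of UNIV] by (simp add: has_field_derivative_def)
    then show ?case
      by (rule Ck_on_SucI[OF assms(2) _ Ck_on_bilinear[OF bounded_bilinear_mult assms(2) Suc.IH[OF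
              holomorphic_deriv[OF Suc.prems assms(2)]] Ck_on_const[OF assms(2)]]])
  qed
  then show ?thesis by (simp add: Cinf_on_def)
qed

lemma Cinf_on_holomorphic_compose:
  "g holomorphic_on T \<Longrightarrow> open T \<Longrightarrow> open S \<Longrightarrow> f ` S \<subseteq> T \<Longrightarrow> Cinf_on S f \<Longrightarrow> Cinf_on S (\<lambda>x. g (f x))"
  by (rule Cinf_on_compose[OF holomorphic_imp_Cinf_on])

lemma Cinf_on_inverse:
  fixes f :: "'a::euclidean_space \<Rightarrow> complex"
  assumes "open S" "Cinf_on S f" "\<And>x. x \<in> S \<Longrightarrow> f x \<noteq> 0"
  shows "Cinf_on S (\<lambda>x. inverse (f x))"
  by (rule Cinf_on_holomorphic_compose[where T = "- {0}"])
    (use assms in \<open>auto intro!: holomorphic_intros\<close>)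

lemma Cinf_on_divide:
  fixes f g :: "'a::euclidean_space \<Rightarrow> complex"
  assumes "open S" "Cinf_on S f" "Cinf_on S g" "\<And>x. x \<in> S \<Longrightarrow> g x \<noteq> 0"
  shows "Cinf_on S (\<lambda>x. f x / g x)"
  using Cinf_on_mult[OF assms(1,2) Cinf_on_inverse[OF assms(1,3,4)]] by (simp add: field_simps)

lemma Cinf_on_divide_real:
  fixes f g :: "'a::euclidean_space \<Rightarrow> real"
  assumes "open S" "Cinf_on S f" "Cinf_on S g" "\<And>x. x \<in> S \<Longrightarrow> g x \<noteq> 0"
  shows "Cinf_on S (\<lambda>x. f x / g x)"
proof -
  have "Cinf_on S (\<lambda>x. Re (complex_of_real (f x) / complex_of_real (g x)))"
    by (intro Cinf_on_Re Cinf_on_divide Cinf_on_of_real assms) (use assms in auto)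
  then show ?thesis by simp
qed

lemma Cinf_on_csqrt:
  assumes "open S" "Cinf_on S f" "\<And>x. x \<in> S \<Longrightarrow> f x \<notin> \<real>\<^sub>\<le>\<^sub>0"
  shows "Cinf_on S (\<lambda>x. csqrt (f x))"
  by (rule Cinf_on_holomorphic_compose[where T = "- \<real>\<^sub>\<le>\<^sub>0"])
    (use assms in \<open>auto intro!: holomorphic_intros\<close>)

lemma Cinf_on_sqrt:
  fixes f :: "'a::euclidean_space \<Rightarrow> real"
  assumes "open S" "Cinf_on S f" "\<And>x. x \<in> S \<Longrightarrow> f x > 0"
  shows "Cinf_on S (\<lambda>x. sqrt (f x))"
proof (rule Cinf_on_cong[OF _ assms(1)])
  show "Cinf_on S (\<lambda>x. Re (csqrt (complex_of_real (f x))))"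
    by (intro Cinf_on_Re Cinf_on_csqrt Cinf_on_of_real assms) (use assms(3) in \<open>auto simp: not_le\<close>)
  show "Re (csqrt (complex_of_real (f x))) = sqrt (f x)" if "x \<in> S" for x
    using assms(3)[OF that] by simp
qed

lemma Cinf_on_exp:
  fixes f :: "'a::euclidean_space \<Rightarrow> complex"
  shows "open S \<Longrightarrow> Cinf_on S f \<Longrightarrow> Cinf_on S (\<lambda>x. exp (f x))"
  by (rule Cinf_on_holomorphic_compose[of exp UNIV]) (auto intro!: holomorphic_intros)

lemma Cinf_on_Ln:
  assumes "open S" "Cinf_on S f" "\<And>x. x \<in> S \<Longrightarrow> f x \<notin> \<real>\<^sub>\<le>\<^sub>0"
  shows "Cinf_on S (\<lambda>x. Ln (f x))"
  by (rule Cinf_on_holomorphic_compose[where T = "- \<real>\<^sub>\<le>\<^sub>0"])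
    (use assms in \<open>auto intro!: holomorphic_intros\<close>)

lemma Cinf_on_cis:
  assumes "open S" "Cinf_on S f"
  shows "Cinf_on S (\<lambda>x. cis (f x))"
  unfolding cis_conv_exp by (intro Cinf_on_exp Cinf_on_mult Cinf_on_of_real Cinf_on_const assms)

lemma Cinf_on_cos:
  fixes f :: "'a::euclidean_space \<Rightarrow> real"
  assumes "open S" "Cinf_on S f"
  shows "Cinf_on S (\<lambda>x. cos (f x))"
  using Cinf_on_Re[OF assms(1) Cinf_on_cis[OF assms]] by simp

lemma Cinf_on_sin:
  fixes f :: "'a::euclidean_space \<Rightarrow> real"
  assumes "open S" "Cinf_on S f"
  shows "Cinf_on S (\<lambda>x. sin (f x))"
  using Cinf_on_Im[OF assms(1) Cinf_on_cis[OF assms]] by simp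

lemmas Cinf_intros = Cinf_on_const Cinf_on_id Cinf_on_add Cinf_on_diff Cinf_on_uminus Cinf_on_mult
  Cinf_on_scaleR Cinf_on_inner Cinf_on_fst Cinf_on_snd Cinf_on_Re Cinf_on_Im Cinf_on_cnj
  Cinf_on_of_real Cinf_on_vec_nth Cinf_on_Pair Cinf_on_vec_lambda Cinf_on_sum Cinf_on_prod
  Cinf_on_power Cinf_on_exp Cinf_on_cis Cinf_on_cos Cinf_on_sin

lemma Cinf_on_Complex:
  assumes "open S" "Cinf_on S f" "Cinf_on S g"
  shows "Cinf_on S (\<lambda>x. Complex (f x) (g x))"
proof -
  have "Cinf_on S (\<lambda>x. complex_of_real (f x) + \<i> * complex_of_real (g x))"
    by (intro Cinf_intros assms)
  then show ?thesis by (simp add: Complex_eq)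
qed

lemma Cinf_on_imp_smooth_on: "Cinf_on S f \<Longrightarrow> open S \<Longrightarrow> T \<subseteq> S \<Longrightarrow> smooth_on T f"
  unfolding smooth_on_def by blast

lemma smooth_onI:
  assumes "\<And>x. x \<in> S \<Longrightarrow> \<exists>U F. open U \<and> x \<in> U \<and> Cinf_on U F \<and> (\<forall>y\<in>U \<inter> S. F y = f y)"
  shows "smooth_on S f"
  using assms unfolding smooth_on_def by blast

lemma smooth_onE:
  assumes "smooth_on S f" "x \<in> S"
  obtains U F where "open U" "x \<in> U" "Cinf_on U F" "\<forall>y\<in>U \<inter> S. F y = f y"
proof -
  obtain U F where "open U \<and> x \<in> U \<and> Cinf_on U F \<and> (\<forall>y\<in>U \<inter> S. F y = f y)"
    using bspec[OF assms(1)[unfolded smooth_on_def] assms(2)] by (elim exE)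
  then show thesis by (intro that[of U F]) auto
qed

lemma smooth_on_subset:
  assumes "smooth_on S f" "T \<subseteq> S"
  shows "smooth_on T f"
proof (rule smooth_onI)
  fix x assume "x \<in> T"
  then have "x \<in> S" using assms(2) by blast
  obtain U F where "open U" "x \<in> U" "Cinf_on U F" "\<forall>y\<in>U \<inter> S. F y = f y"
    by (rule smooth_onE[OF assms(1) \<open>x \<in> S\<close>])
  then show "\<exists>U F. open U \<and> x \<in> U \<and> Cinf_on U F \<and> (\<forall>y\<in>U \<inter> T. F y = f y)"
    using assms(2) by (intro exI[of _ U] exI[of _ F]) auto
qed

lemma smooth_on_cong: "smooth_on S f \<Longrightarrow> (\<And>x. x \<in> S \<Longrightarrow> f x = g x) \<Longrightarrow> smooth_on S g"
  unfolding smooth_on_def by simp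

lemma smooth_on_imp_continuous_on:
  assumes "smooth_on S f"
  shows "continuous_on S f"
  unfolding continuous_on_eq_continuous_within
proof
  fix x assume "x \<in> S"
  obtain U F where U: "open U" "x \<in> U" "Cinf_on U F" "\<forall>y\<in>U \<inter> S. F y = f y"
    by (rule smooth_onE[OF assms \<open>x \<in> S\<close>])
  have "continuous_on (S \<inter> U) f"
    using continuous_on_subset[OF Cinf_on_imp_continuous_on[OF U(3)], of "S \<inter> U"] U(4)
    using continuous_on_cong[of "S \<inter> U" "S \<inter> U" F f] by auto
  then have "continuous (at x within S \<inter> U) f"
    using U(2) \<open>x \<in> S\<close> by (simp add: continuous_on_eq_continuous_within)
  moreover have "at x within S \<inter> U = at x within S"
    by (rule at_within_nhd[OF U(2,1)]) auto
  ultimately show "continuous (at x within S) f" by simp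
qed

text \<open>Every clause of the recursion is a local condition. This is what glues the local
  extensions in \<open>smooth_on\<close> to smoothness on an open set.\<close>

lemma Ck_on_local:
  assumes "\<And>x. x \<in> S \<Longrightarrow> \<exists>U. open U \<and> x \<in> U \<and> Ck_on k U f"
  shows "Ck_on k S f"
  using assms
proof (induction k arbitrary: f)
  case 0
  then show ?case
    by (metis Ck_on.simps(1) continuous_at_imp_continuous_on continuous_on_eq_continuous_at)
next
  case (Suc k)
  have "f differentiable (at x) \<and> (\<exists>U. open U \<and> x \<in> U \<and> Ck_on k U (\<lambda>x. frechet_derivative f (at x) v))"
    if xS: "x \<in> S" for x v
  proof -
    obtain U where "open U" "x \<in> U" "Ck_on (Suc k) U f" using Suc.prems[OF xS] by blast
    then show ?thesis by auto
  qed
  then show ?case using Suc.IH by simp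
qed

lemma smooth_on_open: "open S \<Longrightarrow> smooth_on S f \<longleftrightarrow> Cinf_on S f"
proof
  assume "open S" "smooth_on S f"
  show "Cinf_on S f"
    unfolding Cinf_on_def
  proof (intro allI Ck_on_local)
    fix k x assume "x \<in> S"
    obtain U F where U: "open U" "x \<in> U" "Cinf_on U F" "\<forall>y\<in>U \<inter> S. F y = f y"
      by (rule smooth_onE[OF \<open>smooth_on S f\<close> \<open>x \<in> S\<close>])
    have "Ck_on k (U \<inter> S) f"
      using Ck_on_subset[of k U F "U \<inter> S"] U \<open>open S\<close>
      by (intro Ck_on_cong[of "U \<inter> S" F f]) (auto simp: Cinf_on_def)
    then show "\<exists>U. open U \<and> x \<in> U \<and> Ck_on k U f"
      using U \<open>x \<in> S\<close> \<open>open S\<close> by blast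
  qed
qed (auto intro: Cinf_on_imp_smooth_on)

lemma smooth_on_compose:
  assumes "smooth_on T g" "smooth_on S f" "f ` S \<subseteq> T"
  shows "smooth_on S (\<lambda>x. g (f x))"
proof (rule smooth_onI)
  fix x assume "x \<in> S"
  then have "f x \<in> T" using assms(3) by blast
  obtain U F where U: "open U" "x \<in> U" "Cinf_on U F" "\<forall>y\<in>U \<inter> S. F y = f y"
    by (rule smooth_onE[OF assms(2) \<open>x \<in> S\<close>])
  obtain V G where V: "open V" "f x \<in> V" "Cinf_on V G" "\<forall>y\<in>V \<inter> T. G y = g y"
    by (rule smooth_onE[OF assms(1) \<open>f x \<in> T\<close>])
  let ?W = "U \<inter> F -` V"
  have "open ?W"
    using Cinf_on_open_preimage[OF U(3) U(1) V(1)] .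
  moreover have "Cinf_on ?W (\<lambda>x. G (F x))"
    by (rule Cinf_on_compose[OF V(3) Cinf_on_subset[OF U(3)] \<open>open ?W\<close> V(1)]) auto
  moreover have "x \<in> ?W" using U V \<open>x \<in> S\<close> by auto
  moreover have "\<forall>y\<in>?W \<inter> S. G (F y) = g (f y)"
    using U(4) V(4) assms(3) by auto
  ultimately show "\<exists>U F. open U \<and> x \<in> U \<and> Cinf_on U F \<and> (\<forall>y\<in>U \<inter> S. F y = g (f y))"
    by (intro exI[of _ ?W] exI[of _ "\<lambda>x. G (F x)"]) blast
qed

text \<open>Openness of the image is invariance of domain. The inverse g satisfies Dg(y) =
  Dh(g(y))^-1, and Cramer's rule makes the right side a smooth function of g(y); each order of
  differentiability of g therefore yields the next.\<close>

lemma Cinf_on_inverse_function: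
  fixes h :: "real^'n \<Rightarrow> real^'n"
  assumes "open W" "Cinf_on W h" "inj_on h W"
    and surj: "\<And>w. w \<in> W \<Longrightarrow> surj (frechet_derivative h (at w))"
  shows "open (h ` W)" "Cinf_on (h ` W) (inv_into W h)"
proof -
  let ?g = "inv_into W h" and ?A = "\<lambda>w. matrix (frechet_derivative h (at w))"
  note cont = Cinf_on_imp_continuous_on[OF assms(2)]
  show op: "open (h ` W)" by (rule invariance_of_domain[OF cont assms(1,3)])
  have lin: "linear (frechet_derivative h (at w))" if "w \<in> W" for w
    using Cinf_on_has_derivative[OF assms(2) that] has_derivative_linear by blast
  have Aw: "?A w *v v = frechet_derivative h (at w) v" if "w \<in> W" for w v
    using lin[OF that] by (simp add: matrix_works)
  have det: "det (?A w) \<noteq> 0" if "w \<in> W" for w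
    using linear_surj_imp_inj[OF lin[OF that] surj[OF that]] det_nz_iff_inj[OF lin[OF that]] by simp
  define D where "D w v = (\<chi> k. det (\<chi> i j. if j = k then v $ i else ?A w $ i $ j) / det (?A w))" for w v
  have D: "?A w *v u = v \<longleftrightarrow> u = D w v" if "w \<in> W" for w u v
    unfolding D_def by (rule cramer[OF det[OF that]])
  have smD: "Cinf_on W (\<lambda>w. D w v)" for v
  proof -
    have entry: "Cinf_on W (\<lambda>w. ?A w $ i $ j)" for i j
      unfolding matrix_def by (simp, intro Cinf_on_vec_nth Cinf_on_frechet_derivative assms)
    have "Cinf_on W (\<lambda>w. det (?A w))"
      unfolding det_def by (intro Cinf_on_sum Cinf_on_mult Cinf_on_prod Cinf_on_const entry assms(1))
    moreover have "Cinf_on W (\<lambda>w. det (\<chi> i j. if j = k then v $ i else ?A w $ i $ j))" for k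
    proof -
      have "Cinf_on W (\<lambda>w. if j = k then v $ i else ?A w $ i $ j)" for i j
        by (cases "j = k") (simp_all add: Cinf_on_const entry assms(1))
      then show ?thesis
        unfolding det_def by (simp, intro Cinf_on_sum Cinf_on_mult Cinf_on_prod Cinf_on_const assms(1))
    qed
    ultimately show ?thesis
      unfolding D_def by (intro Cinf_on_vec_lambda Cinf_on_divide_real assms(1) det)
  qed
  have der: "(?g has_derivative D (?g y)) (at y)" if "y \<in> h ` W" for y
  proof -
    have w: "?g y \<in> W" "h (?g y) = y" using that by (auto intro: inv_into_into f_inv_into_f)
    have "(?g has_derivative D (?g y)) (at (h (?g y)))"
    proof (rule has_derivative_inverse_strong[OF assms(1) w(1) cont])
      show "?g (h x) = x" if "x \<in> W" for x using assms(3) that by simp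
      show "(h has_derivative frechet_derivative h (at (?g y))) (at (?g y))"
        using Cinf_on_has_derivative[OF assms(2) w(1)] .
      show "frechet_derivative h (at (?g y)) \<circ> D (?g y) = id"
        using D[OF w(1)] Aw[OF w(1)] by auto
    qed
    then show ?thesis using w by simp
  qed
  have "Ck_on k (h ` W) ?g" for k
  proof (induction k)
    case 0
    have "continuous_on (h ` W) ?g"
      by (rule continuous_at_imp_continuous_on) (use der has_derivative_continuous in blast)
    then show ?case by simp
  next
    case (Suc k)
    have "Ck_on k (h ` W) (\<lambda>x. D (?g x) v)" for v
      using smD[of v] by (intro Ck_on_compose[OF op assms(1) _ _ Suc]) (auto simp: Cinf_on_def inv_into_into)
    then show ?case by (intro Ck_on_SucI[OF op der])
  qed
  then show "Cinf_on (h ` W) ?g" by (simp add: Cinf_on_def)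
qed

section \<open>Curves, tangent vectors and quotients\<close>

lemma smooth_on_curve:
  fixes \<gamma> :: "real \<Rightarrow> 'a::euclidean_space"
  assumes "smooth_on I \<gamma>" "open I" "t \<in> I"
  shows "(\<gamma> has_vector_derivative vector_derivative \<gamma> (at t)) (at t)"
    and "Cinf_on I (\<lambda>t. vector_derivative \<gamma> (at t))"
proof -
  have C: "Cinf_on I \<gamma>" using assms smooth_on_open by blast
  have d: "(\<gamma> has_derivative frechet_derivative \<gamma> (at t)) (at t)" if "t \<in> I" for t
    using Cinf_on_has_derivative[OF C that] .
  then show D: "(\<gamma> has_vector_derivative vector_derivative \<gamma> (at t)) (at t)"
    using assms(3) differentiableI vector_derivative_works by blast
  have "frechet_derivative \<gamma> (at t) 1 = vector_derivative \<gamma> (at t)" if "t \<in> I" for t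
    using d[OF that] differentiableI frechet_derivative_eq_vector_derivative by (metis scaleR_one)
  then show "Cinf_on I (\<lambda>t. vector_derivative \<gamma> (at t))"
    by (rule Cinf_on_cong[OF Cinf_on_frechet_derivative[OF C, of 1] assms(2)])
qed

text \<open>The reparametrisation \<open>s \<mapsto> (\<epsilon>/2) sin (2s/\<epsilon>)\<close> squeezes the whole line into \<open>[-\<epsilon>/2, \<epsilon>/2]\<close>
  and has derivative 1 at 0.\<close>

lemma tangent_spaceI:
  fixes \<eta> :: "real \<Rightarrow> 'a::euclidean_space"
  assumes "\<epsilon> > 0" "Cinf_on {-\<epsilon><..<\<epsilon>} \<eta>" "\<eta> ` {-\<epsilon><..<\<epsilon>} \<subseteq> S" "\<eta> 0 = x"
    and "(\<eta> has_vector_derivative v) (at 0)"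
  shows "v \<in> tangent_space S x"
proof -
  let ?r = "\<lambda>s. (\<epsilon>/2) * sin ((2/\<epsilon>) * s)"
  have r: "?r s \<in> {-\<epsilon><..<\<epsilon>}" for s
  proof -
    have "\<bar>?r s\<bar> \<le> \<epsilon>/2" using assms(1) abs_sin_le_one[of "(2/\<epsilon>) * s"] by (simp add: abs_mult)
    then show ?thesis unfolding greaterThanLessThan_iff using assms(1) by linarith
  qed
  have "Cinf_on UNIV ?r" by (intro Cinf_intros open_UNIV)
  then have "Cinf_on UNIV (\<lambda>s. \<eta> (?r s))"
    by (rule Cinf_on_compose[OF assms(2)]) (use r in auto)
  then have 1: "smooth_on {-1<..<1} (\<lambda>s. \<eta> (?r s))"
    by (rule Cinf_on_imp_smooth_on) auto
  have "(?r has_vector_derivative 1) (at 0)"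
    using assms(1) by (auto intro!: derivative_eq_intros simp flip: has_real_derivative_iff_has_vector_derivative)
  then have "(\<eta> \<circ> ?r has_vector_derivative 1 *\<^sub>R v) (at 0)"
    by (rule vector_diff_chain_at) (use assms(5) in simp)
  then have "vector_derivative (\<lambda>s. \<eta> (?r s)) (at 0) = v"
    by (simp add: o_def vector_derivative_at)
  then show ?thesis
    unfolding tangent_space_def
    using 1 r assms(3,4) by (intro CollectI exI[of _ "\<lambda>s. \<eta> (?r s)"]) auto
qed

lemma tangent_spaceE:
  fixes S :: "'a::euclidean_space set"
  assumes "v \<in> tangent_space S x"
  obtains \<gamma> where "Cinf_on {-1<..<1} \<gamma>" "\<gamma> ` {-1<..<1} \<subseteq> S" "\<gamma> (0::real) = x"
    "(\<gamma> has_vector_derivative v) (at 0)"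
proof -
  obtain \<gamma> :: "real \<Rightarrow> 'a" where g: "v = vector_derivative \<gamma> (at 0)" "smooth_on {-1<..<1} \<gamma>"
    "\<gamma> ` {-1<..<1} \<subseteq> S" "\<gamma> 0 = x"
    using assms unfolding tangent_space_def by blast
  show thesis
    by (rule that[of \<gamma>]) (use g smooth_on_open[of "{-1<..<1}" \<gamma>] smooth_on_curve(1)[OF g(2), of 0] in auto)
qed

lemma curve_stays_in_open:
  fixes \<gamma> :: "real \<Rightarrow> 'a::euclidean_space"
  assumes "Cinf_on {-1<..<1} \<gamma>" "open U" "\<gamma> 0 \<in> U"
  obtains \<epsilon> where "0 < \<epsilon>" "\<epsilon> \<le> 1" "\<gamma> ` {-\<epsilon><..<\<epsilon>} \<subseteq> U"
proof -
  have "open ({-1<..<1} \<inter> \<gamma> -` U)"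
    by (rule Cinf_on_open_preimage[OF assms(1) _ assms(2)]) simp
  moreover have "0 \<in> {-1<..<1} \<inter> \<gamma> -` U" using assms(3) by simp
  ultimately obtain e where e: "e > 0" "ball 0 e \<subseteq> {-1<..<1} \<inter> \<gamma> -` U"
    using open_contains_ball by blast
  show thesis
  proof (rule that[of "min e 1"])
    show "\<gamma> ` {- min e 1<..<min e 1} \<subseteq> U"
      using e by (force simp: ball_def dist_real_def)
  qed (use e in auto)
qed

text \<open>Curves are pushed forward by F. Only a short piece of a curve is known to stay in U,
  which suffices because \<open>tangent_spaceI\<close> accepts curves on any symmetric interval
  around 0.\<close>

lemma tangent_space_image:
  assumes "v \<in> tangent_space S x" "open U" "x \<in> U" "Cinf_on U F" "F ` (U \<inter> S) \<subseteq> T"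
  shows "frechet_derivative F (at x) v \<in> tangent_space T (F x)"
proof -
  obtain \<gamma> where g: "Cinf_on {-1<..<1} \<gamma>" "\<gamma> ` {-1<..<1} \<subseteq> S" "\<gamma> (0::real) = x"
    "(\<gamma> has_vector_derivative v) (at 0)"
    using tangent_spaceE[OF assms(1)] .
  obtain \<epsilon> where e: "0 < \<epsilon>" "\<epsilon> \<le> 1" "\<gamma> ` {-\<epsilon><..<\<epsilon>} \<subseteq> U"
    by (rule curve_stays_in_open[OF g(1) assms(2)]) (use g(3) assms(3) in auto)
  show ?thesis
  proof (rule tangent_spaceI[OF e(1)])
    show "Cinf_on {-\<epsilon><..<\<epsilon>} (\<lambda>t. F (\<gamma> t))"
      by (rule Cinf_on_compose[OF assms(4) Cinf_on_subset[OF g(1)]]) (use e assms(2) in auto)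
    show "(\<lambda>t. F (\<gamma> t)) ` {-\<epsilon><..<\<epsilon>} \<subseteq> T"
      using e g(2) assms(5) by force
    have "(F has_derivative frechet_derivative F (at x)) (at (\<gamma> 0))"
      using Cinf_on_has_derivative[OF assms(4,3)] g(3) by simp
    from vector_derivative_diff_chain_within[OF g(4), of F, OF has_derivative_at_withinI[OF this]]
    show "((\<lambda>t. F (\<gamma> t)) has_vector_derivative frechet_derivative F (at x) v) (at 0)"
      by (simp add: o_def)
  qed (simp add: g)
qed

text \<open>F - G maps S near x into {0}, and a tangent vector to a single point vanishes. Two
  extensions of a map on S may thus be interchanged along S, although their derivatives can differ
  in other directions.\<close>

lemma frechet_derivative_tangent_cong:
  assumes "v \<in> tangent_space S x" "open U" "x \<in> U" "Cinf_on U F" "Cinf_on U G"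
    and "\<And>y. y \<in> U \<inter> S \<Longrightarrow> F y = G y"
  shows "frechet_derivative F (at x) v = frechet_derivative G (at x) v"
proof -
  have D: "frechet_derivative (\<lambda>y. F y - G y) (at x) = (\<lambda>v. frechet_derivative F (at x) v - frechet_derivative G (at x) v)"
    using has_derivative_diff[OF Cinf_on_has_derivative[OF assms(4,3)] Cinf_on_has_derivative[OF assms(5,3)]]
    by (metis frechet_derivative_at)
  have "frechet_derivative (\<lambda>y. F y - G y) (at x) v \<in> tangent_space {0} (F x - G x)"
    by (rule tangent_space_image[OF assms(1-3) Cinf_on_diff[OF assms(2,4,5)]]) (use assms(6) in auto)
  then obtain \<gamma> where g: "\<gamma> ` {-1<..<1} \<subseteq> {0}"
    "(\<gamma> has_vector_derivative frechet_derivative F (at x) v - frechet_derivative G (at x) v) (at (0::real))"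
    unfolding D by (rule tangent_spaceE)
  have "((\<lambda>_. 0) has_vector_derivative frechet_derivative F (at x) v - frechet_derivative G (at x) v) (at (0::real))"
    by (rule has_vector_derivative_transform_within_open[OF g(2), of "{-1<..<1}"]) (use g(1) in \<open>auto simp: image_subset_iff\<close>)
  then show ?thesis
    using vector_derivative_unique_at[OF has_vector_derivative_const[of 0]] by fastforce
qed

lemma frechet_derivative_compose_Cinf:
  assumes "Cinf_on V G" "Cinf_on U F" "x \<in> U" "F x \<in> V"
  shows "frechet_derivative (\<lambda>y. G (F y)) (at x) v = frechet_derivative G (at (F x)) (frechet_derivative F (at x) v)"
  using has_derivative_compose[OF Cinf_on_has_derivative[OF assms(2,3)] Cinf_on_has_derivative[OF assms(1,4)]]
  by (metis frechet_derivative_at)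

text \<open>The germ at x of a smooth map from X to Y over a common quotient, given by an extension
  to an ambient neighbourhood. The value at x is prescribed so that lifts in opposite directions can
  be matched at the same pair of points.\<close>

definition lift_at ::
    "'a::euclidean_space set \<Rightarrow> ('a \<Rightarrow> 'q) \<Rightarrow> 'b::euclidean_space set \<Rightarrow> ('b \<Rightarrow> 'q) \<Rightarrow> 'a \<Rightarrow> 'b \<Rightarrow> bool" where
  "lift_at X \<pi> Y \<rho> x y \<longleftrightarrow> (\<exists>U \<Phi>. open U \<and> x \<in> U \<and> Cinf_on U \<Phi> \<and> \<Phi> x = y \<and>
     (\<forall>x'\<in>U \<inter> X. \<Phi> x' \<in> Y \<and> \<rho> (\<Phi> x') = \<pi> x'))"

lemma lift_atE:
  assumes "lift_at X \<pi> Y \<rho> x y"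
  obtains U \<Phi> where "open U" "x \<in> U" "Cinf_on U \<Phi>" "\<Phi> x = y" "\<forall>x'\<in>U \<inter> X. \<Phi> x' \<in> Y \<and> \<rho> (\<Phi> x') = \<pi> x'"
  using assms unfolding lift_at_def by (elim exE conjE)

lemma topspace_quotient_top: "topspace (quotient_top X \<pi> (\<pi> ` X)) = \<pi> ` X"
proof
  show "topspace (quotient_top X \<pi> (\<pi> ` X)) \<subseteq> \<pi> ` X"
    using openin_topspace[of "quotient_top X \<pi> (\<pi> ` X)"] unfolding openin_quotient_top by blast
  have "{x \<in> X. \<pi> x \<in> \<pi> ` X} = X" by blast
  then have "openin (quotient_top X \<pi> (\<pi> ` X)) (\<pi> ` X)"
    by (simp add: openin_quotient_top)
  then show "\<pi> ` X \<subseteq> topspace (quotient_top X \<pi> (\<pi> ` X))"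
    by (rule openin_subset)
qed

lemma openin_quotient_top_subset: "openin (quotient_top X \<pi> Q) U \<Longrightarrow> U \<subseteq> Q"
  unfolding openin_quotient_top by (rule conjunct1)

text \<open>Around each of its points the set contains the preimage, under a lift, of the
  corresponding open subset of Y.\<close>

lemma lift_openin_preimage:
  assumes "\<And>x. x \<in> X \<Longrightarrow> \<pi> x \<in> U \<Longrightarrow> \<exists>y\<in>Y. lift_at X \<pi> Y \<rho> x y"
    and "openin (top_of_set Y) {y \<in> Y. \<rho> y \<in> U}"
  shows "openin (top_of_set X) {x \<in> X. \<pi> x \<in> U}"
proof (subst openin_subopen, intro ballI)
  fix x assume x: "x \<in> {x \<in> X. \<pi> x \<in> U}"
  then obtain y where "y \<in> Y" "lift_at X \<pi> Y \<rho> x y" using assms(1) by blast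
  obtain O' \<Phi> where O: "open O'" "x \<in> O'" "Cinf_on O' \<Phi>" "\<Phi> x = y"
    "\<forall>x'\<in>O' \<inter> X. \<Phi> x' \<in> Y \<and> \<rho> (\<Phi> x') = \<pi> x'"
    by (rule lift_atE[OF \<open>lift_at X \<pi> Y \<rho> x y\<close>])
  obtain T where T: "open T" "{y \<in> Y. \<rho> y \<in> U} = Y \<inter> T"
    using assms(2) unfolding openin_open by blast
  have "open (O' \<inter> \<Phi> -` T)"
    by (rule Cinf_on_open_preimage[OF O(3) O(1) T(1)])
  moreover have "y \<in> {y \<in> Y. \<rho> y \<in> U}" using x O(2,4,5) by auto
  then have "x \<in> X \<inter> (O' \<inter> \<Phi> -` T)" unfolding T(2) using x O(2,4) by auto
  moreover have "X \<inter> (O' \<inter> \<Phi> -` T) \<subseteq> {x \<in> X. \<pi> x \<in> U}" using O(5) T(2) by force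
  ultimately show "\<exists>T. openin (top_of_set X) T \<and> x \<in> T \<and> T \<subseteq> {x \<in> X. \<pi> x \<in> U}"
    by (intro exI[of _ "X \<inter> (O' \<inter> \<Phi> -` T)"]) (simp add: openin_open_Int)
qed

lemma submersion_onE:
  assumes "submersion_on S f" "x \<in> S"
  obtains U F where "open U" "x \<in> U" "Cinf_on U F" "\<forall>y\<in>U \<inter> S. F y = f y"
    "frechet_derivative F (at x) ` tangent_space S x = UNIV"
  using bspec[OF assms(1)[unfolded submersion_on_def] assms(2)] by (elim exE conjE)

lemma submersion_onI:
  assumes "\<And>x. x \<in> S \<Longrightarrow> \<exists>U F. open U \<and> x \<in> U \<and> Cinf_on U F \<and> (\<forall>y\<in>U \<inter> S. F y = f y) \<and>
        frechet_derivative F (at x) ` tangent_space S x = UNIV"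
  shows "submersion_on S f"
  unfolding submersion_on_def by (rule ballI) (rule assms)

text \<open>If G extends \<phi> \<circ> \<rho> near y, then G \<circ> \<Phi> extends \<phi> \<circ>
  \<pi> near x. To reach a given w, choose v tangent to Y with DG v = w and push it to X by the
  reverse lift \<Psi>. Although \<Phi> \<circ> \<Psi> may move points within fibres, G \<circ>
  \<Phi> \<circ> \<Psi> agrees with G on Y near y, so D\<Psi> v is again sent to w.\<close>

lemma lift_submersion_on:
  assumes lifts: "\<And>x. x \<in> X \<Longrightarrow> \<pi> x \<in> U \<Longrightarrow> \<exists>y\<in>Y. lift_at X \<pi> Y \<rho> x y \<and> lift_at Y \<rho> X \<pi> y x"
    and sub: "submersion_on {y \<in> Y. \<rho> y \<in> U} (\<phi> \<circ> \<rho>)"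
  shows "submersion_on {x \<in> X. \<pi> x \<in> U} (\<phi> \<circ> \<pi>)"
proof (rule submersion_onI)
  fix x assume x: "x \<in> {x \<in> X. \<pi> x \<in> U}"
  let ?SX = "{x \<in> X. \<pi> x \<in> U}" and ?SY = "{y \<in> Y. \<rho> y \<in> U}"
  obtain y where y: "y \<in> Y" "lift_at X \<pi> Y \<rho> x y" "lift_at Y \<rho> X \<pi> y x"
    using lifts x by blast
  obtain A \<Phi> where A: "open A" "x \<in> A" "Cinf_on A \<Phi>" "\<Phi> x = y"
    "\<forall>x'\<in>A \<inter> X. \<Phi> x' \<in> Y \<and> \<rho> (\<Phi> x') = \<pi> x'"
    by (rule lift_atE[OF y(2)])
  obtain B \<Psi> where B: "open B" "y \<in> B" "Cinf_on B \<Psi>" "\<Psi> y = x"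
    "\<forall>y'\<in>B \<inter> Y. \<Psi> y' \<in> X \<and> \<pi> (\<Psi> y') = \<rho> y'"
    by (rule lift_atE[OF y(3)])
  have "x \<in> A \<inter> X" using A(2) x by simp
  with A(5) have "\<Phi> x \<in> Y \<and> \<rho> (\<Phi> x) = \<pi> x" by (rule bspec)
  then have ySY: "y \<in> ?SY" using x A(4) by simp
  obtain V G where V: "open V" "y \<in> V" "Cinf_on V G" "\<forall>y'\<in>V \<inter> ?SY. G y' = (\<phi> \<circ> \<rho>) y'"
    "frechet_derivative G (at y) ` tangent_space ?SY y = UNIV"
    by (rule submersion_onE[OF sub ySY])
  let ?A = "A \<inter> \<Phi> -` V" and ?F = "\<lambda>x. G (\<Phi> x)"
  have oA: "open ?A" by (rule Cinf_on_open_preimage[OF A(3) A(1) V(1)])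
  have xA: "x \<in> ?A" using A V by simp
  have CF: "Cinf_on ?A ?F"
    by (rule Cinf_on_compose[OF V(3) Cinf_on_subset[OF A(3)] oA V(1)]) auto
  have F: "?F x' = (\<phi> \<circ> \<pi>) x'" if "x' \<in> ?A" "x' \<in> ?SX" for x'
    using that A(5) V(4) by force
  have oB: "open (B \<inter> \<Psi> -` ?A)" by (rule Cinf_on_open_preimage[OF B(3) B(1) oA])
  have "w \<in> frechet_derivative ?F (at x) ` tangent_space ?SX x" for w
  proof -
    have "w \<in> frechet_derivative G (at y) ` tangent_space ?SY y" unfolding V(5) by (rule UNIV_I)
    then obtain v where v: "v \<in> tangent_space ?SY y" "frechet_derivative G (at y) v = w"
      by (elim imageE) simp
    have "frechet_derivative \<Psi> (at y) v \<in> tangent_space ?SX (\<Psi> y)"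
      by (rule tangent_space_image[OF v(1) B(1-3)]) (use B(5) in auto)
    moreover have "frechet_derivative ?F (at x) (frechet_derivative \<Psi> (at y) v)
        = frechet_derivative (\<lambda>y'. ?F (\<Psi> y')) (at y) v"
      using frechet_derivative_compose_Cinf[OF CF B(3) B(2)] B(4) xA by simp
    moreover have "\<dots> = frechet_derivative G (at y) v"
    proof (rule frechet_derivative_tangent_cong[OF v(1), of "B \<inter> \<Psi> -` ?A \<inter> V"])
      show "Cinf_on (B \<inter> \<Psi> -` ?A \<inter> V) (\<lambda>y'. ?F (\<Psi> y'))"
        by (rule Cinf_on_compose[OF CF Cinf_on_subset[OF B(3)] _ oA]) (use oB V(1) in auto)
      show "Cinf_on (B \<inter> \<Psi> -` ?A \<inter> V) G" by (rule Cinf_on_subset[OF V(3)]) auto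
      show "?F (\<Psi> y') = G y'" if "y' \<in> B \<inter> \<Psi> -` ?A \<inter> V \<inter> ?SY" for y'
      proof -
        have "\<Psi> y' \<in> ?A" "\<Psi> y' \<in> ?SX" using that B(5) by auto
        then have "?F (\<Psi> y') = (\<phi> \<circ> \<pi>) (\<Psi> y')" by (rule F)
        then show ?thesis using that B(5) V(4) by auto
      qed
    qed (use oB V xA B in auto)
    ultimately show ?thesis using v(2) B(4) by (intro image_eqI[of _ _ "frechet_derivative \<Psi> (at y) v"]) simp_all
  qed
  then show "\<exists>U F. open U \<and> x \<in> U \<and> Cinf_on U F \<and> (\<forall>y\<in>U \<inter> ?SX. F y = (\<phi> \<circ> \<pi>) y) \<and>
      frechet_derivative F (at x) ` tangent_space ?SX x = UNIV"
    using oA xA CF F by (intro exI[of _ ?A] exI[of _ ?F]) auto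
qed

text \<open>The two quotients live in different types, so the lifting conditions compare them in the
  second one, with \<open>f \<circ> \<pi>\<close> in place of \<pi>. Lifts are required through
  every pair of points with the same image there.\<close>

locale quotient_iso =
  fixes X :: "'a::euclidean_space set" and \<pi> :: "'a \<Rightarrow> 'q"
    and Y :: "'b::euclidean_space set" and \<rho> :: "'b \<Rightarrow> 'r"
    and f :: "'q \<Rightarrow> 'r" and g :: "'r \<Rightarrow> 'q"
  assumes gf: "x \<in> X \<Longrightarrow> g (f (\<pi> x)) = \<pi> x" and fg: "y \<in> Y \<Longrightarrow> f (g (\<rho> y)) = \<rho> y"
    and f_im: "x \<in> X \<Longrightarrow> f (\<pi> x) \<in> \<rho> ` Y" and g_im: "y \<in> Y \<Longrightarrow> g (\<rho> y) \<in> \<pi> ` X"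
    and lift_f: "x \<in> X \<Longrightarrow> y \<in> Y \<Longrightarrow> f (\<pi> x) = \<rho> y \<Longrightarrow> lift_at X (f \<circ> \<pi>) Y \<rho> x y"
    and lift_g: "x \<in> X \<Longrightarrow> y \<in> Y \<Longrightarrow> f (\<pi> x) = \<rho> y \<Longrightarrow> lift_at Y \<rho> X (f \<circ> \<pi>) y x"
begin

abbreviation "TX \<equiv> quotient_top X \<pi> (\<pi> ` X)"
abbreviation "TY \<equiv> quotient_top Y \<rho> (\<rho> ` Y)"

lemma sym: "quotient_iso Y \<rho> X \<pi> g f"
proof
  fix x y assume xy: "x \<in> Y" "y \<in> X" "g (\<rho> x) = \<pi> y"
  then have e: "f (\<pi> y) = \<rho> x" using fg by metis
  obtain U \<Phi> where U: "open U" "x \<in> U" "Cinf_on U \<Phi>" "\<Phi> x = y" "\<forall>x'\<in>U \<inter> Y. \<Phi> x' \<in> X \<and> (f \<circ> \<pi>) (\<Phi> x') = \<rho> x'"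
    by (rule lift_atE[OF lift_g[OF xy(2,1) e]])
  show "lift_at Y (g \<circ> \<rho>) X \<pi> x y"
    unfolding lift_at_def using U gf by (intro exI[of _ U] exI[of _ \<Phi>]) (metis comp_apply)
  obtain V \<Psi> where V: "open V" "y \<in> V" "Cinf_on V \<Psi>" "\<Psi> y = x" "\<forall>x'\<in>V \<inter> X. \<Psi> x' \<in> Y \<and> \<rho> (\<Psi> x') = (f \<circ> \<pi>) x'"
    by (rule lift_atE[OF lift_f[OF xy(2,1) e]])
  show "lift_at X \<pi> Y (g \<circ> \<rho>) y x"
    unfolding lift_at_def using V gf by (intro exI[of _ V] exI[of _ \<Psi>]) (metis IntD2 comp_apply)
qed (use gf fg f_im g_im in auto)

lemma openin_preimage:
  assumes "openin TY V"
  shows "openin TX {q \<in> \<pi> ` X. f q \<in> V}"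
proof -
  have "openin (top_of_set X) {x \<in> X. (f \<circ> \<pi>) x \<in> V}"
  proof (rule lift_openin_preimage)
    show "openin (top_of_set Y) {y \<in> Y. \<rho> y \<in> V}" using assms openin_quotient_top by blast
    show "\<exists>y\<in>Y. lift_at X (f \<circ> \<pi>) Y \<rho> x y" if "x \<in> X" for x
      using f_im[OF that] lift_f[OF that] by auto
  qed
  moreover have "{x \<in> X. \<pi> x \<in> {q \<in> \<pi> ` X. f q \<in> V}} = {x \<in> X. (f \<circ> \<pi>) x \<in> V}" by auto
  ultimately show ?thesis unfolding openin_quotient_top by auto
qed

lemma continuous_map_f: "continuous_map TX TY f"
  unfolding continuous_map_def topspace_quotient_top using openin_preimage f_im by auto

lemma homeomorphic_maps_fg: "homeomorphic_maps TX TY f g"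
  unfolding homeomorphic_maps_def topspace_quotient_top
  using continuous_map_f quotient_iso.continuous_map_f[OF sym] gf fg by auto

text \<open>The topological part is composition with the homeomorphism f; the submersion part is
  \<open>lift_submersion_on\<close> for the projections \<open>f \<circ> \<pi>\<close> and
  \<open>\<rho>\<close>.\<close>

lemma chart_pull:
  assumes "(V, \<psi>) \<in> quotient_charts Y \<rho> (\<rho> ` Y)"
  shows "({q \<in> \<pi> ` X. f q \<in> V}, \<psi> \<circ> f) \<in> quotient_charts X \<pi> (\<pi> ` X)"
proof -
  let ?U = "{q \<in> \<pi> ` X. f q \<in> V}"
  have V: "openin TY V" "open (\<psi> ` V)"
    "homeomorphic_map (subtopology TY V) (top_of_set (\<psi> ` V)) \<psi>"
    "submersion_on {y \<in> Y. \<rho> y \<in> V} (\<psi> \<circ> \<rho>)"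
    using assms unfolding quotient_charts_def by auto
  have VY: "V \<subseteq> \<rho> ` Y" by (rule openin_quotient_top_subset[OF V(1)])
  have fU: "f ` ?U = V"
  proof
    show "V \<subseteq> f ` ?U"
    proof
      fix r assume "r \<in> V"
      then have "r = f (g r)" "g r \<in> ?U" using VY fg g_im by auto
      then show "r \<in> f ` ?U" by blast
    qed
  qed auto
  have im: "(\<psi> \<circ> f) ` ?U = \<psi> ` V" using fU by (metis image_comp)
  have "homeomorphic_map (subtopology TX ?U) (subtopology TY V) f"
  proof (rule homeomorphic_map_subtopologies)
    show "homeomorphic_map TX TY f" using homeomorphic_maps_fg homeomorphic_map_maps by blast
    have "topspace TX \<inter> ?U = ?U" "topspace TY \<inter> V = V"
      using VY by (auto simp: topspace_quotient_top)
    then show "f ` (topspace TX \<inter> ?U) = topspace TY \<inter> V" using fU by presburger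
  qed
  then have hom: "homeomorphic_map (subtopology TX ?U) (top_of_set (\<psi> ` V)) (\<psi> \<circ> f)"
    using V(3) homeomorphic_map_compose by blast
  have "submersion_on {x \<in> X. (f \<circ> \<pi>) x \<in> V} (\<psi> \<circ> (f \<circ> \<pi>))"
  proof (rule lift_submersion_on[OF _ V(4)])
    show "\<exists>y\<in>Y. lift_at X (f \<circ> \<pi>) Y \<rho> x y \<and> lift_at Y \<rho> X (f \<circ> \<pi>) y x" if "x \<in> X" for x
      using f_im[OF that] lift_f[OF that] lift_g[OF that] by auto
  qed
  moreover have "{x \<in> X. \<pi> x \<in> ?U} = {x \<in> X. (f \<circ> \<pi>) x \<in> V}" by auto
  ultimately have "submersion_on {x \<in> X. \<pi> x \<in> ?U} ((\<psi> \<circ> f) \<circ> \<pi>)" by (metis comp_assoc)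
  then show ?thesis
    unfolding quotient_charts_def using openin_preimage[OF V(1)] V(2) hom im by auto
qed

lemma inv_into_chart_pull:
  assumes "(V, \<psi>) \<in> quotient_charts Y \<rho> (\<rho> ` Y)" "u \<in> \<psi> ` V"
  shows "inv_into {q \<in> \<pi> ` X. f q \<in> V} (\<psi> \<circ> f) u = g (inv_into V \<psi> u)"
proof -
  let ?U = "{q \<in> \<pi> ` X. f q \<in> V}"
  have V: "openin TY V" "homeomorphic_map (subtopology TY V) (top_of_set (\<psi> ` V)) \<psi>"
    using assms unfolding quotient_charts_def by auto
  have VY: "V \<subseteq> \<rho> ` Y" by (rule openin_quotient_top_subset[OF V(1)])
  then have "topspace (subtopology TY V) = V" by (auto simp: topspace_quotient_top)
  then have inj: "inj_on \<psi> V" using V(2) unfolding homeomorphic_map_def by simp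
  let ?r = "inv_into V \<psi> u"
  have r: "?r \<in> V" "\<psi> ?r = u" using assms(2) by (auto intro: inv_into_into f_inv_into_f)
  have fgr: "f (g ?r) = ?r" using r VY fg by auto
  have gr: "g ?r \<in> ?U" using r VY fg g_im by auto
  have "inj_on (\<psi> \<circ> f) ?U"
  proof (rule inj_onI)
    fix a b assume "a \<in> ?U" "b \<in> ?U" "(\<psi> \<circ> f) a = (\<psi> \<circ> f) b"
    then have "f a = f b" "a \<in> \<pi> ` X" "b \<in> \<pi> ` X" using inj by (auto dest: inj_onD)
    then show "a = b" using gf by (metis imageE)
  qed
  from inv_into_f_f[OF this gr] show ?thesis by (simp add: fgr r(2))
qed

end

text \<open>Openness of chart domains and the homeomorphism property are built into
  \<open>quotient_charts\<close>. What is left to check is the topology, that the charts cover, and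
  that they are compatible.\<close>

lemma smooth_manifold_quotient_mfd:
  fixes A :: "('q, 'n::finite) chart set"
  assumes "A = quotient_charts X \<pi> Q"
  shows "smooth_manifold (quotient_mfd X \<pi> Q :: ('q, 'n) mfd) \<longleftrightarrow>
     Hausdorff_space (quotient_top X \<pi> Q) \<and> second_countable (quotient_top X \<pi> Q) \<and>
     (\<forall>q\<in>topspace (quotient_top X \<pi> Q). \<exists>(U, \<phi>)\<in>A. q \<in> U) \<and>
     (\<forall>(U, \<phi>)\<in>A. \<forall>(V, \<psi>)\<in>A. smooth_on (\<phi> ` (U \<inter> V)) (\<psi> \<circ> inv_into U \<phi>))"
proof -
  have "\<forall>(U, \<phi>)\<in>A. openin (quotient_top X \<pi> Q) U \<and> open (\<phi> ` U) \<and>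
        homeomorphic_map (subtopology (quotient_top X \<pi> Q) U) (top_of_set (\<phi> ` U)) \<phi>"
    unfolding assms quotient_charts_def by auto
  moreover have "(topspace (quotient_top X \<pi> Q) = (\<Union>(U, \<phi>)\<in>A. U))
      = (\<forall>q\<in>topspace (quotient_top X \<pi> Q). \<exists>(U, \<phi>)\<in>A. q \<in> U)"
  proof -
    have "(\<Union>(U, \<phi>)\<in>A. U) \<subseteq> topspace (quotient_top X \<pi> Q)"
      unfolding assms quotient_charts_def using openin_subset by blast
    then have "(topspace (quotient_top X \<pi> Q) = (\<Union>(U, \<phi>)\<in>A. U))
        = (topspace (quotient_top X \<pi> Q) \<subseteq> (\<Union>(U, \<phi>)\<in>A. U))" by blast
    then show ?thesis by (simp add: subset_iff case_prod_beta Ball_def)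
  qed
  ultimately show ?thesis
    unfolding smooth_manifold_def quotient_mfd_def second_countable_def assms[symmetric] prod.case
    by - (simp only:, intro iffI; elim conjE; intro conjI; assumption)
qed

lemma smooth_manifold_transition:
  assumes "smooth_manifold (quotient_mfd X \<pi> Q :: ('q, 'n::finite) mfd)"
    and "(U, \<phi> :: 'q \<Rightarrow> real^'n) \<in> quotient_charts X \<pi> Q" "(V, \<psi> :: 'q \<Rightarrow> real^'n) \<in> quotient_charts X \<pi> Q"
  shows "smooth_on (\<phi> ` (U \<inter> V)) (\<psi> \<circ> inv_into U \<phi>)"
proof -
  have "\<forall>(U, \<phi>)\<in>quotient_charts X \<pi> Q. \<forall>(V, \<psi>)\<in>quotient_charts X \<pi> Q.
      smooth_on (\<phi> ` (U \<inter> V)) ((\<psi> :: 'q \<Rightarrow> real^'n) \<circ> inv_into U (\<phi> :: 'q \<Rightarrow> real^'n))"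
    using assms(1) unfolding smooth_manifold_quotient_mfd[OF HOL.refl] by (elim conjE)
  from bspec[OF bspec[OF this assms(2), simplified] assms(3)] show ?thesis by simp
qed

context quotient_iso
begin

text \<open>By symmetry the charts of X can be pulled back to Y along g. The transition maps of X
  are then transition maps of Y, where they are smooth by assumption.\<close>

lemma smooth_manifold_pull:
  assumes "smooth_manifold (quotient_mfd Y \<rho> (\<rho> ` Y) :: ('r, 'n::finite) mfd)"
  shows "smooth_manifold (quotient_mfd X \<pi> (\<pi> ` X) :: ('q, 'n) mfd)"
proof -
  note Y = assms[unfolded smooth_manifold_quotient_mfd[OF HOL.refl]]
  have hom: "TX homeomorphic_space TY"
    using homeomorphic_maps_fg homeomorphic_space_def by blast
  interpret I: quotient_iso Y \<rho> X \<pi> g f by (rule sym)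
  show ?thesis
    unfolding smooth_manifold_quotient_mfd[OF HOL.refl]
  proof (intro conjI)
    show "Hausdorff_space TX" using Y hom homeomorphic_Hausdorff_space by blast
    show "second_countable TX" using Y hom homeomorphic_space_second_countability by blast
    show "\<forall>q\<in>topspace TX. \<exists>(U, \<phi>)\<in>quotient_charts X \<pi> (\<pi> ` X) :: ('q, 'n) chart set. q \<in> U"
    proof
      fix q assume "q \<in> topspace TX"
      then have q: "q \<in> \<pi> ` X" by (simp add: topspace_quotient_top)
      then have "f q \<in> topspace TY" using f_im by (auto simp: topspace_quotient_top)
      then obtain V and \<psi> :: "'r \<Rightarrow> real^'n" where V: "(V, \<psi>) \<in> quotient_charts Y \<rho> (\<rho> ` Y)" "f q \<in> V"
        using Y by blast
      show "\<exists>(U, \<phi>)\<in>quotient_charts X \<pi> (\<pi> ` X) :: ('q, 'n) chart set. q \<in> U"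
        by (rule bexI[OF _ chart_pull[OF V(1)]]) (use V(2) q in simp)
    qed
    show "\<forall>(U, \<phi>)\<in>quotient_charts X \<pi> (\<pi> ` X) :: ('q, 'n) chart set. \<forall>(V, \<psi>)\<in>quotient_charts X \<pi> (\<pi> ` X) :: ('q, 'n) chart set.
        smooth_on (\<phi> ` (U \<inter> V)) (\<psi> \<circ> inv_into U \<phi>)"
    proof (safe)
      fix U V and \<phi> \<psi> :: "'q \<Rightarrow> real^'n"
      assume c: "(U, \<phi>) \<in> quotient_charts X \<pi> (\<pi> ` X)" "(V, \<psi>) \<in> quotient_charts X \<pi> (\<pi> ` X)"
      have sub: "U \<subseteq> \<pi> ` X" "V \<subseteq> \<pi> ` X"
        using c unfolding quotient_charts_def openin_quotient_top by auto
      let ?U = "{r \<in> \<rho> ` Y. g r \<in> U}" and ?V = "{r \<in> \<rho> ` Y. g r \<in> V}"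
      have "smooth_on ((\<phi> \<circ> g) ` (?U \<inter> ?V)) ((\<psi> \<circ> g) \<circ> inv_into ?U (\<phi> \<circ> g))"
        by (rule smooth_manifold_transition[OF assms I.chart_pull[OF c(1)] I.chart_pull[OF c(2)]])
      moreover have "(\<phi> \<circ> g) ` (?U \<inter> ?V) = \<phi> ` (U \<inter> V)"
      proof -
        have "g ` (?U \<inter> ?V) = U \<inter> V"
        proof
          show "U \<inter> V \<subseteq> g ` (?U \<inter> ?V)"
          proof
            fix q assume q: "q \<in> U \<inter> V"
            then have "q = g (f q)" "f q \<in> ?U \<inter> ?V" using sub gf f_im by auto
            then show "q \<in> g ` (?U \<inter> ?V)" by blast
          qed
        qed auto
        then show ?thesis by (metis image_comp)
      qed
      moreover have "((\<psi> \<circ> g) \<circ> inv_into ?U (\<phi> \<circ> g)) u = (\<psi> \<circ> inv_into U \<phi>) u" if "u \<in> \<phi> ` (U \<inter> V)" for u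
      proof -
        have u: "u \<in> \<phi> ` U" using that by blast
        then have "inv_into U \<phi> u \<in> U" by (rule inv_into_into)
        then show ?thesis
          using I.inv_into_chart_pull[OF c(1) u] sub(1) gf by auto
      qed
      ultimately show "smooth_on (\<phi> ` (U \<inter> V)) (\<psi> \<circ> inv_into U \<phi>)"
        by (simp only:) (rule smooth_on_cong)
    qed
  qed
qed

text \<open>Read in charts, f is the transition map from \<phi> to the pulled back chart \<psi>
  \<circ> f, so compatibility of the charts of the domain is enough.\<close>

lemma smooth_map_f:
  assumes "smooth_manifold (quotient_mfd X \<pi> (\<pi> ` X) :: ('q, 'n::finite) mfd)"
  shows "smooth_map (quotient_mfd X \<pi> (\<pi> ` X) :: ('q, 'n) mfd) (quotient_mfd Y \<rho> (\<rho> ` Y) :: ('r, 'n) mfd) f"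
proof -
  have "smooth_on (\<phi> ` {x \<in> U. f x \<in> V}) (\<psi> \<circ> f \<circ> inv_into U \<phi>)"
    if c: "(U, \<phi>) \<in> quotient_charts X \<pi> (\<pi> ` X)" "(V, \<psi>) \<in> quotient_charts Y \<rho> (\<rho> ` Y)"
    for U V and \<phi> :: "'q \<Rightarrow> real^'n" and \<psi> :: "'r \<Rightarrow> real^'n"
  proof -
    have "U \<subseteq> \<pi> ` X" using c unfolding quotient_charts_def openin_quotient_top by auto
    then have "{x \<in> U. f x \<in> V} = U \<inter> {q \<in> \<pi> ` X. f q \<in> V}" by blast
    then show ?thesis
      using smooth_manifold_transition[OF assms c(1) chart_pull[OF c(2)]] by simp
  qed
  then show ?thesis unfolding smooth_map_def quotient_mfd_def using continuous_map_f by auto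
qed

theorem diffeomorphic_quotients:
  assumes "smooth_manifold (quotient_mfd Y \<rho> (\<rho> ` Y) :: ('r, 'n::finite) mfd)"
  shows "diffeomorphic (quotient_mfd X \<pi> (\<pi> ` X) :: ('q, 'n) mfd) (quotient_mfd Y \<rho> (\<rho> ` Y) :: ('r, 'n) mfd)"
proof -
  have "fst (quotient_mfd X \<pi> (\<pi> ` X) :: ('q, 'n) mfd) = TX"
    and "fst (quotient_mfd Y \<rho> (\<rho> ` Y) :: ('r, 'n) mfd) = TY"
    by (simp_all add: quotient_mfd_def)
  then show ?thesis
    unfolding diffeomorphic_def diffeomorphism_def
    using assms smooth_manifold_pull[OF assms] smooth_map_f[OF smooth_manifold_pull[OF assms]]
      quotient_iso.smooth_map_f[OF sym assms] gf fg
    by (intro conjI exI[of _ f] exI[of _ g]) (auto simp: topspace_quotient_top)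
qed

end

section \<open>Quotients with local slices\<close>

text \<open>Modelled on the quotient by a finite group acting freely: P is a chart of X itself with
  inverse \<sigma>, on a set V so small that no two points of X in V share a fibre. The condition
  \<open>lifts\<close> stands in for the group elements, as local smooth maps carrying one point of
  a fibre to another. Keeping \<open>slice\<close> abstract separates the general argument from
  explicit formulas.\<close>

locale quotient_slices =
  fixes X :: "'a::euclidean_space set" and \<pi> :: "'a \<Rightarrow> 'q" and slice :: "'a \<Rightarrow> 'a set \<Rightarrow> (real^'n::finite) set \<Rightarrow> ('a \<Rightarrow> real^'n) \<Rightarrow> (real^'n \<Rightarrow> 'a) \<Rightarrow> bool"
  assumes slice_ex: "x \<in> X \<Longrightarrow> \<exists>V W P \<sigma>. x \<in> V \<and> slice x V W P \<sigma>"
    and slice: "slice x V W P \<sigma> \<Longrightarrow> open V \<and> open W \<and> Cinf_on V P \<and> Cinf_on W \<sigma> \<and> \<sigma> ` W \<subseteq> X \<inter> V \<and>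
        P ` (X \<inter> V) \<subseteq> W \<and> (\<forall>u\<in>W. P (\<sigma> u) = u) \<and> (\<forall>y\<in>X \<inter> V. \<sigma> (P y) = y) \<and> inj_on \<pi> (X \<inter> V)"
    and lifts: "x \<in> X \<Longrightarrow> y \<in> X \<Longrightarrow> \<pi> x = \<pi> y \<Longrightarrow> lift_at X \<pi> X \<pi> x y"
begin

abbreviation "T \<equiv> quotient_top X \<pi> (\<pi> ` X)"

text \<open>A lift taking x to a point y of V maps a neighbourhood of x into V and respects fibres,
  so the saturation of V is open.\<close>

lemma open_image:
  assumes "open V"
  shows "openin T (\<pi> ` (X \<inter> V))"
proof -
  have "openin (top_of_set X) {x \<in> X. \<pi> x \<in> \<pi> ` (X \<inter> V)}"
  proof (subst openin_subopen, intro ballI)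
    fix x assume x: "x \<in> {x \<in> X. \<pi> x \<in> \<pi> ` (X \<inter> V)}"
    then obtain y where y: "x \<in> X" "y \<in> X" "y \<in> V" "\<pi> x = \<pi> y" by auto
    obtain O' \<Phi> where O: "open O'" "x \<in> O'" "Cinf_on O' \<Phi>" "\<Phi> x = y"
      "\<forall>x'\<in>O' \<inter> X. \<Phi> x' \<in> X \<and> \<pi> (\<Phi> x') = \<pi> x'"
      by (rule lift_atE[OF lifts[OF y(1,2,4)]])
    have "open (O' \<inter> \<Phi> -` V)"
      by (rule Cinf_on_open_preimage[OF O(3) O(1) assms])
    moreover have "X \<inter> (O' \<inter> \<Phi> -` V) \<subseteq> {x \<in> X. \<pi> x \<in> \<pi> ` (X \<inter> V)}"
    proof
      fix x' assume x': "x' \<in> X \<inter> (O' \<inter> \<Phi> -` V)"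
      then have "\<Phi> x' \<in> X \<inter> V" "\<pi> x' = \<pi> (\<Phi> x')" using O(5) by auto
      then show "x' \<in> {x \<in> X. \<pi> x \<in> \<pi> ` (X \<inter> V)}" using x' by auto
    qed
    moreover have "x \<in> X \<inter> (O' \<inter> \<Phi> -` V)" using x y O by auto
    ultimately show "\<exists>T. openin (top_of_set X) T \<and> x \<in> T \<and> T \<subseteq> {x \<in> X. \<pi> x \<in> \<pi> ` (X \<inter> V)}"
      by (intro exI[of _ "X \<inter> (O' \<inter> \<Phi> -` V)"]) (simp add: openin_open_Int)
  qed
  then show ?thesis unfolding openin_quotient_top by auto
qed

lemma second_countable_T: "second_countable T"
proof -
  obtain \<B> :: "'a set set" where B: "countable \<B>" "topological_basis \<B>"
    using ex_countable_basis by blast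
  show ?thesis
    unfolding second_countable_def
  proof (intro exI conjI allI impI ballI)
    show "countable ((\<lambda>V. \<pi> ` (X \<inter> V)) ` \<B>)" using B(1) by simp
    show "openin T V" if "V \<in> (\<lambda>V. \<pi> ` (X \<inter> V)) ` \<B>" for V
      using that open_image topological_basis_open[OF B(2)] by auto
    fix U q assume Uq: "openin T U \<and> q \<in> U"
    then have U: "U \<subseteq> \<pi> ` X" "openin (top_of_set X) {x \<in> X. \<pi> x \<in> U}"
      unfolding openin_quotient_top by auto
    obtain O' where O: "open O'" "{x \<in> X. \<pi> x \<in> U} = X \<inter> O'"
      using U(2) unfolding openin_open by blast
    obtain x where x: "x \<in> X" "\<pi> x = q" using Uq U(1) by auto
    then have "x \<in> O'" using O(2) Uq by auto
    then obtain V where V: "V \<in> \<B>" "x \<in> V" "V \<subseteq> O'"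
      by (rule topological_basisE[OF B(2) O(1)])
    have "\<pi> ` (X \<inter> V) \<subseteq> U" using O(2) V(3) by auto
    then show "\<exists>V\<in>(\<lambda>V. \<pi> ` (X \<inter> V)) ` \<B>. q \<in> V \<and> V \<subseteq> U"
      using V x by (intro bexI[of _ "\<pi> ` (X \<inter> V)"]) auto
  qed
qed

definition slice_chart :: "'a set \<Rightarrow> ('a \<Rightarrow> real^'n) \<Rightarrow> ('q, 'n) chart" where
  "slice_chart V P = (\<pi> ` (X \<inter> V), \<lambda>q. P (inv_into (X \<inter> V) \<pi> q))"

lemma lifts_slice:
  assumes "open V" "x \<in> X" "y \<in> X \<inter> V" "\<pi> x = \<pi> y"
  shows "lift_at X \<pi> (X \<inter> V) \<pi> x y" "lift_at (X \<inter> V) \<pi> X \<pi> y x"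
proof -
  have y: "y \<in> X" "\<pi> y = \<pi> x" using assms by auto
  obtain U \<Phi> where U: "open U" "x \<in> U" "Cinf_on U \<Phi>" "\<Phi> x = y"
      "\<forall>x'\<in>U \<inter> X. \<Phi> x' \<in> X \<and> \<pi> (\<Phi> x') = \<pi> x'"
    by (rule lift_atE[OF lifts[OF assms(2) y(1) assms(4)]])
  have "open (U \<inter> \<Phi> -` V)"
    by (rule Cinf_on_open_preimage[OF U(3) U(1) assms(1)])
  moreover have "Cinf_on (U \<inter> \<Phi> -` V) \<Phi>" by (rule Cinf_on_subset[OF U(3)]) auto
  ultimately show "lift_at X \<pi> (X \<inter> V) \<pi> x y"
    unfolding lift_at_def using U assms by (intro exI[of _ "U \<inter> \<Phi> -` V"] exI[of _ \<Phi>]) auto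
  obtain O' \<Psi> where O: "open O'" "y \<in> O'" "Cinf_on O' \<Psi>" "\<Psi> y = x"
      "\<forall>x'\<in>O' \<inter> X. \<Psi> x' \<in> X \<and> \<pi> (\<Psi> x') = \<pi> x'"
    by (rule lift_atE[OF lifts[OF y(1) assms(2) y(2)]])
  then show "lift_at (X \<inter> V) \<pi> X \<pi> y x"
    unfolding lift_at_def by (intro exI[of _ O'] exI[of _ \<Psi>]) auto
qed

text \<open>On X \<inter> V the chart composed with \<pi> is P, and P \<circ> \<sigma> = id makes
  its derivative surjective on tangent vectors. The fibres through V also contain points outside V;
  there the submersion property is obtained by lifting back into V.\<close>

lemma slice_chart_in_quotient_charts:
  assumes "slice x V W P \<sigma>"
  shows "slice_chart V P \<in> quotient_charts X \<pi> (\<pi> ` X)"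
proof -
  have V: "open V" and W: "open W" and P: "Cinf_on V P" and s: "Cinf_on W \<sigma>" and sW: "\<sigma> ` W \<subseteq> X \<inter> V"
    and PV: "P ` (X \<inter> V) \<subseteq> W" and Ps: "\<And>u. u \<in> W \<Longrightarrow> P (\<sigma> u) = u"
    and sP: "\<And>y. y \<in> X \<inter> V \<Longrightarrow> \<sigma> (P y) = y" and inj: "inj_on \<pi> (X \<inter> V)"
    using slice[OF assms] by auto
  define U where "U = \<pi> ` (X \<inter> V)"
  define \<kappa> where "\<kappa> = (\<lambda>q. P (inv_into (X \<inter> V) \<pi> q))"
  have k: "\<kappa> (\<pi> y) = P y" if "y \<in> X \<inter> V" for y
    unfolding \<kappa>_def by (simp only: inv_into_f_f[OF inj that])
  have oU: "openin T U" unfolding U_def by (rule open_image[OF V])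
  have "P ` (X \<inter> V) = W"
  proof
    show "W \<subseteq> P ` (X \<inter> V)"
    proof
      fix u assume "u \<in> W"
      then have "u = P (\<sigma> u)" "\<sigma> u \<in> X \<inter> V" using Ps sW by auto
      then show "u \<in> P ` (X \<inter> V)" by (rule image_eqI)
    qed
  qed (rule PV)
  moreover have "\<kappa> ` U = P ` (X \<inter> V)" unfolding U_def image_image using k by (rule image_cong[OF HOL.refl])
  ultimately have kU: "\<kappa> ` U = W" by simp
  have top: "topspace (subtopology T U) = U"
    using openin_quotient_top_subset[OF oU] by (auto simp: topspace_quotient_top)
  have "homeomorphic_maps (subtopology T U) (top_of_set W) \<kappa> (\<pi> \<circ> \<sigma>)"
    unfolding homeomorphic_maps_def top
  proof (intro conjI ballI)
    show "continuous_map (subtopology T U) (top_of_set W) \<kappa>"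
      unfolding continuous_map_def top
    proof (intro conjI allI impI)
      show "\<kappa> \<in> U \<rightarrow> topspace (top_of_set W)" using kU by auto
      fix S assume "openin (top_of_set W) S"
      then obtain O' where O: "open O'" "S = W \<inter> O'" unfolding openin_open by auto
      have "{q \<in> U. \<kappa> q \<in> S} = \<pi> ` (X \<inter> (V \<inter> P -` O'))"
      proof (intro set_eqI iffI)
        fix q assume q: "q \<in> {q \<in> U. \<kappa> q \<in> S}"
        then obtain y where y: "y \<in> X \<inter> V" "q = \<pi> y" unfolding U_def by blast
        then have "P y \<in> O'" using q O(2) k[OF y(1)] by simp
        then show "q \<in> \<pi> ` (X \<inter> (V \<inter> P -` O'))" using y by blast
      next
        fix q assume "q \<in> \<pi> ` (X \<inter> (V \<inter> P -` O'))"
        then obtain y where y: "y \<in> X \<inter> V" "P y \<in> O'" "q = \<pi> y" by blast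
        then have "\<kappa> q \<in> S" using k[OF y(1)] PV O(2) by auto
        then show "q \<in> {q \<in> U. \<kappa> q \<in> S}" using y unfolding U_def by blast
      qed
      moreover have "openin T (\<pi> ` (X \<inter> (V \<inter> P -` O')))"
        by (rule open_image) (rule Cinf_on_open_preimage[OF P V O(1)])
      ultimately show "openin (subtopology T U) {q \<in> U. \<kappa> q \<in> S}"
        unfolding openin_open_subtopology[OF oU] by auto
    qed
    have "continuous_map (top_of_set W) T (\<pi> \<circ> \<sigma>)"
      unfolding continuous_map_def
    proof (intro conjI allI impI)
      show "\<pi> \<circ> \<sigma> \<in> topspace (top_of_set W) \<rightarrow> topspace T"
        using sW by (auto simp: topspace_quotient_top)
      fix S assume "openin T S"
      then have "openin (top_of_set X) {x \<in> X. \<pi> x \<in> S}" unfolding openin_quotient_top by blast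
      then obtain O' where O: "open O'" "{x \<in> X. \<pi> x \<in> S} = X \<inter> O'" unfolding openin_open by blast
      have "(\<pi> (\<sigma> u) \<in> S) = (\<sigma> u \<in> O')" if "u \<in> W" for u
      proof -
        have "\<sigma> u \<in> X" using that sW by auto
        then show ?thesis using O(2) by blast
      qed
      then have "{u \<in> topspace (top_of_set W). (\<pi> \<circ> \<sigma>) u \<in> S} = W \<inter> \<sigma> -` O'" by auto
      then show "openin (top_of_set W) {u \<in> topspace (top_of_set W). (\<pi> \<circ> \<sigma>) u \<in> S}"
        using continuous_openin_preimage_gen[OF Cinf_on_imp_continuous_on[OF s] O(1)] by simp
    qed
    then show "continuous_map (top_of_set W) (subtopology T U) (\<pi> \<circ> \<sigma>)"
      unfolding continuous_map_in_subtopology using sW unfolding U_def by (auto intro!: imageI)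
    show "(\<pi> \<circ> \<sigma>) (\<kappa> q) = q" if "q \<in> U" for q
      using that k sP unfolding U_def by auto
    show "\<kappa> ((\<pi> \<circ> \<sigma>) u) = u" if "u \<in> topspace (top_of_set W)" for u
    proof -
      have "u \<in> W" "\<sigma> u \<in> X \<inter> V" using that sW by auto
      then show ?thesis using k Ps by simp
    qed
  qed
  then have hom: "homeomorphic_map (subtopology T U) (top_of_set (\<kappa> ` U)) \<kappa>"
    unfolding kU using homeomorphic_map_maps by blast
  have sub: "submersion_on {y \<in> X \<inter> V. \<pi> y \<in> U} (\<kappa> \<circ> \<pi>)"
  proof (rule submersion_onI)
    fix y assume "y \<in> {y \<in> X \<inter> V. \<pi> y \<in> U}"
    then have y: "y \<in> X \<inter> V" by simp
    then have u: "P y \<in> W" "\<sigma> (P y) = y" using PV sP by auto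
    have Sy: "{y \<in> X \<inter> V. \<pi> y \<in> U} = X \<inter> V" unfolding U_def by auto
    have "w \<in> frechet_derivative P (at y) ` tangent_space (X \<inter> V) y" for w
    proof (rule image_eqI)
      have "w \<in> tangent_space UNIV (P y)"
        by (rule tangent_spaceI[of 1 "\<lambda>t. P y + t *\<^sub>R w"])
          (auto intro!: Cinf_intros derivative_eq_intros)
      then have "frechet_derivative \<sigma> (at (P y)) w \<in> tangent_space (X \<inter> V) (\<sigma> (P y))"
        by (rule tangent_space_image[OF _ W u(1) s]) (use sW in auto)
      then show "frechet_derivative \<sigma> (at (P y)) w \<in> tangent_space (X \<inter> V) y" by (simp add: u)
      have "frechet_derivative (\<lambda>u. P (\<sigma> u)) (at (P y)) w
          = frechet_derivative P (at y) (frechet_derivative \<sigma> (at (P y)) w)"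
        using frechet_derivative_compose_Cinf[OF P s u(1)] y by (simp add: u)
      moreover have "((\<lambda>u. P (\<sigma> u)) has_derivative (\<lambda>v. v)) (at (P y))"
        by (rule has_derivative_transform_within_open[OF _ W u(1)]) (auto simp: Ps)
      then have "frechet_derivative (\<lambda>u. P (\<sigma> u)) (at (P y)) w = w"
        using frechet_derivative_at by metis
      ultimately show "w = frechet_derivative P (at y) (frechet_derivative \<sigma> (at (P y)) w)" by simp
    qed
    then show "\<exists>O' F. open O' \<and> y \<in> O' \<and> Cinf_on O' F \<and> (\<forall>z\<in>O' \<inter> {y \<in> X \<inter> V. \<pi> y \<in> U}. F z = (\<kappa> \<circ> \<pi>) z) \<and>
        frechet_derivative F (at y) ` tangent_space {y \<in> X \<inter> V. \<pi> y \<in> U} y = UNIV"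
      using V y P k unfolding Sy by (intro exI[of _ V] exI[of _ P]) auto
  qed
  have "submersion_on {x \<in> X. \<pi> x \<in> U} (\<kappa> \<circ> \<pi>)"
  proof (rule lift_submersion_on[OF _ sub])
    fix x assume x: "x \<in> X" "\<pi> x \<in> U"
    then obtain y where y: "y \<in> X \<inter> V" "\<pi> x = \<pi> y" unfolding U_def by blast
    then show "\<exists>y\<in>X \<inter> V. lift_at X \<pi> (X \<inter> V) \<pi> x y \<and> lift_at (X \<inter> V) \<pi> X \<pi> y x"
      using lifts_slice[OF V x(1) y] by blast
  qed
  then show ?thesis
    unfolding quotient_charts_def slice_chart_def U_def[symmetric] \<kappa>_def[symmetric]
    using oU hom W kU by auto
qed

text \<open>Both charts are arbitrary members of \<open>quotient_charts\<close>, so a slice near a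
  preimage serves as intermediary. The map h = \<phi> \<circ> \<pi> \<circ> \<sigma> is injective
  and smooth between open subsets of R^n with surjective derivative, and the transition map is
  locally (\<psi> \<circ> \<pi> \<circ> \<sigma>) \<circ> h^-1.\<close>

lemma transition_smooth:
  fixes \<phi> \<psi> :: "'q \<Rightarrow> real^'n"
  assumes c1: "(U1, \<phi>) \<in> quotient_charts X \<pi> (\<pi> ` X)" and c2: "(U2, \<psi>) \<in> quotient_charts X \<pi> (\<pi> ` X)"
  shows "smooth_on (\<phi> ` (U1 \<inter> U2)) (\<psi> \<circ> inv_into U1 \<phi>)"
proof (rule smooth_onI)
  fix u0 assume "u0 \<in> \<phi> ` (U1 \<inter> U2)"
  then obtain q where q: "q \<in> U1" "q \<in> U2" "u0 = \<phi> q" by blast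
  have o1: "openin T U1" and o2: "openin T U2"
    and sub1: "submersion_on {x \<in> X. \<pi> x \<in> U1} (\<phi> \<circ> \<pi>)" and sub2: "submersion_on {x \<in> X. \<pi> x \<in> U2} (\<psi> \<circ> \<pi>)"
    and hom: "homeomorphic_map (subtopology T U1) (top_of_set (\<phi> ` U1)) \<phi>"
    using c1 c2 unfolding quotient_charts_def by auto
  have sm1: "smooth_on {x \<in> X. \<pi> x \<in> U1} (\<phi> \<circ> \<pi>)" and sm2: "smooth_on {x \<in> X. \<pi> x \<in> U2} (\<psi> \<circ> \<pi>)"
    using sub1 sub2 unfolding submersion_on_def smooth_on_def by meson+
  have "topspace (subtopology T U1) = U1"
    using openin_quotient_top_subset[OF o1] by (auto simp: topspace_quotient_top)
  then have inj1: "inj_on \<phi> U1" using hom unfolding homeomorphic_map_def by simp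
  obtain x where x: "x \<in> X" "\<pi> x = q" using q(1) openin_quotient_top_subset[OF o1] by auto
  obtain V W P \<sigma> where xV: "x \<in> V" and sl: "slice x V W P \<sigma>" using slice_ex[OF x(1)] by blast
  have V: "open V" and W: "open W" and P: "Cinf_on V P" and s: "Cinf_on W \<sigma>" and sW: "\<sigma> ` W \<subseteq> X \<inter> V"
    and PV: "P ` (X \<inter> V) \<subseteq> W" and Ps: "\<And>u. u \<in> W \<Longrightarrow> P (\<sigma> u) = u"
    and sP: "\<And>y. y \<in> X \<inter> V \<Longrightarrow> \<sigma> (P y) = y" and inj: "inj_on \<pi> (X \<inter> V)"
    using slice[OF sl] by auto
  have "openin (top_of_set X) {x \<in> X. \<pi> x \<in> U1 \<inter> U2}"
    using openin_Int[OF o1 o2] unfolding openin_quotient_top by blast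
  then obtain O' where O: "open O'" "{x \<in> X. \<pi> x \<in> U1 \<inter> U2} = X \<inter> O'" unfolding openin_open by blast
  define W' where "W' = W \<inter> \<sigma> -` O'"
  have W': "open W'" unfolding W'_def
    by (rule Cinf_on_open_preimage[OF s W O(1)])
  have sW': "\<sigma> u \<in> X \<inter> V \<and> \<pi> (\<sigma> u) \<in> U1 \<and> \<pi> (\<sigma> u) \<in> U2 \<and> u \<in> W" if "u \<in> W'" for u
  proof -
    have "\<sigma> u \<in> X \<inter> V" "u \<in> W" using that sW unfolding W'_def by auto
    moreover have "\<sigma> u \<in> {x \<in> X. \<pi> x \<in> U1 \<inter> U2}" unfolding O(2) using that calculation unfolding W'_def by auto
    ultimately show ?thesis by auto
  qed
  have ss: "smooth_on W' \<sigma>" by (rule Cinf_on_imp_smooth_on[OF s W]) (auto simp: W'_def)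
  define h where "h = (\<lambda>u. (\<phi> \<circ> \<pi>) (\<sigma> u))"
  have "smooth_on W' h" unfolding h_def
    by (rule smooth_on_compose[OF sm1 ss]) (use sW' in auto)
  then have Ch: "Cinf_on W' h" by (simp only: smooth_on_open[OF W'])
  have "smooth_on W' (\<lambda>u. (\<psi> \<circ> \<pi>) (\<sigma> u))"
    by (rule smooth_on_compose[OF sm2 ss]) (use sW' in auto)
  then have Cp: "Cinf_on W' (\<lambda>u. (\<psi> \<circ> \<pi>) (\<sigma> u))" by (simp only: smooth_on_open[OF W'])
  have injh: "inj_on h W'"
  proof (rule inj_onI)
    fix a b assume ab: "a \<in> W'" "b \<in> W'" "h a = h b"
    have "\<pi> (\<sigma> a) = \<pi> (\<sigma> b)"
      by (rule inj_onD[OF inj1]) (use ab sW' in \<open>auto simp: h_def\<close>)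
    then have "\<sigma> a = \<sigma> b"
      by (rule inj_onD[OF inj]) (use ab sW' in auto)
    then show "a = b" using Ps sW' ab by metis
  qed
  have surj: "surj (frechet_derivative h (at u))" if u: "u \<in> W'" for u
  proof -
    let ?y = "\<sigma> u" and ?S = "{x \<in> X. \<pi> x \<in> U1}"
    have y: "?y \<in> ?S" "?y \<in> V" "P ?y = u" using sW'[OF u] Ps by auto
    obtain A F where A: "open A" "?y \<in> A" "Cinf_on A F" "\<forall>y\<in>A \<inter> ?S. F y = (\<phi> \<circ> \<pi>) y"
      "frechet_derivative F (at ?y) ` tangent_space ?S ?y = UNIV"
      by (rule submersion_onE[OF sub1 y(1)])
    let ?N = "A \<inter> (V \<inter> P -` W')"
    have oN: "open (V \<inter> P -` W')"
      by (rule Cinf_on_open_preimage[OF P V W'])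
    have "w \<in> range (frechet_derivative h (at u))" for w
    proof -
      have "w \<in> frechet_derivative F (at ?y) ` tangent_space ?S ?y" unfolding A(5) by (rule UNIV_I)
      then obtain v where v: "v \<in> tangent_space ?S ?y" "w = frechet_derivative F (at ?y) v"
        by (elim imageE)
      \<comment> \<open>Near \<open>?y\<close> both h \<circ> P and F restrict to \<phi> \<circ>
        \<pi> on X, because \<sigma> \<circ> P is the identity there. Surjectivity of DF on tangent
        vectors thus passes to Dh.\<close>
      have "frechet_derivative (\<lambda>y. h (P y)) (at ?y) v = frechet_derivative F (at ?y) v"
      proof (rule frechet_derivative_tangent_cong[OF v(1), of ?N])
        show "open ?N" using A(1) oN by blast
        show "?y \<in> ?N" using A(2) y u by simp
        show "Cinf_on ?N F" by (rule Cinf_on_subset[OF A(3)]) auto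
        show "Cinf_on ?N (\<lambda>y. h (P y))"
          by (rule Cinf_on_compose[OF Ch Cinf_on_subset[OF P] _ W']) (use A(1) oN in auto)
        show "h (P y) = F y" if "y \<in> ?N \<inter> ?S" for y
          using that A(4) sP unfolding h_def by auto
      qed
      moreover have "frechet_derivative (\<lambda>y. h (P y)) (at ?y) v
          = frechet_derivative h (at u) (frechet_derivative P (at ?y) v)"
        using frechet_derivative_compose_Cinf[OF Ch P y(2)] y(3) u by simp
      ultimately show ?thesis using v(2) by (metis rangeI)
    qed
    then show ?thesis by blast
  qed
  have oh: "open (h ` W')" and Cg: "Cinf_on (h ` W') (inv_into W' h)"
    using Cinf_on_inverse_function[OF W' Ch injh surj] by auto
  have xW': "P x \<in> W'" "\<sigma> (P x) = x"
  proof -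
    show "\<sigma> (P x) = x" using sP x xV by blast
    moreover have "P x \<in> W" using PV x xV by blast
    moreover have "x \<in> X \<inter> O'" using O(2) x q by blast
    ultimately show "P x \<in> W'" unfolding W'_def by auto
  qed
  show "\<exists>A F. open A \<and> u0 \<in> A \<and> Cinf_on A F \<and> (\<forall>y\<in>A \<inter> \<phi> ` (U1 \<inter> U2). F y = (\<psi> \<circ> inv_into U1 \<phi>) y)"
  proof (intro exI conjI ballI)
    show "open (h ` W')" by (rule oh)
    have "u0 = h (P x)" using q x xW' unfolding h_def by simp
    then show "u0 \<in> h ` W'" using xW' by blast
    show "Cinf_on (h ` W') (\<lambda>y. (\<psi> \<circ> \<pi>) (\<sigma> (inv_into W' h y)))"
      by (rule Cinf_on_compose[OF Cp Cg oh W']) (auto intro: inv_into_into)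
    fix y assume "y \<in> h ` W' \<inter> \<phi> ` (U1 \<inter> U2)"
    then obtain w where w: "w \<in> W'" "y = h w" by blast
    have "inv_into W' h y = w" unfolding w(2) by (rule inv_into_f_f[OF injh w(1)])
    moreover have "inv_into U1 \<phi> y = \<pi> (\<sigma> w)"
      unfolding w(2) h_def comp_apply by (rule inv_into_f_f[OF inj1]) (use sW' w in auto)
    ultimately show "(\<psi> \<circ> \<pi>) (\<sigma> (inv_into W' h y)) = (\<psi> \<circ> inv_into U1 \<phi>) y" by simp
  qed
qed

theorem smooth_manifold_slices:
  assumes "Hausdorff_space T"
  shows "smooth_manifold (quotient_mfd X \<pi> (\<pi> ` X) :: ('q, 'n) mfd)"
  unfolding smooth_manifold_quotient_mfd[OF HOL.refl]
proof (intro conjI assms second_countable_T)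
  show "\<forall>q\<in>topspace T. \<exists>(U, \<phi>)\<in>quotient_charts X \<pi> (\<pi> ` X) :: ('q, 'n) chart set. q \<in> U"
  proof
    fix q assume "q \<in> topspace T"
    then obtain x where x: "x \<in> X" "q = \<pi> x" by (auto simp: topspace_quotient_top)
    obtain V W P \<sigma> where V: "x \<in> V" "slice x V W P \<sigma>" using slice_ex[OF x(1)] by blast
    have "q \<in> fst (slice_chart V P)" unfolding slice_chart_def using x V(1) by auto
    then show "\<exists>(U, \<phi>)\<in>quotient_charts X \<pi> (\<pi> ` X) :: ('q, 'n) chart set. q \<in> U"
      using slice_chart_in_quotient_charts[OF V(2)] by (intro bexI[of _ "slice_chart V P"]) (auto simp: case_prod_beta)
  qed
  show "\<forall>(U, \<phi>)\<in>quotient_charts X \<pi> (\<pi> ` X) :: ('q, 'n) chart set. \<forall>(V, \<psi>)\<in>quotient_charts X \<pi> (\<pi> ` X) :: ('q, 'n) chart set.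
      smooth_on (\<phi> ` (U \<inter> V)) (\<psi> \<circ> inv_into U \<phi>)"
    using transition_smooth by auto
qed

end

section \<open>Lens spaces\<close>

definition lens_root :: "nat \<Rightarrow> complex" where
  "lens_root p = exp (2 * of_real pi * \<i> / of_nat p)"

definition cscale :: "complex \<Rightarrow> complex \<times> complex \<Rightarrow> complex \<times> complex" where
  "cscale c z = (c * fst z, c * snd z)"

lemma norm_cscale: "norm (cscale c z) = norm c * norm z"
  unfolding cscale_def norm_prod_def
  by (simp add: norm_mult power_mult_distrib real_sqrt_mult flip: distrib_left)

lemma cscale_diff: "cscale c z - cscale c w = cscale c (z - w)" "cscale a z - cscale b z = cscale (a - b) z"
  by (simp_all add: cscale_def algebra_simps prod_eq_iff)

lemma cscale_cscale: "cscale a (cscale b z) = cscale (a * b) z" and cscale_1: "cscale 1 z = z"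
  by (simp_all add: cscale_def mult.assoc)

lemma Cinf_on_cscale: "Cinf_on UNIV (cscale c)"
  unfolding cscale_def by (intro Cinf_intros open_UNIV)

lemma lens_root_eq: "lens_root p = cis (2 * pi / p)"
  by (simp add: lens_root_def cis_conv_exp mult_ac)

lemma lens_root_power: "lens_root p ^ k = cis (2 * pi * k / p)"
  unfolding lens_root_eq Complex.DeMoivre by (rule arg_cong[of _ _ cis]) simp

lemma norm_lens_root_power: "norm (lens_root p ^ k) = 1"
  by (simp add: lens_root_power)

lemma lens_root_power_p: "p > 0 \<Longrightarrow> lens_root p ^ (p * k) = 1"
  by (simp add: lens_root_power power_mult)

lemma lens_root_power_mod: "p > 0 \<Longrightarrow> lens_root p ^ (k mod p) = lens_root p ^ k"
  by (metis lens_root_power_p mod_mult_div_eq mult.right_neutral power_add)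

lemma lens_orbit_eq: "lens_orbit p z = range (\<lambda>k. cscale (lens_root p ^ k) z)"
  unfolding lens_orbit_def lens_root_def[symmetric] cscale_def by auto

lemma lens_orbit_finite: "p > 0 \<Longrightarrow> lens_orbit p z = (\<lambda>k. cscale (lens_root p ^ k) z) ` {..<p}"
proof
  assume p: "p > 0"
  show "lens_orbit p z \<subseteq> (\<lambda>k. cscale (lens_root p ^ k) z) ` {..<p}"
  proof
    fix w assume "w \<in> lens_orbit p z"
    then obtain k where "w = cscale (lens_root p ^ k) z" by (auto simp: lens_orbit_eq)
    then have "w = cscale (lens_root p ^ (k mod p)) z" using lens_root_power_mod[OF p] by simp
    then show "w \<in> (\<lambda>k. cscale (lens_root p ^ k) z) ` {..<p}" using p by auto
  qed
qed (auto simp: lens_orbit_eq)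

lemma lens_root_power_inverse:
  assumes "p > 0"
  obtains m where "lens_root p ^ m * lens_root p ^ k = 1"
proof
  \<comment> \<open>Since p > 0 gives k \<le> p * k, the subtraction of naturals is exact.\<close>
  show "lens_root p ^ (p * k - k) * lens_root p ^ k = 1"
    using assms lens_root_power_p[OF assms, of k] by (simp flip: power_add)
qed

lemma lens_orbit_eq_iff:
  assumes "p > 0"
  shows "lens_orbit p z = lens_orbit p w \<longleftrightarrow> (\<exists>k. w = cscale (lens_root p ^ k) z)"
proof
  assume "lens_orbit p z = lens_orbit p w"
  moreover have "w \<in> lens_orbit p w"
    unfolding lens_orbit_eq by (rule image_eqI[of _ _ 0]) (simp_all add: cscale_1)
  ultimately show "\<exists>k. w = cscale (lens_root p ^ k) z" by (auto simp: lens_orbit_eq)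
next
  assume "\<exists>k. w = cscale (lens_root p ^ k) z"
  then obtain k where k: "w = cscale (lens_root p ^ k) z" ..
  obtain m where m: "lens_root p ^ m * lens_root p ^ k = 1" by (rule lens_root_power_inverse[OF assms])
  have z: "z = cscale (lens_root p ^ m) w" using m k by (simp add: cscale_cscale cscale_1)
  have sub: "lens_orbit p (cscale (lens_root p ^ k) z) \<subseteq> lens_orbit p z" for k z
    by (auto simp: lens_orbit_eq cscale_cscale simp flip: power_add)
  show "lens_orbit p z = lens_orbit p w"
    using sub[of k z, folded k] sub[of m w, folded z] by (rule equalityI[rotated])
qed

text \<open>The local parametrisation of \<open>S\<^sup>3\<close> at \<open>q\<close> is the inverse of the central projection onto the
  tangent hyperplane at \<open>q\<close>; the complex numbers \<open>a\<close>, \<open>b\<close> are the coordinates with respect to the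
  unitary basis \<open>q\<close>, \<open>(- cnj q\<^sub>1, cnj q\<^sub>0)\<close>.\<close>

definition sphere_coord_a :: "complex \<times> complex \<Rightarrow> complex \<times> complex \<Rightarrow> complex" where
  "sphere_coord_a q y = fst y * cnj (fst q) + snd y * cnj (snd q)"

definition sphere_coord_b :: "complex \<times> complex \<Rightarrow> complex \<times> complex \<Rightarrow> complex" where
  "sphere_coord_b q y = snd y * fst q - fst y * snd q"

definition central_proj :: "complex \<times> complex \<Rightarrow> complex \<times> complex \<Rightarrow> real^3" where
  "central_proj q y = (\<chi> i. (if i = 1 then Im (sphere_coord_a q y) else if i = 2 then Re (sphere_coord_b q y)
     else Im (sphere_coord_b q y)) / Re (sphere_coord_a q y))"

definition central_param :: "complex \<times> complex \<Rightarrow> real^3 \<Rightarrow> complex \<times> complex" where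
  "central_param q u = (1 / sqrt (1 + (u$1)\<^sup>2 + (u$2)\<^sup>2 + (u$3)\<^sup>2)) *\<^sub>R
     (Complex 1 (u$1) * fst q - Complex (u$2) (u$3) * cnj (snd q),
      Complex 1 (u$1) * snd q + Complex (u$2) (u$3) * cnj (fst q))"

lemma sphere3_eq: "norm q = 1 \<longleftrightarrow> fst q * cnj (fst q) + snd q * cnj (snd q) = (1::complex)"
proof -
  have "norm q = 1 \<longleftrightarrow> (norm (fst q))\<^sup>2 + (norm (snd q))\<^sup>2 = 1"
    by (simp add: norm_prod_def real_sqrt_eq_1_iff)
  also have "\<dots> \<longleftrightarrow> complex_of_real ((norm (fst q))\<^sup>2 + (norm (snd q))\<^sup>2) = 1"
    by (simp only: of_real_eq_1_iff)
  also have "complex_of_real ((norm (fst q))\<^sup>2 + (norm (snd q))\<^sup>2) = fst q * cnj (fst q) + snd q * cnj (snd q)"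
    by (simp only: of_real_add complex_norm_square)
  finally show ?thesis .
qed

lemma sphere_coord_combine:
  assumes "norm q = 1"
  shows "(a * fst q - b * cnj (snd q), a * snd q + b * cnj (fst q)) = y
    \<longleftrightarrow> sphere_coord_a q y = a \<and> sphere_coord_b q y = b"
proof -
  have q: "fst q * cnj (fst q) + snd q * cnj (snd q) = 1" using assms sphere3_eq by blast
  show ?thesis
  proof
    assume y: "(a * fst q - b * cnj (snd q), a * snd q + b * cnj (fst q)) = y"
    have "sphere_coord_a q y = a * (fst q * cnj (fst q) + snd q * cnj (snd q))"
      unfolding y[symmetric] sphere_coord_a_def by (simp add: algebra_simps)
    moreover have "sphere_coord_b q y = b * (fst q * cnj (fst q) + snd q * cnj (snd q))"
      unfolding y[symmetric] sphere_coord_b_def by (simp add: algebra_simps)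
    ultimately show "sphere_coord_a q y = a \<and> sphere_coord_b q y = b" using q by simp
  next
    assume ab: "sphere_coord_a q y = a \<and> sphere_coord_b q y = b"
    have "a * fst q - b * cnj (snd q) = fst y * (fst q * cnj (fst q) + snd q * cnj (snd q))"
      "a * snd q + b * cnj (fst q) = snd y * (fst q * cnj (fst q) + snd q * cnj (snd q))"
      unfolding conjunct1[OF ab, symmetric] conjunct2[OF ab, symmetric] sphere_coord_a_def sphere_coord_b_def
      by (simp_all add: algebra_simps)
    then show "(a * fst q - b * cnj (snd q), a * snd q + b * cnj (fst q)) = y"
      using q by (simp add: prod_eq_iff)
  qed
qed

text \<open>Parseval's identity for the unitary basis attached to q.\<close>

lemma norm_sphere_coord:
  assumes "norm q = 1"
  shows "(norm (sphere_coord_a q y))\<^sup>2 + (norm (sphere_coord_b q y))\<^sup>2 = (norm y)\<^sup>2"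
proof -
  have q: "fst q * cnj (fst q) + snd q * cnj (snd q) = 1" using assms sphere3_eq by blast
  have "complex_of_real ((norm (sphere_coord_a q y))\<^sup>2 + (norm (sphere_coord_b q y))\<^sup>2)
    = (fst y * cnj (fst y) + snd y * cnj (snd y)) * (fst q * cnj (fst q) + snd q * cnj (snd q))"
    unfolding of_real_add complex_norm_square sphere_coord_a_def sphere_coord_b_def
    by (simp add: algebra_simps)
  also have "\<dots> = complex_of_real ((norm (fst y))\<^sup>2 + (norm (snd y))\<^sup>2)"
    by (simp only: q mult_1_right of_real_add complex_norm_square)
  finally show ?thesis unfolding of_real_eq_iff by (simp add: norm_prod_def)
qed

lemma central_param_coord:
  assumes "norm q = 1"
  defines "N \<equiv> \<lambda>u::real^3. 1 / sqrt (1 + (u$1)\<^sup>2 + (u$2)\<^sup>2 + (u$3)\<^sup>2)"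
  shows "sphere_coord_a q (central_param q u) = N u *\<^sub>R Complex 1 (u$1)"
    and "sphere_coord_b q (central_param q u) = N u *\<^sub>R Complex (u$2) (u$3)"
proof -
  have "(N u *\<^sub>R Complex 1 (u$1) * fst q - N u *\<^sub>R Complex (u$2) (u$3) * cnj (snd q),
      N u *\<^sub>R Complex 1 (u$1) * snd q + N u *\<^sub>R Complex (u$2) (u$3) * cnj (fst q)) = central_param q u"
    unfolding central_param_def N_def by (simp add: algebra_simps)
  then show "sphere_coord_a q (central_param q u) = N u *\<^sub>R Complex 1 (u$1)"
    "sphere_coord_b q (central_param q u) = N u *\<^sub>R Complex (u$2) (u$3)"
    unfolding sphere_coord_combine[OF assms(1)] by auto
qed

lemma one_plus_squares_pos: "0 < 1 + (a::real)\<^sup>2 + b\<^sup>2 + c\<^sup>2"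
  by (simp add: add_pos_nonneg)

lemma central_param:
  assumes "norm q = 1"
  shows "norm (central_param q u) = 1" "Re (sphere_coord_a q (central_param q u)) > 0"
    "central_proj q (central_param q u) = u"
proof -
  let ?S = "1 + (u$1)\<^sup>2 + (u$2)\<^sup>2 + (u$3)\<^sup>2"
  have S: "?S > 0" by (rule one_plus_squares_pos)
  then have "(norm (central_param q u))\<^sup>2 = 1"
    unfolding norm_sphere_coord[OF assms, symmetric] central_param_coord[OF assms]
    by (simp add: cmod_power2 power_divide flip: add_divide_distrib)
  then show "norm (central_param q u) = 1" by (smt (verit) norm_ge_zero power2_eq_1_iff)
  show "Re (sphere_coord_a q (central_param q u)) > 0"
    unfolding central_param_coord[OF assms] using S by simp
  show "central_proj q (central_param q u) = u"
    unfolding central_proj_def central_param_coord[OF assms] using S by (simp add: vec_eq_iff forall_3)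
qed

lemma central_param_central_proj:
  assumes "norm q = 1" "norm y = 1" "Re (sphere_coord_a q y) > 0"
  shows "central_param q (central_proj q y) = y"
proof -
  let ?u = "central_proj q y" and ?a = "sphere_coord_a q y" and ?b = "sphere_coord_b q y"
  let ?S = "1 + (?u$1)\<^sup>2 + (?u$2)\<^sup>2 + (?u$3)\<^sup>2"
  have "(Re ?a)\<^sup>2 * ?S = (Re ?a)\<^sup>2 + (Im ?a)\<^sup>2 + (Re ?b)\<^sup>2 + (Im ?b)\<^sup>2"
    using assms(3) by (simp add: central_proj_def field_simps power2_eq_square)
  also have "\<dots> = 1"
    using norm_sphere_coord[OF assms(1), of y] assms(2) by (simp add: cmod_power2)
  finally have "?S = (1 / Re ?a)\<^sup>2" using assms(3) by (simp add: field_simps)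
  \<comment> \<open>On the open hemisphere the normalising factor of \<open>central_param\<close> is
    exactly the real part of a, so multiplying by it restores the coordinates a and b of y.\<close>
  then have "1 / sqrt ?S = Re ?a" using assms(3) by simp
  then have "central_param q ?u = (?a * fst q - ?b * cnj (snd q), ?a * snd q + ?b * cnj (fst q))"
    unfolding central_param_def using assms(3)
    by (simp add: central_proj_def complex_eq_iff algebra_simps)
  then show ?thesis using sphere_coord_combine[OF assms(1), of ?a ?b y] by simp
qed

lemma Cinf_on_sphere_coord: "open S \<Longrightarrow> Cinf_on S (sphere_coord_a q)" "open S \<Longrightarrow> Cinf_on S (sphere_coord_b q)"
  unfolding sphere_coord_a_def sphere_coord_b_def by (intro Cinf_intros; assumption)+

lemma Cinf_on_central_proj:
  assumes "open S" "\<And>y. y \<in> S \<Longrightarrow> Re (sphere_coord_a q y) \<noteq> 0"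
  shows "Cinf_on S (central_proj q)"
  unfolding central_proj_def
proof (intro Cinf_on_vec_lambda Cinf_on_divide_real assms Cinf_on_Re Cinf_on_sphere_coord)
  fix i :: 3
  have "Cinf_on S (\<lambda>y. Im (sphere_coord_a q y))" "Cinf_on S (\<lambda>y. Re (sphere_coord_b q y))"
    "Cinf_on S (\<lambda>y. Im (sphere_coord_b q y))"
    by (intro Cinf_on_Re Cinf_on_Im Cinf_on_sphere_coord assms)+
  then show "Cinf_on S (\<lambda>y. if i = 1 then Im (sphere_coord_a q y) else if i = 2 then Re (sphere_coord_b q y)
     else Im (sphere_coord_b q y))"
    by (cases "i = 1"; cases "i = 2") simp_all
qed

lemma Cinf_on_central_param: "open S \<Longrightarrow> Cinf_on S (central_param q)"
  unfolding central_param_def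
  by (intro Cinf_intros Cinf_on_Complex Cinf_on_divide_real Cinf_on_sqrt; (assumption)?)
    (simp_all add: one_plus_squares_pos less_imp_neq[symmetric] real_sqrt_eq_zero_cancel_iff)

text \<open>The radius r is at most half of every gap between 1 and another power of the root of
  unity \<zeta>. Two points of one orbit on the sphere have distance |\<zeta>^k - 1| for some k, so
  the ball cannot contain two different ones.\<close>

definition lens_slice ::
    "nat \<Rightarrow> complex \<times> complex \<Rightarrow> (complex \<times> complex) set \<Rightarrow> (real^3) set \<Rightarrow>
     (complex \<times> complex \<Rightarrow> real^3) \<Rightarrow> (real^3 \<Rightarrow> complex \<times> complex) \<Rightarrow> bool" where
  "lens_slice p q V W P \<sigma> \<longleftrightarrow> norm q = 1 \<and> P = central_proj q \<and> \<sigma> = central_param q \<and>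
     (\<exists>r. (\<forall>k. lens_root p ^ k \<noteq> 1 \<longrightarrow> 2 * r \<le> norm (lens_root p ^ k - 1)) \<and>
       V = ball q r \<inter> {y. Re (sphere_coord_a q y) > 0} \<and> W = central_param q -` ball q r)"

lemma lens_root_gap:
  assumes "p > 0"
  obtains r where "r > 0" "\<forall>k. lens_root p ^ k \<noteq> 1 \<longrightarrow> 2 * r \<le> norm (lens_root p ^ k - 1)"
proof -
  \<comment> \<open>The element 1 keeps the set nonempty when p = 1, where all powers of the root
    are 1 and there is no gap to respect.\<close>
  let ?D = "insert 1 ((\<lambda>k. norm (lens_root p ^ k - 1)) ` {k \<in> {..<p}. lens_root p ^ k \<noteq> 1})"
  have fin: "finite ?D" by simp
  have "Min ?D > 0" using fin by (subst Min_gr_iff) auto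
  moreover have "2 * (Min ?D / 2) \<le> norm (lens_root p ^ k - 1)" if "lens_root p ^ k \<noteq> 1" for k
  proof -
    have "norm (lens_root p ^ (k mod p) - 1) \<in> ?D"
      by (intro insertI2 image_eqI[of _ _ "k mod p"]) (use that assms in \<open>auto simp: lens_root_power_mod\<close>)
    then have "Min ?D \<le> norm (lens_root p ^ (k mod p) - 1)" by (rule Min_le[OF fin])
    then show ?thesis using lens_root_power_mod[OF assms, of k] by simp
  qed
  ultimately show thesis using that[of "Min ?D / 2"] by auto
qed

lemma lens_quotient_slices:
  assumes "p > 0"
  shows "quotient_slices (sphere 0 1) (lens_orbit p) (lens_slice p)"
proof
  fix q :: "complex \<times> complex" assume "q \<in> sphere 0 1"
  then have q: "norm q = 1" by simp
  obtain r where r: "r > 0" "\<forall>k. lens_root p ^ k \<noteq> 1 \<longrightarrow> 2 * r \<le> norm (lens_root p ^ k - 1)"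
    by (rule lens_root_gap[OF assms])
  have "sphere_coord_a q q = 1" using q sphere3_eq unfolding sphere_coord_a_def by blast
  then have "q \<in> ball q r \<inter> {y. Re (sphere_coord_a q y) > 0}" using r(1) by simp
  then show "\<exists>V W P \<sigma>. q \<in> V \<and> lens_slice p q V W P \<sigma>"
    unfolding lens_slice_def using q r(2)
    by (intro exI[of _ "ball q r \<inter> {y. Re (sphere_coord_a q y) > 0}"] exI[of _ "central_param q -` ball q r"]
        exI[of _ "central_proj q"] exI[of _ "central_param q"] conjI exI[of _ r]) simp_all
next
  fix q V W P \<sigma>
  assume "lens_slice p q V W P \<sigma>"
  then obtain r where q: "norm q = 1" and P: "P = central_proj q" and s: "\<sigma> = central_param q"
    and r: "\<And>k. lens_root p ^ k \<noteq> 1 \<Longrightarrow> 2 * r \<le> norm (lens_root p ^ k - 1)"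
    and V: "V = ball q r \<inter> {y. Re (sphere_coord_a q y) > 0}" and W: "W = central_param q -` ball q r"
    unfolding lens_slice_def by blast
  have "open {y. Re (sphere_coord_a q y) > 0}"
    unfolding sphere_coord_a_def by (intro open_Collect_less continuous_intros)
  then have oV: "open V" unfolding V by blast
  have oW: "open W"
    unfolding W by (rule open_vimage[OF open_ball Cinf_on_imp_continuous_on[OF Cinf_on_central_param[OF open_UNIV]]])
  have "Cinf_on V P" unfolding P by (rule Cinf_on_central_proj[OF oV]) (auto simp: V)
  moreover have "Cinf_on W \<sigma>" unfolding s by (rule Cinf_on_central_param[OF oW])
  moreover have "\<sigma> ` W \<subseteq> sphere 0 1 \<inter> V" unfolding s W V using central_param[OF q] by auto
  moreover have "P ` (sphere 0 1 \<inter> V) \<subseteq> W"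
    unfolding P W V using central_param_central_proj[OF q] by auto
  moreover have "\<forall>u\<in>W. P (\<sigma> u) = u" unfolding P s using central_param[OF q] by auto
  moreover have "\<forall>y\<in>sphere 0 1 \<inter> V. \<sigma> (P y) = y"
    unfolding P s V using central_param_central_proj[OF q] by auto
  moreover have "inj_on (lens_orbit p) (sphere 0 1 \<inter> V)"
  proof (rule inj_onI)
    fix y y' assume y: "y \<in> sphere 0 1 \<inter> V" "y' \<in> sphere 0 1 \<inter> V" "lens_orbit p y = lens_orbit p y'"
    then obtain k where k: "y' = cscale (lens_root p ^ k) y" using lens_orbit_eq_iff[OF assms] by blast
    have "dist y y' < 2 * r"
      using y(1,2) dist_triangle_less_add[of q y r y' r] unfolding V
      by (smt (verit) IntE dist_commute dist_triangle mem_ball)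
    moreover have "dist y y' = norm (lens_root p ^ k - 1)"
    proof -
      have "dist y y' = norm (cscale (lens_root p ^ k - 1) y)"
        unfolding k dist_norm cscale_diff(2)[symmetric] cscale_1 by (rule norm_minus_commute)
      then show ?thesis using y(1) by (simp add: norm_cscale)
    qed
    ultimately have "lens_root p ^ k = 1" using r[of k] by fastforce
    then show "y = y'" using k by (simp add: cscale_1)
  qed
  ultimately show "open V \<and> open W \<and> Cinf_on V P \<and> Cinf_on W \<sigma> \<and> \<sigma> ` W \<subseteq> sphere 0 1 \<inter> V \<and>
      P ` (sphere 0 1 \<inter> V) \<subseteq> W \<and> (\<forall>u\<in>W. P (\<sigma> u) = u) \<and> (\<forall>y\<in>sphere 0 1 \<inter> V. \<sigma> (P y) = y) \<and>
      inj_on (lens_orbit p) (sphere 0 1 \<inter> V)"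
    using oV oW by blast
next
  fix x y :: "complex \<times> complex" assume "lens_orbit p x = lens_orbit p y"
  then obtain k where k: "y = cscale (lens_root p ^ k) x" using lens_orbit_eq_iff[OF assms] by blast
  show "lift_at (sphere 0 1) (lens_orbit p) (sphere 0 1) (lens_orbit p) x y"
    unfolding lift_at_def
  proof (intro exI conjI ballI)
    show "Cinf_on UNIV (cscale (lens_root p ^ k))" by (rule Cinf_on_cscale)
    show "cscale (lens_root p ^ k) x' \<in> sphere 0 1" if "x' \<in> UNIV \<inter> sphere 0 1" for x'
      using that by (simp add: norm_cscale norm_lens_root_power)
    show "lens_orbit p (cscale (lens_root p ^ k) x') = lens_orbit p x'" for x'
      using lens_orbit_eq_iff[OF assms] by metis
  qed (use k in auto)
qed

text \<open>The distance to the orbit of y1 does not increase under the action; it vanishes at y1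
  and is positive at y2, the orbit being finite and hence closed. The regions below and above half
  of its value at y2 therefore have disjoint images in the quotient.\<close>

lemma Hausdorff_lens:
  assumes "p > 0"
  shows "Hausdorff_space (quotient_top (sphere 0 1) (lens_orbit p) (lens_orbit p ` sphere 0 1))"
proof -
  interpret quotient_slices "sphere 0 1" "lens_orbit p" "lens_slice p"
    by (rule lens_quotient_slices[OF assms])
  have inv: "infdist (cscale (lens_root p ^ k) x) (lens_orbit p y) \<le> infdist x (lens_orbit p y)" for k x y
  proof -
    have ne: "lens_orbit p y \<noteq> {}" by (simp add: lens_orbit_eq)
    show ?thesis
      unfolding infdist_notempty[OF ne, of x]
    proof (rule cINF_greatest[OF ne])
      fix o' assume "o' \<in> lens_orbit p y"
      then have "cscale (lens_root p ^ k) o' \<in> lens_orbit p y"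
        by (auto simp: lens_orbit_eq cscale_cscale simp flip: power_add)
      then have "infdist (cscale (lens_root p ^ k) x) (lens_orbit p y)
          \<le> dist (cscale (lens_root p ^ k) x) (cscale (lens_root p ^ k) o')"
        by (rule infdist_le)
      also have "\<dots> = dist x o'"
        by (simp add: dist_norm cscale_diff norm_cscale norm_lens_root_power)
      finally show "infdist (cscale (lens_root p ^ k) x) (lens_orbit p y) \<le> dist x o'" .
    qed
  qed
  show ?thesis
    unfolding Hausdorff_space_def topspace_quotient_top
  proof (intro allI impI, elim conjE imageE)
    fix Q1 Q2 y1 y2 assume y: "Q1 \<noteq> Q2" "Q1 = lens_orbit p y1" "y1 \<in> sphere 0 1" "Q2 = lens_orbit p y2" "y2 \<in> sphere 0 1"
    let ?f = "\<lambda>x. infdist x (lens_orbit p y1)"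
    have y1: "y1 \<in> lens_orbit p y1"
      unfolding lens_orbit_eq by (rule image_eqI[of _ _ 0]) (simp_all add: cscale_1)
    have "y2 \<notin> lens_orbit p y1"
      using y lens_orbit_eq_iff[OF assms, of y1 y2] by (auto simp: lens_orbit_eq)
    moreover have "closed (lens_orbit p y1)"
      unfolding lens_orbit_finite[OF assms] by (intro finite_imp_closed finite_imageI) simp
    ultimately have pos: "?f y2 > 0" using infdist_pos_not_in_closed y1 by blast
    define \<delta> where "\<delta> = ?f y2 / 2"
    let ?U = "{x. ?f x < \<delta>}" and ?V = "{x. ?f x > \<delta>}"
    have "open ?U" "open ?V" by (intro open_Collect_less continuous_intros)+
    then have "openin T (lens_orbit p ` (sphere 0 1 \<inter> ?U))" "openin T (lens_orbit p ` (sphere 0 1 \<inter> ?V))"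
      by (auto intro: open_image)
    moreover have "Q1 \<in> lens_orbit p ` (sphere 0 1 \<inter> ?U)" "Q2 \<in> lens_orbit p ` (sphere 0 1 \<inter> ?V)"
      using y y1 pos by (auto simp: \<delta>_def)
    moreover have "disjnt (lens_orbit p ` (sphere 0 1 \<inter> ?U)) (lens_orbit p ` (sphere 0 1 \<inter> ?V))"
    proof -
      have False if ab: "?f a < \<delta>" "\<delta> < ?f b" "lens_orbit p a = lens_orbit p b" for a b
      proof -
        obtain k where "b = cscale (lens_root p ^ k) a"
          using ab(3) unfolding lens_orbit_eq_iff[OF assms] ..
        then show False using ab(1,2) inv[of k a y1] by simp
      qed
      then show ?thesis unfolding disjnt_def by blast
    qed
    ultimately show "\<exists>U V. openin T U \<and> openin T V \<and> Q1 \<in> U \<and> Q2 \<in> V \<and> disjnt U V" by blast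
  qed
qed

lemma smooth_manifold_lens_space: "p > 0 \<Longrightarrow> smooth_manifold (lens_space p)"
  unfolding lens_space_def
  by (rule quotient_slices.smooth_manifold_slices[OF lens_quotient_slices Hausdorff_lens])

section \<open>Geodesics of a metric induced by a constant bilinear form\<close>

text \<open>The mean value theorem is applied once in each direction: along a to the increment of f
  over h b, then along b to the derivative of f in direction a. The second difference on the left is
  symmetric in a and b, which yields Schwarz's theorem.\<close>

lemma Cinf_on_second_difference:
  fixes f :: "'a::euclidean_space \<Rightarrow> real"
  assumes "Cinf_on W f" "h > 0"
    and "\<And>s t. 0 \<le> s \<Longrightarrow> s \<le> h \<Longrightarrow> 0 \<le> t \<Longrightarrow> t \<le> h \<Longrightarrow> u + s *\<^sub>R a + t *\<^sub>R b \<in> W"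
  obtains s t where "0 \<le> s" "s \<le> h" "0 \<le> t" "t \<le> h"
    "f (u + h *\<^sub>R a + h *\<^sub>R b) - f (u + h *\<^sub>R a) - f (u + h *\<^sub>R b) + f u
      = h * h * frechet_derivative (\<lambda>x. frechet_derivative f (at x) a) (at (u + s *\<^sub>R a + t *\<^sub>R b)) b"
proof -
  let ?fa = "\<lambda>x. frechet_derivative f (at x) a"
  have Cfa: "Cinf_on W ?fa" by (rule Cinf_on_frechet_derivative[OF assms(1)])
  have line: "DERIV (\<lambda>s. g (p + s *\<^sub>R v)) s :> frechet_derivative g (at (p + s *\<^sub>R v)) v"
    if "Cinf_on W g" "p + s *\<^sub>R v \<in> W" for g :: "'a \<Rightarrow> real" and p v s
  proof -
    have "((\<lambda>s. p + s *\<^sub>R v) has_vector_derivative v) (at s)"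
      by (auto intro!: derivative_eq_intros)
    from vector_derivative_diff_chain_within[OF this has_derivative_at_withinI[OF Cinf_on_has_derivative[OF that]]]
    show ?thesis by (simp add: o_def has_real_derivative_iff_has_vector_derivative)
  qed
  define G where "G = (\<lambda>s. f (u + s *\<^sub>R a + h *\<^sub>R b) - f (u + s *\<^sub>R a))"
  have "DERIV G s :> ?fa (u + s *\<^sub>R a + h *\<^sub>R b) - ?fa (u + s *\<^sub>R a)" if "0 \<le> s" "s \<le> h" for s
  proof -
    have eq: "u + s *\<^sub>R a + h *\<^sub>R b = (u + h *\<^sub>R b) + s *\<^sub>R a" for s by simp
    have "u + s *\<^sub>R a + h *\<^sub>R b \<in> W" "u + s *\<^sub>R a \<in> W"
      using assms(3)[OF that, of h] assms(3)[OF that, of 0] assms(2) by auto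
    then show ?thesis
      unfolding G_def eq by (intro DERIV_diff line[OF assms(1)])
  qed
  from MVT2[OF assms(2) this] obtain s where s: "0 < s" "s < h"
    "G h - G 0 = (h - 0) * (?fa (u + s *\<^sub>R a + h *\<^sub>R b) - ?fa (u + s *\<^sub>R a))"
    by blast
  have "DERIV (\<lambda>t. ?fa ((u + s *\<^sub>R a) + t *\<^sub>R b)) t
      :> frechet_derivative ?fa (at ((u + s *\<^sub>R a) + t *\<^sub>R b)) b" if "0 \<le> t" "t \<le> h" for t
    by (rule line[OF Cfa]) (use assms(3)[of s t] s that in auto)
  from MVT2[OF assms(2) this] obtain t where t: "0 < t" "t < h"
    "?fa (u + s *\<^sub>R a + h *\<^sub>R b) - ?fa (u + s *\<^sub>R a + 0 *\<^sub>R b)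
      = (h - 0) * frechet_derivative ?fa (at (u + s *\<^sub>R a + t *\<^sub>R b)) b"
    by blast
  show thesis
    by (rule that[of s t]) (use s t in \<open>auto simp: G_def\<close>)
qed

lemma Cinf_on_symmetric_real:
  fixes f :: "'a::euclidean_space \<Rightarrow> real"
  assumes f: "Cinf_on W f" and W: "open W" "u \<in> W"
  shows "frechet_derivative (\<lambda>x. frechet_derivative f (at x) a) (at u) b
       = frechet_derivative (\<lambda>x. frechet_derivative f (at x) b) (at u) a"
    (is "?A u = ?C u")
proof (rule ccontr)
  assume ne: "?A u \<noteq> ?C u"
  let ?\<delta> = "dist (?A u) (?C u) / 2"
  have d: "?\<delta> > 0" using ne by simp
  have "continuous_on W ?A" "continuous_on W ?C"
    by (intro Cinf_on_imp_continuous_on Cinf_on_frechet_derivative f)+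
  then have "open (W \<inter> ?A -` ball (?A u) ?\<delta>)" "open (W \<inter> ?C -` ball (?C u) ?\<delta>)"
    using W by (intro continuous_open_preimage; simp)+
  then have "open ((W \<inter> ?A -` ball (?A u) ?\<delta>) \<inter> (W \<inter> ?C -` ball (?C u) ?\<delta>))" by (rule open_Int)
  moreover have "u \<in> (W \<inter> ?A -` ball (?A u) ?\<delta>) \<inter> (W \<inter> ?C -` ball (?C u) ?\<delta>)" using W d by simp
  ultimately obtain e where e: "e > 0" "ball u e \<subseteq> (W \<inter> ?A -` ball (?A u) ?\<delta>) \<inter> (W \<inter> ?C -` ball (?C u) ?\<delta>)"
    unfolding open_contains_ball by blast
  \<comment> \<open>Small enough that the parallelogram spanned at u by h a and h b stays within
    distance e/2; the summand 1 covers the case a = b = 0.\<close>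
  define h where "h = (e / 2) / (norm a + norm b + 1)"
  have n: "norm a + norm b + 1 > 0" using norm_ge_zero[of a] norm_ge_zero[of b] by linarith
  have h: "h > 0" unfolding h_def using e(1) n by simp
  have in_ball: "u + s *\<^sub>R a + t *\<^sub>R b \<in> ball u e" if "0 \<le> s" "s \<le> h" "0 \<le> t" "t \<le> h" for s t
  proof -
    have "norm (s *\<^sub>R a + t *\<^sub>R b) \<le> s * norm a + t * norm b"
      using norm_triangle_ineq[of "s *\<^sub>R a" "t *\<^sub>R b"] that by simp
    also have "\<dots> \<le> h * norm a + h * norm b" using that by (intro add_mono mult_right_mono) auto
    also have "\<dots> \<le> h * (norm a + norm b + 1)" using h by (simp add: algebra_simps)
    also have "\<dots> = e / 2"
      unfolding h_def by (rule nonzero_eq_divide_eq[THEN iffD1, OF _ HOL.refl]) (use n in simp)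
    also have "\<dots> < e" using e(1) by simp
    finally have "norm (s *\<^sub>R a + t *\<^sub>R b) < e" .
    moreover have "dist u (u + s *\<^sub>R a + t *\<^sub>R b) = norm (s *\<^sub>R a + t *\<^sub>R b)"
      unfolding dist_norm by (metis add.assoc add_diff_cancel_left' norm_minus_commute)
    ultimately show ?thesis by simp
  qed
  obtain s t where st: "0 \<le> s" "s \<le> h" "0 \<le> t" "t \<le> h"
    "f (u + h *\<^sub>R a + h *\<^sub>R b) - f (u + h *\<^sub>R a) - f (u + h *\<^sub>R b) + f u = h * h * ?A (u + s *\<^sub>R a + t *\<^sub>R b)"
    by (rule Cinf_on_second_difference[OF f h, of u a b]) (use in_ball e in auto)
  have in_ball': "u + s *\<^sub>R b + t *\<^sub>R a \<in> ball u e" if "0 \<le> s" "s \<le> h" "0 \<le> t" "t \<le> h" for s t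
    using in_ball[OF that(3,4,1,2)] by (simp add: add_ac)
  obtain s' t' where st': "0 \<le> s'" "s' \<le> h" "0 \<le> t'" "t' \<le> h"
    "f (u + h *\<^sub>R b + h *\<^sub>R a) - f (u + h *\<^sub>R b) - f (u + h *\<^sub>R a) + f u = h * h * ?C (u + s' *\<^sub>R b + t' *\<^sub>R a)"
    by (rule Cinf_on_second_difference[OF f h, of u b a]) (use in_ball' e in auto)
  have "h * h * ?A (u + s *\<^sub>R a + t *\<^sub>R b) = h * h * ?C (u + s' *\<^sub>R b + t' *\<^sub>R a)"
    unfolding st(5)[symmetric] st'(5)[symmetric] by (simp add: add_ac)
  then have "?A (u + s *\<^sub>R a + t *\<^sub>R b) = ?C (u + s' *\<^sub>R b + t' *\<^sub>R a)" using h by simp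
  moreover have "dist (?A u) (?A (u + s *\<^sub>R a + t *\<^sub>R b)) < ?\<delta>"
    using in_ball[OF st(1-4)] e(2) by auto
  moreover have "dist (?C u) (?C (u + s' *\<^sub>R b + t' *\<^sub>R a)) < ?\<delta>"
    using in_ball'[OF st'(1-4)] e(2) by auto
  ultimately show False
    using dist_triangle_less_add[of "?A u" "?A (u + s *\<^sub>R a + t *\<^sub>R b)" ?\<delta> "?C u" ?\<delta>]
    by (simp add: dist_commute)
qed

lemma Cinf_on_symmetric:
  fixes f :: "'a::euclidean_space \<Rightarrow> 'b::euclidean_space"
  assumes f: "Cinf_on W f" and W: "open W" "u \<in> W"
  shows "frechet_derivative (\<lambda>x. frechet_derivative f (at x) a) (at u) b
       = frechet_derivative (\<lambda>x. frechet_derivative f (at x) b) (at u) a"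
proof (rule euclidean_eqI)
  fix e :: 'b assume "e \<in> Basis"
  have inner: "frechet_derivative (\<lambda>x. g x \<bullet> e) (at x) v = frechet_derivative g (at x) v \<bullet> e"
    if "Cinf_on W g" "x \<in> W" for g :: "'a \<Rightarrow> 'b" and x v
    using has_derivative_inner_left[OF Cinf_on_has_derivative[OF that], of e] frechet_derivative_at by metis
  have second: "frechet_derivative (\<lambda>x. frechet_derivative f (at x) a) (at u) b \<bullet> e
      = frechet_derivative (\<lambda>x. frechet_derivative (\<lambda>x. f x \<bullet> e) (at x) a) (at u) b" for a b
  proof -
    have C: "Cinf_on W (\<lambda>x. frechet_derivative f (at x) a)" by (rule Cinf_on_frechet_derivative[OF f])
    have "frechet_derivative (\<lambda>x. frechet_derivative f (at x) a \<bullet> e) (at u)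
        = frechet_derivative (\<lambda>x. frechet_derivative (\<lambda>x. f x \<bullet> e) (at x) a) (at u)"
      by (rule frechet_derivative_transform_within_open[OF _ W])
        (use Cinf_on_has_derivative[OF Cinf_on_bounded_linear[OF bounded_linear_inner_left W(1) C] W(2)]
          inner[OF f] in \<open>auto simp: differentiable_def\<close>)
    then show ?thesis using inner[OF C W(2)] by metis
  qed
  show "frechet_derivative (\<lambda>x. frechet_derivative f (at x) a) (at u) b \<bullet> e
       = frechet_derivative (\<lambda>x. frechet_derivative f (at x) b) (at u) a \<bullet> e"
    unfolding second
    by (rule Cinf_on_symmetric_real[OF Cinf_on_bounded_linear[OF bounded_linear_inner_left W(1) f] W])
qed

lemma tangent_space_open: "open W \<Longrightarrow> u \<in> W \<Longrightarrow> v \<in> tangent_space W u"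
proof -
  assume W: "open W" "u \<in> W"
  have "v \<in> tangent_space UNIV u"
    by (rule tangent_spaceI[of 1 "\<lambda>t. u + t *\<^sub>R v"]) (auto intro!: Cinf_intros derivative_eq_intros)
  then have "frechet_derivative (\<lambda>x. x) (at u) v \<in> tangent_space W u"
    by (rule tangent_space_image[OF _ W Cinf_on_id[OF W(1)]]) auto
  then show "v \<in> tangent_space W u" by simp
qed

lemma tangent_space_openin:
  assumes "openin (top_of_set M) U" "p \<in> U" "v \<in> tangent_space M p"
  shows "v \<in> tangent_space U p"
proof -
  obtain O' where O: "open O'" "U = M \<inter> O'" using assms(1) unfolding openin_open by blast
  have "frechet_derivative (\<lambda>x. x) (at p) v \<in> tangent_space U p"
    by (rule tangent_space_image[OF assms(3) O(1) _ Cinf_on_id[OF O(1)]]) (use assms(2) O in auto)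
  then show ?thesis by simp
qed

lemma matrix_inv_inverse:
  fixes A :: "real^'n^'n"
  assumes "\<And>x. A *v x = 0 \<Longrightarrow> x = 0"
  shows "A ** matrix_inv A = mat 1" "matrix_inv A ** A = mat 1"
proof -
  have "invertible A" using assms unfolding invertible_left_inverse matrix_left_invertible_ker by blast
  then have "A ** matrix_inv A = mat 1 \<and> matrix_inv A ** A = mat 1"
    unfolding invertible_def matrix_inv_def by (rule someI_ex)
  then show "A ** matrix_inv A = mat 1" "matrix_inv A ** A = mat 1" by auto
qed

abbreviation geodesic_lhs ::
    "('a::euclidean_space, 'n::finite) lorentz \<Rightarrow> 'a set \<Rightarrow> ('a \<Rightarrow> real^'n) \<Rightarrow> (real \<Rightarrow> 'a) \<Rightarrow> real \<Rightarrow> 'n \<Rightarrow> real" where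
  "geodesic_lhs S U \<phi> \<gamma> t k \<equiv> velocity (velocity (\<phi> \<circ> \<gamma>)) t $ k
    + (\<Sum>i\<in>UNIV. \<Sum>j\<in>UNIV. christoffel S (U, \<phi>) (\<phi> (\<gamma> t)) k i j
        * velocity (\<phi> \<circ> \<gamma>) t $ i * velocity (\<phi> \<circ> \<gamma>) t $ j)"

text \<open>As B does not depend on the point, all derivatives of the metric matrix come from the
  parametrisation. B may be indefinite; nondegeneracy is imposed on each tangent space.\<close>

locale ambient_metric =
  fixes S :: "('a::euclidean_space, 'n::finite) lorentz" and B :: "'a \<Rightarrow> 'a \<Rightarrow> real"
  assumes bilinear: "bounded_bilinear B" and B_sym: "B v w = B w v"
    and atlas_eq: "atlas S = submanifold_charts (points S)"
    and metric_eq: "p \<in> points S \<Longrightarrow> v \<in> tangent_space (points S) p \<Longrightarrow> w \<in> tangent_space (points S) p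
      \<Longrightarrow> metric S p v w = B v w"
    and nondegenerate: "p \<in> points S \<Longrightarrow> v \<in> tangent_space (points S) p
      \<Longrightarrow> (\<And>w. w \<in> tangent_space (points S) p \<Longrightarrow> B v w = 0) \<Longrightarrow> v = 0"

locale ambient_metric_chart = ambient_metric S B
  for S :: "('a::euclidean_space, 'n::finite) lorentz" and B +
  fixes U :: "'a set" and \<phi> :: "'a \<Rightarrow> real^'n"
  assumes chart: "(U, \<phi>) \<in> submanifold_charts (points S)"
begin

abbreviation "\<psi> \<equiv> inv_into U \<phi>"
abbreviation "W \<equiv> \<phi> ` U"
abbreviation "D i u \<equiv> partial_deriv i \<psi> u"
abbreviation "H j i u \<equiv> partial_deriv j (D i) u"
abbreviation "G \<equiv> metric_matrix S (U, \<phi>)"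

lemma chart_facts:
  shows U: "openin (top_of_set (points S)) U" and W: "open W" and inj: "inj_on \<phi> U"
    and smooth_phi: "smooth_on U \<phi>" and psi: "Cinf_on W \<psi>" and U_sub: "U \<subseteq> points S"
    and psi_W: "\<psi> ` W \<subseteq> U" "u \<in> W \<Longrightarrow> \<psi> u \<in> U" "u \<in> W \<Longrightarrow> \<phi> (\<psi> u) = u"
    and psi_phi: "p \<in> U \<Longrightarrow> \<psi> (\<phi> p) = p"
proof -
  show U: "openin (top_of_set (points S)) U" and W: "open W" and inj: "inj_on \<phi> U" and "smooth_on U \<phi>"
    using chart unfolding submanifold_charts_def by auto
  have "smooth_on W \<psi>" using chart unfolding submanifold_charts_def by auto
  then show "Cinf_on W \<psi>" by (simp only: smooth_on_open[OF W])
  show "U \<subseteq> points S" using U openin_imp_subset by blast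
  show "\<psi> ` W \<subseteq> U" "u \<in> W \<Longrightarrow> \<psi> u \<in> U" "u \<in> W \<Longrightarrow> \<phi> (\<psi> u) = u" for u
    by (auto intro: inv_into_into f_inv_into_f)
  show "p \<in> U \<Longrightarrow> \<psi> (\<phi> p) = p" by (rule inv_into_f_f[OF inj])
qed

lemma Cinf_D: "Cinf_on W (D i)"
  unfolding partial_deriv_def by (rule Cinf_on_frechet_derivative[OF psi])

lemma H_sym: "u \<in> W \<Longrightarrow> H j i u = H i j u"
  unfolding partial_deriv_def by (rule Cinf_on_symmetric[OF psi W])

lemma frechet_axis_sum:
  assumes "Cinf_on W f" "u \<in> W"
  shows "frechet_derivative f (at u) v = (\<Sum>i\<in>UNIV. (v $ i) *\<^sub>R partial_deriv i f u)"
proof -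
  have lin: "linear (frechet_derivative f (at u))"
    using Cinf_on_has_derivative[OF assms] has_derivative_linear by blast
  have "v = (\<Sum>i\<in>UNIV. (v $ i) *\<^sub>R axis i 1)"
    using basis_expansion[of v] by (simp add: scalar_mult_eq_scaleR)
  then have "frechet_derivative f (at u) v = frechet_derivative f (at u) (\<Sum>i\<in>UNIV. (v $ i) *\<^sub>R axis i 1)"
    by simp
  also have "\<dots> = (\<Sum>i\<in>UNIV. (v $ i) *\<^sub>R partial_deriv i f u)"
    by (simp add: linear_sum[OF lin] linear_scale[OF lin] partial_deriv_def)
  finally show ?thesis .
qed

lemma frechet_psi_tangent: "u \<in> W \<Longrightarrow> frechet_derivative \<psi> (at u) v \<in> tangent_space (points S) (\<psi> u)"
  by (rule tangent_space_image[OF tangent_space_open[OF W] W _ psi]) (use psi_W(1) U_sub in auto)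

lemma D_tangent: "u \<in> W \<Longrightarrow> D i u \<in> tangent_space (points S) (\<psi> u)"
  unfolding partial_deriv_def by (rule frechet_psi_tangent)

text \<open>If F extends \<phi> near p, then \<psi> \<circ> F is the identity on U near p.
  Differentiating along T exhibits T as the image of DF T under D\<psi>.\<close>

lemma tangent_span:
  assumes "p \<in> U" "T \<in> tangent_space (points S) p"
  obtains c where "T = frechet_derivative \<psi> (at (\<phi> p)) c"
proof -
  obtain O' F where F: "open O'" "p \<in> O'" "Cinf_on O' F" "\<forall>y\<in>O' \<inter> U. F y = \<phi> y"
    by (rule smooth_onE[OF smooth_phi assms(1)])
  let ?N = "O' \<inter> F -` W"
  have oN: "open ?N" by (rule Cinf_on_open_preimage[OF F(3) F(1) W])
  have Fp: "F p = \<phi> p" "F p \<in> W" using F assms(1) by auto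
  have CN: "Cinf_on ?N F" by (rule Cinf_on_subset[OF F(3)]) auto
  have "frechet_derivative (\<lambda>y. \<psi> (F y)) (at p) T = frechet_derivative (\<lambda>y. y) (at p) T"
  proof (rule frechet_derivative_tangent_cong[OF tangent_space_openin[OF U assms(1,2)] oN])
    show "p \<in> ?N" using F(2) Fp by simp
    show "Cinf_on ?N (\<lambda>y. \<psi> (F y))" by (rule Cinf_on_compose[OF psi CN oN W]) auto
    show "Cinf_on ?N (\<lambda>y. y)" by (rule Cinf_on_id[OF oN])
    show "\<psi> (F y) = y" if "y \<in> ?N \<inter> U" for y using that F(4) psi_phi by auto
  qed
  then have "T = frechet_derivative \<psi> (at (\<phi> p)) (frechet_derivative F (at p) T)"
    using frechet_derivative_compose_Cinf[OF psi F(3,2) Fp(2), of T] Fp(1) by simp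
  then show thesis by (rule that)
qed

lemma frechet_psi_inj:
  assumes "u \<in> W" "frechet_derivative \<psi> (at u) v = 0"
  shows "v = 0"
proof -
  obtain O' F where F: "open O'" "\<psi> u \<in> O'" "Cinf_on O' F" "\<forall>y\<in>O' \<inter> U. F y = \<phi> y"
    by (rule smooth_onE[OF smooth_phi psi_W(2)[OF assms(1)]])
  have oN: "open (W \<inter> \<psi> -` O')"
    by (rule Cinf_on_open_preimage[OF psi W F(1)])
  have "((\<lambda>x. F (\<psi> x)) has_derivative (\<lambda>v. v)) (at u)"
    by (rule has_derivative_transform_within_open[OF has_derivative_ident oN])
      (use assms(1) F psi_W in auto)
  then have "frechet_derivative (\<lambda>x. F (\<psi> x)) (at u) v = v"
    using frechet_derivative_at by metis
  then have v: "v = frechet_derivative F (at (\<psi> u)) 0"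
    using frechet_derivative_compose_Cinf[OF F(3) psi assms(1) F(2), of v] assms(2) by simp
  have "linear (frechet_derivative F (at (\<psi> u)))"
    using Cinf_on_has_derivative[OF F(3,2)] has_derivative_linear by blast
  then show ?thesis using v linear_0 by metis
qed

lemma G_eq:
  assumes "u \<in> W"
  shows "G u $ i $ j = B (D i u) (D j u)"
proof -
  have "\<psi> u \<in> points S" using psi_W(2)[OF assms] U_sub by blast
  from metric_eq[OF this D_tangent[OF assms] D_tangent[OF assms]] show ?thesis
    unfolding metric_matrix_def by simp
qed

lemma B_sum_left: "B (\<Sum>i\<in>A. f i) w = (\<Sum>i\<in>A. B (f i) w)"
  and B_sum_right: "B w (\<Sum>i\<in>A. f i) = (\<Sum>i\<in>A. B w (f i))"
  and B_add_left: "B (a + b) w = B a w + B b w"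
  and B_scale_left: "B (r *\<^sub>R a) w = r * B a w"
  and B_scale_right: "B w (r *\<^sub>R a) = r * B w a"
  using bounded_bilinear.sum_left[OF bilinear] bounded_bilinear.sum_right[OF bilinear]
    bounded_bilinear.add_left[OF bilinear] bounded_bilinear.scaleR_left[OF bilinear]
    bounded_bilinear.scaleR_right[OF bilinear] by auto

lemma orthogonal_iff:
  assumes "p \<in> U"
  shows "(\<forall>T\<in>tangent_space (points S) p. B Y T = 0) \<longleftrightarrow> (\<forall>l. B Y (D l (\<phi> p)) = 0)"
proof
  have u: "\<phi> p \<in> W" using assms by blast
  show "\<forall>l. B Y (D l (\<phi> p)) = 0" if "\<forall>T\<in>tangent_space (points S) p. B Y T = 0"
    using that D_tangent[OF u] psi_phi[OF assms] by auto
  show "\<forall>T\<in>tangent_space (points S) p. B Y T = 0" if *: "\<forall>l. B Y (D l (\<phi> p)) = 0"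
  proof
    fix T assume "T \<in> tangent_space (points S) p"
    then obtain c where "T = frechet_derivative \<psi> (at (\<phi> p)) c" by (rule tangent_span[OF assms])
    then show "B Y T = 0"
      using * by (simp add: frechet_axis_sum[OF psi u] B_sum_right B_scale_right)
  qed
qed

text \<open>A kernel vector c of G yields the tangent vector D\<psi> c, which is orthogonal to all
  coordinate fields and hence to the whole tangent space; it vanishes by nondegeneracy, and D\<psi>
  is injective.\<close>

lemma G_kernel:
  assumes "u \<in> W" "G u *v c = 0"
  shows "c = 0"
proof -
  let ?v = "frechet_derivative \<psi> (at u) c"
  have p: "\<psi> u \<in> U" "\<phi> (\<psi> u) = u" using psi_W assms(1) by auto
  have "B ?v (D l u) = (G u *v c) $ l" for l
    by (simp add: frechet_axis_sum[OF psi assms(1)] B_sum_left B_scale_left matrix_vector_mult_def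
        G_eq[OF assms(1)] B_sym[of "D l u"] mult.commute)
  then have "\<forall>T\<in>tangent_space (points S) (\<psi> u). B ?v T = 0"
    using orthogonal_iff[OF p(1), of ?v] p(2) assms(2) by simp
  then have "?v = 0"
    using nondegenerate[OF _ frechet_psi_tangent[OF assms(1)]] p(1) U_sub by blast
  then show ?thesis by (rule frechet_psi_inj[OF assms(1)])
qed

lemma partial_deriv_G:
  assumes "u \<in> W"
  shows "partial_deriv m (\<lambda>w. G w $ i $ j) u = B (H m i u) (D j u) + B (D i u) (H m j u)"
proof -
  have "((\<lambda>w. B (D i w) (D j w)) has_derivative
      (\<lambda>v. B (D i u) (frechet_derivative (D j) (at u) v) + B (frechet_derivative (D i) (at u) v) (D j u))) (at u)"
    by (rule bounded_bilinear.FDERIV[OF bilinear Cinf_on_has_derivative[OF Cinf_D assms]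
          Cinf_on_has_derivative[OF Cinf_D assms]])
  then have "((\<lambda>w. G w $ i $ j) has_derivative
      (\<lambda>v. B (D i u) (frechet_derivative (D j) (at u) v) + B (frechet_derivative (D i) (at u) v) (D j u))) (at u)"
    by (rule has_derivative_transform_within_open[OF _ W assms]) (simp add: G_eq)
  from frechet_derivative_at[OF this, symmetric] show ?thesis
    unfolding partial_deriv_def by (simp add: add.commute)
qed

text \<open>The entries of the metric matrix are B(D_i, D_j). Since second derivatives are
  symmetric, the combination of three derivatives in the Christoffel symbol collapses to 2 B(H_ij,
  D_l).\<close>

lemma christoffel_eq:
  assumes "u \<in> W"
  shows "christoffel S (U, \<phi>) u k i j = (\<Sum>l\<in>UNIV. matrix_inv (G u) $ k $ l * B (H i j u) (D l u))"
proof -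
  have "partial_deriv i (\<lambda>w. G w $ l $ j) u + partial_deriv j (\<lambda>w. G w $ l $ i) u
      - partial_deriv l (\<lambda>w. G w $ i $ j) u = 2 * B (H i j u) (D l u)" for l
    unfolding partial_deriv_G[OF assms]
    using H_sym[OF assms, of i l] H_sym[OF assms, of j l] H_sym[OF assms, of j i]
      B_sym[of "D l u" "H i j u"] B_sym[of "D i u" "H l j u"]
    by simp
  then show ?thesis
    unfolding christoffel_def by (simp add: sum_distrib_left mult_ac)
qed

text \<open>In coordinates \<gamma>'' is the sum of the terms u'_i u'_j H_ij and u''_i D_i. Pairing
  it with the D_l gives b = G u'' + q, while the left side of the geodesic equation is E = u'' +
  G^-1 q. Hence G E = b, and E and b vanish together because G is invertible.\<close>

lemma geodesic_equation_iff:
  assumes I: "open I" "t \<in> I" and g: "smooth_on I \<gamma>" "\<gamma> ` I \<subseteq> points S" and tU: "\<gamma> t \<in> U"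
  shows "(\<forall>k. geodesic_lhs S U \<phi> \<gamma> t k = 0)
    \<longleftrightarrow> (\<forall>T\<in>tangent_space (points S) (\<gamma> t). B (velocity (velocity \<gamma>) t) T = 0)"
proof -
  obtain O' where O: "open O'" "U = points S \<inter> O'" using U unfolding openin_open by blast
  define J where "J = I \<inter> \<gamma> -` O'"
  have J: "open J" unfolding J_def
    by (rule continuous_open_preimage[OF smooth_on_imp_continuous_on[OF g(1)] I(1) O(1)])
  have tJ: "t \<in> J" using I(2) tU O(2) unfolding J_def by auto
  have gJ: "\<gamma> s \<in> U" if "s \<in> J" for s using that g(2) O(2) unfolding J_def by auto
  have sg: "smooth_on J \<gamma>" by (rule smooth_on_subset[OF g(1)]) (auto simp: J_def)
  define u where "u = \<phi> \<circ> \<gamma>"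
  have "smooth_on J (\<lambda>s. \<phi> (\<gamma> s))" by (rule smooth_on_compose[OF smooth_phi sg]) (use gJ in auto)
  then have su: "smooth_on J u" unfolding u_def o_def .
  have uW: "u s \<in> W" "\<psi> (u s) = \<gamma> s" if "s \<in> J" for s
    using gJ[OF that] psi_phi unfolding u_def by auto
  have du: "(u has_vector_derivative velocity u s) (at s)" if "s \<in> J" for s
    unfolding velocity_def by (rule smooth_on_curve(1)[OF su J that])
  have "Cinf_on J (velocity u)"
    unfolding velocity_def by (rule smooth_on_curve(2)[OF su J tJ])
  then have svu: "smooth_on J (velocity u)" by (simp only: smooth_on_open[OF J])
  have ddu: "(velocity u has_vector_derivative velocity (velocity u) t) (at t)"
    unfolding velocity_def[of "velocity u"] by (rule smooth_on_curve(1)[OF svu J tJ])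
  have chain: "((\<lambda>s. f (u s)) has_vector_derivative (\<Sum>j\<in>UNIV. (velocity u s $ j) *\<^sub>R partial_deriv j f (u s))) (at s)"
    if f: "Cinf_on W f" and s: "s \<in> J" for f :: "real^'n \<Rightarrow> 'a" and s
    using vector_derivative_diff_chain_within[OF du[OF s] has_derivative_at_withinI[OF Cinf_on_has_derivative[OF f uW(1)[OF s]]]]
    unfolding frechet_axis_sum[OF f uW(1)[OF s]] by (simp add: o_def)
  have dg: "(\<gamma> has_vector_derivative (\<Sum>i\<in>UNIV. (velocity u s $ i) *\<^sub>R D i (u s))) (at s)" if "s \<in> J" for s
    by (rule has_vector_derivative_transform_within_open[OF chain[OF psi that] J that]) (rule uW(2))
  then have vg: "velocity \<gamma> s = (\<Sum>i\<in>UNIV. (velocity u s $ i) *\<^sub>R D i (u s))" if "s \<in> J" for s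
    unfolding velocity_def[of \<gamma>] using that vector_derivative_at by blast
  have comp: "((\<lambda>s. velocity u s $ i) has_vector_derivative velocity (velocity u) t $ i) (at t)" for i
    by (rule bounded_linear.has_vector_derivative[OF bounded_linear_vec_nth ddu])
  have "((\<lambda>s. \<Sum>i\<in>UNIV. (velocity u s $ i) *\<^sub>R D i (u s)) has_vector_derivative
      (\<Sum>i\<in>UNIV. (velocity u t $ i) *\<^sub>R (\<Sum>j\<in>UNIV. (velocity u t $ j) *\<^sub>R H j i (u t))
        + (velocity (velocity u) t $ i) *\<^sub>R D i (u t))) (at t)"
    by (intro has_vector_derivative_sum has_vector_derivative_scaleR chain[OF Cinf_D tJ])
      (simp add: comp has_real_derivative_iff_has_vector_derivative)
  then have "(velocity \<gamma> has_vector_derivative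
      (\<Sum>i\<in>UNIV. (velocity u t $ i) *\<^sub>R (\<Sum>j\<in>UNIV. (velocity u t $ j) *\<^sub>R H j i (u t))
        + (velocity (velocity u) t $ i) *\<^sub>R D i (u t))) (at t)"
    by (rule has_vector_derivative_transform_within_open[OF _ J tJ]) (simp add: vg)
  then have vvg: "velocity (velocity \<gamma>) t = (\<Sum>i\<in>UNIV. (velocity u t $ i) *\<^sub>R (\<Sum>j\<in>UNIV. (velocity u t $ j) *\<^sub>R H j i (u t))
        + (velocity (velocity u) t $ i) *\<^sub>R D i (u t))"
    unfolding velocity_def[of "velocity \<gamma>"] by (rule vector_derivative_at)
  let ?u = "u t" and ?u' = "velocity u t" and ?u'' = "velocity (velocity u) t"
  note ut = uW(1)[OF tJ]
  define b where "b = (\<chi> l. B (velocity (velocity \<gamma>) t) (D l ?u))"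
  define q where "q = (\<chi> l. \<Sum>i\<in>UNIV. \<Sum>j\<in>UNIV. ?u' $ i * ?u' $ j * B (H i j ?u) (D l ?u))"
  define E where "E = (\<chi> k. ?u'' $ k + (\<Sum>i\<in>UNIV. \<Sum>j\<in>UNIV. christoffel S (U, \<phi>) ?u k i j * ?u' $ i * ?u' $ j))"
  have b: "b = G ?u *v ?u'' + q"
    unfolding b_def q_def vvg vec_eq_iff
    by (simp add: B_sum_left B_add_left B_scale_left matrix_vector_mult_def G_eq[OF ut] sum.distrib
        sum_distrib_left B_sym[of "D _ ?u" "D _ ?u"] mult_ac H_sym[OF ut])
  have E: "E = ?u'' + matrix_inv (G ?u) *v q"
  proof -
    have "(\<Sum>i\<in>UNIV. \<Sum>j\<in>UNIV. christoffel S (U, \<phi>) ?u k i j * ?u' $ i * ?u' $ j) = (matrix_inv (G ?u) *v q) $ k" for k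
    proof -
      have "(matrix_inv (G ?u) *v q) $ k
          = (\<Sum>l\<in>UNIV. \<Sum>i\<in>UNIV. \<Sum>j\<in>UNIV. matrix_inv (G ?u) $ k $ l * B (H i j ?u) (D l ?u) * ?u' $ i * ?u' $ j)"
        by (simp add: matrix_vector_mult_def q_def sum_distrib_left mult_ac)
      also have "\<dots> = (\<Sum>i\<in>UNIV. \<Sum>l\<in>UNIV. \<Sum>j\<in>UNIV. matrix_inv (G ?u) $ k $ l * B (H i j ?u) (D l ?u) * ?u' $ i * ?u' $ j)"
        by (rule sum.swap)
      also have "\<dots> = (\<Sum>i\<in>UNIV. \<Sum>j\<in>UNIV. \<Sum>l\<in>UNIV. matrix_inv (G ?u) $ k $ l * B (H i j ?u) (D l ?u) * ?u' $ i * ?u' $ j)"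
        by (rule sum.cong[OF HOL.refl]) (rule sum.swap)
      finally show ?thesis by (simp add: christoffel_eq[OF ut] sum_distrib_right)
    qed
    then show ?thesis unfolding E_def vec_eq_iff by simp
  qed
  note inv = matrix_inv_inverse[of "G ?u", OF G_kernel[OF ut]]
  have "G ?u *v E = b"
    unfolding E b by (simp add: matrix_vector_right_distrib matrix_vector_mul_assoc inv)
  then have "E = 0 \<longleftrightarrow> b = 0" using G_kernel[OF ut, of E] by auto
  moreover have "b = 0 \<longleftrightarrow> (\<forall>T\<in>tangent_space (points S) (\<gamma> t). B (velocity (velocity \<gamma>) t) T = 0)"
    using orthogonal_iff[OF tU] unfolding b_def vec_eq_iff u_def by simp
  moreover have "E = 0 \<longleftrightarrow> (\<forall>k. geodesic_lhs S U \<phi> \<gamma> t k = 0)"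
    unfolding E_def vec_eq_iff u_def by simp
  ultimately show ?thesis by blast
qed

end

text \<open>The right side is free of charts. The charts have to cover so that at every time some
  instance of the coordinate equation is available.\<close>

lemma (in ambient_metric) geodesic_iff:
  assumes cover: "\<And>p. p \<in> points S \<Longrightarrow> \<exists>(U, \<phi>)\<in>submanifold_charts (points S) :: ('a, 'n) chart set. p \<in> U"
  shows "geodesic S I \<gamma> \<longleftrightarrow> open I \<and> is_interval I \<and> I \<noteq> {} \<and> smooth_on I \<gamma> \<and> \<gamma> ` I \<subseteq> points S \<and>
    (\<forall>t\<in>I. \<forall>T\<in>tangent_space (points S) (\<gamma> t). B (velocity (velocity \<gamma>) t) T = 0)"
proof -
  have eq: "(\<forall>k. geodesic_lhs S U \<phi> \<gamma> t k = 0)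
      \<longleftrightarrow> (\<forall>T\<in>tangent_space (points S) (\<gamma> t). B (velocity (velocity \<gamma>) t) T = 0)"
    if "(U, \<phi>) \<in> submanifold_charts (points S)" "open I" "smooth_on I \<gamma>" "\<gamma> ` I \<subseteq> points S" "t \<in> I" "\<gamma> t \<in> U" for U \<phi> t
  proof -
    interpret ambient_metric_chart S B U \<phi> by unfold_locales (rule that(1))
    show ?thesis by (rule geodesic_equation_iff[OF that(2,5,3,4,6)])
  qed
  show ?thesis
    unfolding geodesic_def atlas_eq
  proof (intro conj_cong HOL.refl, rule iffI)
    assume a: "open I" "smooth_on I \<gamma>" "\<gamma> ` I \<subseteq> points S"
    assume g: "\<forall>(U, \<phi>)\<in>submanifold_charts (points S). \<forall>t\<in>I. \<gamma> t \<in> U \<longrightarrow> (\<forall>k. geodesic_lhs S U \<phi> \<gamma> t k = 0)"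
    show "\<forall>t\<in>I. \<forall>T\<in>tangent_space (points S) (\<gamma> t). B (velocity (velocity \<gamma>) t) T = 0"
    proof
      fix t assume t: "t \<in> I"
      then obtain U and \<phi> :: "'a \<Rightarrow> real^'n" where c: "(U, \<phi>) \<in> submanifold_charts (points S)" "\<gamma> t \<in> U"
        using cover[of "\<gamma> t"] a(3) by blast
      have "\<forall>k. geodesic_lhs S U \<phi> \<gamma> t k = 0"
        using bspec[OF g c(1)] t c(2) by simp
      then show "\<forall>T\<in>tangent_space (points S) (\<gamma> t). B (velocity (velocity \<gamma>) t) T = 0"
        by (simp only: eq[OF c(1) a t c(2)])
    qed
  next
    assume a: "open I" "smooth_on I \<gamma>" "\<gamma> ` I \<subseteq> points S"
    assume g: "\<forall>t\<in>I. \<forall>T\<in>tangent_space (points S) (\<gamma> t). B (velocity (velocity \<gamma>) t) T = 0"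
    show "\<forall>(U, \<phi>)\<in>submanifold_charts (points S). \<forall>t\<in>I. \<gamma> t \<in> U \<longrightarrow> (\<forall>k. geodesic_lhs S U \<phi> \<gamma> t k = 0)"
    proof (safe)
      fix U and \<phi> :: "'a \<Rightarrow> real^'n" and t k
      assume c: "(U, \<phi>) \<in> submanifold_charts (points S)" "t \<in> I" "\<gamma> t \<in> U"
      show "geodesic_lhs S U \<phi> \<gamma> t k = 0"
        using eq[OF c(1) a c(2,3)] g c(2) by blast
    qed
  qed
qed

section \<open>Products of spheres\<close>

text \<open>One inclusion differentiates the constant squared norms of the two factors. For the
  other, the line p + t T is normalised in each factor; the normalising factor has derivative 0 at t
  = 0, so the velocity there is still T.\<close>

lemma tangent_space_product_spheres:
  fixes p :: "'a::euclidean_space \<times> 'b::euclidean_space"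
  assumes "p \<in> sphere 0 1 \<times> sphere 0 1"
  shows "tangent_space (sphere 0 1 \<times> sphere 0 1) p = {T. fst p \<bullet> fst T = 0 \<and> snd p \<bullet> snd T = 0}"
proof (intro set_eqI iffI)
  fix T assume T: "T \<in> tangent_space (sphere 0 1 \<times> sphere 0 1) p"
  have "frechet_derivative (\<lambda>q. fst q \<bullet> fst q) (at p) T = frechet_derivative (\<lambda>q. 1) (at p) T"
    by (rule frechet_derivative_tangent_cong[OF T open_UNIV UNIV_I])
      (auto intro!: Cinf_intros simp: norm_eq_1)
  moreover have "((\<lambda>q. fst q \<bullet> fst q) has_derivative (\<lambda>T. fst p \<bullet> fst T + fst T \<bullet> fst p)) (at p)"
    by (auto intro!: derivative_eq_intros)
  moreover have "frechet_derivative (\<lambda>q. snd q \<bullet> snd q) (at p) T = frechet_derivative (\<lambda>q. 1) (at p) T"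
    by (rule frechet_derivative_tangent_cong[OF T open_UNIV UNIV_I])
      (auto intro!: Cinf_intros simp: norm_eq_1)
  moreover have "((\<lambda>q. snd q \<bullet> snd q) has_derivative (\<lambda>T. snd p \<bullet> snd T + snd T \<bullet> snd p)) (at p)"
    by (auto intro!: derivative_eq_intros)
  ultimately show "T \<in> {T. fst p \<bullet> fst T = 0 \<and> snd p \<bullet> snd T = 0}"
    by (simp add: inner_commute frechet_derivative_at[symmetric])
next
  fix T assume T: "T \<in> {T. fst p \<bullet> fst T = 0 \<and> snd p \<bullet> snd T = 0}"
  define r where "r = (\<lambda>n t::real. 1 / sqrt (1 + n * t\<^sup>2))"
  have pos: "1 + n * t\<^sup>2 > 0" if "n \<ge> 0" for n t :: real using that by (simp add: add_pos_nonneg)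
  have Cr: "Cinf_on UNIV (r n)" if "n \<ge> 0" for n
    unfolding r_def
    by (intro Cinf_on_divide_real Cinf_on_sqrt Cinf_intros open_UNIV)
      (use pos[OF that] in \<open>auto simp: less_imp_neq[symmetric] real_sqrt_eq_zero_cancel_iff\<close>)
  have dr: "(r n has_field_derivative 0) (at 0)" for n
    unfolding r_def by (auto intro!: derivative_eq_intros)
  have curve: "((\<lambda>t. r n t *\<^sub>R (a + t *\<^sub>R b)) has_vector_derivative b) (at 0)"
    for n and a b :: "'c::euclidean_space"
    by (rule has_vector_derivative_eq_rhs[OF has_vector_derivative_scaleR[OF dr]])
      (auto intro!: derivative_eq_intros simp: r_def)
  have nrm: "norm (r (b \<bullet> b) t *\<^sub>R (a + t *\<^sub>R b)) = 1" if "norm a = 1" "a \<bullet> b = 0"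
    for a b :: "'c::euclidean_space" and t
  proof -
    have "(norm (a + t *\<^sub>R b))\<^sup>2 = 1 + (b \<bullet> b) * t\<^sup>2"
      unfolding power2_norm_eq_inner
      using that by (simp add: inner_add_left inner_add_right norm_eq_1 inner_commute power2_eq_square)
    then have "norm (a + t *\<^sub>R b) = sqrt (1 + (b \<bullet> b) * t\<^sup>2)" by (rule real_sqrt_unique[OF _ norm_ge_zero, symmetric])
    then show ?thesis using pos[of "b \<bullet> b" t] by (simp add: r_def)
  qed
  let ?\<eta> = "\<lambda>t. (r (fst T \<bullet> fst T) t *\<^sub>R (fst p + t *\<^sub>R fst T), r (snd T \<bullet> snd T) t *\<^sub>R (snd p + t *\<^sub>R snd T))"
  show "T \<in> tangent_space (sphere 0 1 \<times> sphere 0 1) p"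
  proof (rule tangent_spaceI[of 1 ?\<eta>])
    have "Cinf_on UNIV ?\<eta>" by (intro Cinf_intros Cr open_UNIV inner_ge_zero)
    then show "Cinf_on {-1<..<1} ?\<eta>" by (rule Cinf_on_subset) auto
    show "?\<eta> ` {-1<..<1} \<subseteq> sphere 0 1 \<times> sphere 0 1"
      using assms T by (auto simp: nrm mem_Times_iff simp del: norm_scaleR)
    show "?\<eta> 0 = p" by (simp add: r_def)
    show "(?\<eta> has_vector_derivative T) (at 0)"
      using has_vector_derivative_Pair[OF curve curve, of "fst T \<bullet> fst T" "fst p" "fst T" "snd T \<bullet> snd T" "snd p" "snd T"] by simp
  qed simp
qed

text \<open>Each factor is centrally projected after its base point has been moved to a standard
  position, by an orthogonal map in R^3 and by multiplication with a unit complex number in C. Half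
  of each factor around the base point is covered, and the image is all of R^3.\<close>

lemma product_spheres_charts_cover:
  fixes p :: "(real^3) \<times> complex"
  assumes "p \<in> sphere 0 1 \<times> sphere 0 1"
  shows "\<exists>(U, \<phi>)\<in>submanifold_charts (sphere 0 1 \<times> sphere 0 1) :: ((real^3) \<times> complex, 3) chart set. p \<in> U"
proof -
  obtain x0 z0 where p: "p = (x0, z0)" "norm x0 = 1" "norm z0 = 1" using assms by (cases p) auto
  obtain f where f: "orthogonal_transformation f" "f (axis 1 1 :: real^3) = x0"
    by (rule orthogonal_transformation_exists_1[of "axis 1 1 :: real^3" x0]) (simp_all add: p norm_axis_1)
  define g where "g = inv f"
  have gf: "g (f y) = y" "f (g y) = y" for y
    unfolding g_def using orthogonal_transformation_bij[OF f(1)] by (auto simp: bij_is_inj bij_is_surj surj_f_inv_f)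
  have og: "orthogonal_transformation g" unfolding g_def by (rule orthogonal_transformation_inv[OF f(1)])
  have ng: "norm (g y) = norm y" "norm (f y) = norm y" for y
    using og f(1) orthogonal_transformation_norm by auto
  have blf: "bounded_linear f" and blg: "bounded_linear g"
    using f(1) og orthogonal_transformation_linear linear_conv_bounded_linear by blast+
  have flin: "f (a *\<^sub>R y) = a *\<^sub>R f y" "g (a *\<^sub>R y) = a *\<^sub>R g y" for a y
    using blf blg by (simp_all add: linear_simps)
  define \<phi> :: "(real^3) \<times> complex \<Rightarrow> real^3" where "\<phi> = (\<lambda>q. \<chi> i. if i = 1 then g (fst q) $ 2 / g (fst q) $ 1
      else if i = 2 then g (fst q) $ 3 / g (fst q) $ 1 else Im (cnj z0 * snd q) / Re (cnj z0 * snd q))"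
  define \<psi> :: "real^3 \<Rightarrow> (real^3) \<times> complex" where "\<psi> = (\<lambda>u.
      ((1 / sqrt (1 + (u$1)\<^sup>2 + (u$2)\<^sup>2)) *\<^sub>R f (\<chi> i. if i = 1 then 1 else if i = 2 then u$1 else u$2),
       (1 / sqrt (1 + (u$3)\<^sup>2)) *\<^sub>R (z0 * Complex 1 (u$3))))"
  define V where "V = {q. g (fst q) $ 1 > 0 \<and> Re (cnj z0 * snd q) > 0}"
  define U where "U = (sphere 0 1 \<times> sphere 0 1) \<inter> V"
  have "continuous_on UNIV (\<lambda>q :: (real^3) \<times> complex. g (fst q) $ 1)"
    by (rule Cinf_on_imp_continuous_on) (intro Cinf_on_vec_nth Cinf_on_bounded_linear[OF blg] Cinf_intros open_UNIV)
  moreover have "continuous_on UNIV (\<lambda>q :: (real^3) \<times> complex. Re (cnj z0 * snd q))"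
    by (rule Cinf_on_imp_continuous_on) (intro Cinf_intros open_UNIV)
  ultimately have oV: "open V"
    unfolding V_def by (intro open_Collect_conj open_Collect_less continuous_on_const)
  have z0: "cnj z0 * (z0 * w) = w" "z0 * (cnj z0 * w) = w" for w
  proof -
    have "cnj z0 * z0 = 1" using p(3) complex_norm_square[of z0] by (simp add: mult.commute)
    then show "cnj z0 * (z0 * w) = w" "z0 * (cnj z0 * w) = w" by (metis mult.assoc mult.commute mult_1_left)+
  qed
  have S: "1 + (a::real)\<^sup>2 + b\<^sup>2 > 0" "1 + (a::real)\<^sup>2 > 0" for a b by (simp_all add: add_pos_nonneg)
  have norm3: "(norm y)\<^sup>2 = (y$1)\<^sup>2 + (y$2)\<^sup>2 + (y$3)\<^sup>2" for y :: "real^3"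
    by (simp add: norm_vec_def L2_set_def sum_3)
  have psiU: "\<psi> u \<in> U" and phipsi: "\<phi> (\<psi> u) = u" for u
  proof -
    let ?y = "\<chi> i::3. if i = 1 then 1 else if i = 2 then u$1 else u$2"
    have "(norm ?y)\<^sup>2 = 1 + (u$1)\<^sup>2 + (u$2)\<^sup>2" by (simp add: norm3)
    then have "norm ?y = sqrt (1 + (u$1)\<^sup>2 + (u$2)\<^sup>2)" by (rule real_sqrt_unique[OF _ norm_ge_zero, symmetric])
    moreover have "norm (Complex 1 (u$3)) = sqrt (1 + (u$3)\<^sup>2)" by (simp add: cmod_def)
    ultimately have "norm (fst (\<psi> u)) = 1" "norm (snd (\<psi> u)) = 1"
      using S(1)[of "u$1" "u$2"] S(2)[of "u$3"] p by (simp_all add: \<psi>_def ng norm_mult)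
    moreover have "g (fst (\<psi> u)) $ 1 = 1 / sqrt (1 + (u$1)\<^sup>2 + (u$2)\<^sup>2)"
      "Re (cnj z0 * snd (\<psi> u)) = 1 / sqrt (1 + (u$3)\<^sup>2)"
      by (simp_all add: \<psi>_def flin gf z0)
    ultimately show "\<psi> u \<in> U"
      using S(1)[of "u$1" "u$2"] S(2)[of "u$3"] by (simp add: U_def V_def mem_Times_iff)
    show "\<phi> (\<psi> u) = u"
      using S(1)[of "u$1" "u$2"] S(2)[of "u$3"]
      by (simp add: \<phi>_def \<psi>_def gf flin z0 vec_eq_iff forall_3)
  qed
  have psiphi: "\<psi> (\<phi> q) = q" if "q \<in> U" for q
  proof -
    let ?y = "g (fst q)" and ?w = "cnj z0 * snd q"
    have y: "?y $ 1 > 0" "norm ?y = 1" and w: "Re ?w > 0" "norm ?w = 1"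
      using that p unfolding U_def V_def by (auto simp: ng norm_mult)
    have "1 + (?y$2 / ?y$1)\<^sup>2 + (?y$3 / ?y$1)\<^sup>2 = ((?y$1)\<^sup>2 + (?y$2)\<^sup>2 + (?y$3)\<^sup>2) / (?y$1)\<^sup>2"
      using y(1) by (simp add: power_divide add_divide_distrib)
    also have "\<dots> = (1 / ?y$1)\<^sup>2" unfolding norm3[symmetric] y(2) by (simp add: power_divide)
    finally have "1 + (?y$2 / ?y$1)\<^sup>2 + (?y$3 / ?y$1)\<^sup>2 = (1 / ?y$1)\<^sup>2" .
    then have 1: "1 / sqrt (1 + (?y$2 / ?y$1)\<^sup>2 + (?y$3 / ?y$1)\<^sup>2) = ?y$1" using y by simp
    have "(Re ?w)\<^sup>2 * (1 + (Im ?w / Re ?w)\<^sup>2) = 1"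
      using cmod_power2[of ?w] w by (simp add: field_simps)
    then have "1 + (Im ?w / Re ?w)\<^sup>2 = (1 / Re ?w)\<^sup>2" using w by (simp add: field_simps)
    then have 2: "1 / sqrt (1 + (Im ?w / Re ?w)\<^sup>2) = Re ?w" using w by simp
    have ph: "\<phi> q $ 1 = ?y$2 / ?y$1" "\<phi> q $ 2 = ?y$3 / ?y$1" "\<phi> q $ 3 = Im ?w / Re ?w"
      by (simp_all add: \<phi>_def)
    have "fst (\<psi> (\<phi> q)) = f (?y$1 *\<^sub>R (\<chi> i. if i = 1 then 1 else if i = 2 then ?y$2 / ?y$1 else ?y$3 / ?y$1))"
      by (simp only: \<psi>_def ph fst_conv 1 flin)
    also have "?y$1 *\<^sub>R (\<chi> i. if i = 1 then 1 else if i = 2 then ?y$2 / ?y$1 else ?y$3 / ?y$1) = ?y"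
      using y by (simp add: vec_eq_iff forall_3)
    finally have 3: "fst (\<psi> (\<phi> q)) = fst q" by (simp add: gf)
    have 4: "snd (\<psi> (\<phi> q)) = z0 * (Re ?w *\<^sub>R Complex 1 (Im ?w / Re ?w))"
      by (simp only: \<psi>_def ph snd_conv 2 mult_scaleR_right)
    have 5: "Re ?w *\<^sub>R Complex 1 (Im ?w / Re ?w) = ?w" using w by (simp add: complex_eq_iff)
    show ?thesis using 3 4[unfolded 5 z0(2)] by (rule prod_eqI)
  qed
  have Cphi: "Cinf_on V \<phi>"
  proof -
    have 1: "Cinf_on V (\<lambda>q. g (fst q) $ i)" for i
      by (intro Cinf_intros Cinf_on_bounded_linear[OF blg] oV)
    have "Cinf_on V (\<lambda>q. g (fst q) $ 2 / g (fst q) $ 1)" "Cinf_on V (\<lambda>q. g (fst q) $ 3 / g (fst q) $ 1)"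
      "Cinf_on V (\<lambda>q. Im (cnj z0 * snd q) / Re (cnj z0 * snd q))"
      by (intro Cinf_on_divide_real 1 oV Cinf_intros; force simp: V_def)+
    then have "Cinf_on V (\<lambda>q. if i = 1 then g (fst q) $ 2 / g (fst q) $ 1
      else if i = 2 then g (fst q) $ 3 / g (fst q) $ 1 else Im (cnj z0 * snd q) / Re (cnj z0 * snd q))" for i :: 3
      by (cases "i = 1"; cases "i = 2") simp_all
    then show ?thesis unfolding \<phi>_def by (intro Cinf_on_vec_lambda oV)
  qed
  have Cpsi: "Cinf_on UNIV \<psi>"
  proof -
    have "Cinf_on UNIV (\<lambda>u::real^3. if i = 1 then 1 else if i = 2 then u$1 else u$2)" for i :: 3
      by (cases "i = 1"; cases "i = 2") (simp_all add: Cinf_on_const Cinf_on_vec_nth Cinf_on_id)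
    then have 1: "Cinf_on UNIV (\<lambda>u::real^3. f (\<chi> i. if i = 1 then 1 else if i = 2 then u$1 else u$2))"
      by (intro Cinf_on_bounded_linear[OF blf] Cinf_on_vec_lambda open_UNIV)
    have 2: "Cinf_on UNIV (\<lambda>u::real^3. 1 / sqrt (1 + (u$1)\<^sup>2 + (u$2)\<^sup>2))" "Cinf_on UNIV (\<lambda>u::real^3. 1 / sqrt (1 + (u$3)\<^sup>2))"
      by (intro Cinf_on_divide_real Cinf_on_sqrt Cinf_intros open_UNIV;
          use S in \<open>simp add: less_imp_neq[symmetric] real_sqrt_eq_zero_cancel_iff\<close>)+
    show ?thesis unfolding \<psi>_def
      by (intro Cinf_on_Pair Cinf_on_scaleR 1 2 Cinf_intros Cinf_on_Complex open_UNIV)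
  qed
  have im: "\<phi> ` U = UNIV" using psiU phipsi by (metis UNIV_eq_I imageI)
  have inj: "inj_on \<phi> U" using psiphi by (metis inj_on_inverseI)
  have inv: "inv_into U \<phi> u = \<psi> u" for u
    using inv_into_f_f[OF inj psiU[of u]] phipsi by simp
  have "(U, \<phi>) \<in> submanifold_charts (sphere 0 1 \<times> sphere 0 1)"
    unfolding submanifold_charts_def
  proof (intro CollectI case_prodI conjI inj)
    show "openin (top_of_set (sphere 0 1 \<times> sphere 0 1)) U" unfolding U_def using oV by (simp add: openin_open_Int)
    show "open (\<phi> ` U)" unfolding im by (rule open_UNIV)
    show "smooth_on U \<phi>" by (rule Cinf_on_imp_smooth_on[OF Cphi oV]) (simp add: U_def)
    show "smooth_on (\<phi> ` U) (inv_into U \<phi>)" unfolding im inv[abs_def]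
      by (rule Cinf_on_imp_smooth_on[OF Cpsi open_UNIV]) simp
  qed
  moreover have "p \<in> U"
  proof -
    have "g x0 = axis 1 1" using gf(1)[of "axis 1 1"] f(2) by simp
    moreover have "Re (cnj z0 * z0) > 0" using z0(1)[of 1] by (simp only: mult_1_right one_complex.sel zero_less_one)
    ultimately show ?thesis unfolding U_def V_def p(1) using p(2,3) by (simp del: times_complex.sel)
  qed
  ultimately show ?thesis by blast
qed

text \<open>The rotated pairs \<open>P\<close>, \<open>Q\<close> below are constant, which determines \<open>f\<close>.\<close>

lemma harmonic_oscillator_unique:
  fixes f f' :: "real \<Rightarrow> 'a::real_normed_vector"
  assumes I: "is_interval I" "open I" "s \<in> I" "t \<in> I" and w: "\<omega> \<noteq> 0"
    and f: "\<And>t. t \<in> I \<Longrightarrow> (f has_vector_derivative f' t) (at t)"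
    and f': "\<And>t. t \<in> I \<Longrightarrow> (f' has_vector_derivative - (\<omega>\<^sup>2 *\<^sub>R f t)) (at t)"
  shows "f t = cos (\<omega> * (t - s)) *\<^sub>R f s + (sin (\<omega> * (t - s)) / \<omega>) *\<^sub>R f' s"
proof -
  define P where "P = (\<lambda>t. cos (\<omega> * (t - s)) *\<^sub>R f t - (sin (\<omega> * (t - s)) / \<omega>) *\<^sub>R f' t)"
  define Q where "Q = (\<lambda>t. (\<omega> * sin (\<omega> * (t - s))) *\<^sub>R f t + cos (\<omega> * (t - s)) *\<^sub>R f' t)"
  have cs: "((\<lambda>t. cos (\<omega> * (t - s))) has_field_derivative - (\<omega> * sin (\<omega> * (t - s)))) (at t)"
    "((\<lambda>t. sin (\<omega> * (t - s))) has_field_derivative \<omega> * cos (\<omega> * (t - s))) (at t)" for t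
    by (auto intro!: derivative_eq_intros)
  have "(P has_vector_derivative 0) (at t within I)" if "t \<in> I" for t
  proof -
    have "(P has_vector_derivative
        (cos (\<omega> * (t - s)) *\<^sub>R f' t + (- (\<omega> * sin (\<omega> * (t - s)))) *\<^sub>R f t)
        - ((sin (\<omega> * (t - s)) / \<omega>) *\<^sub>R (- (\<omega>\<^sup>2 *\<^sub>R f t)) + (\<omega> * cos (\<omega> * (t - s)) / \<omega>) *\<^sub>R f' t)) (at t)"
      unfolding P_def
      by (intro has_vector_derivative_diff has_vector_derivative_scaleR DERIV_cdivide cs f[OF that] f'[OF that])
    moreover have "(cos (\<omega> * (t - s)) *\<^sub>R f' t + (- (\<omega> * sin (\<omega> * (t - s)))) *\<^sub>R f t)
        - ((sin (\<omega> * (t - s)) / \<omega>) *\<^sub>R (- (\<omega>\<^sup>2 *\<^sub>R f t)) + (\<omega> * cos (\<omega> * (t - s)) / \<omega>) *\<^sub>R f' t) = 0"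
      using w by (simp add: power2_eq_square)
    ultimately show ?thesis using has_vector_derivative_at_within by metis
  qed
  from has_vector_derivative_zero_constant[OF is_interval_convex[OF I(1)] this]
  obtain c1 where c1: "\<And>t. t \<in> I \<Longrightarrow> P t = c1" by blast
  have "(Q has_vector_derivative 0) (at t within I)" if "t \<in> I" for t
  proof -
    have "(Q has_vector_derivative
        ((\<omega> * sin (\<omega> * (t - s))) *\<^sub>R f' t + (\<omega> * (\<omega> * cos (\<omega> * (t - s)))) *\<^sub>R f t)
        + (cos (\<omega> * (t - s)) *\<^sub>R (- (\<omega>\<^sup>2 *\<^sub>R f t)) + (- (\<omega> * sin (\<omega> * (t - s)))) *\<^sub>R f' t)) (at t)"
      unfolding Q_def
      by (intro has_vector_derivative_add has_vector_derivative_scaleR DERIV_cmult cs f[OF that] f'[OF that])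
    moreover have "((\<omega> * sin (\<omega> * (t - s))) *\<^sub>R f' t + (\<omega> * (\<omega> * cos (\<omega> * (t - s)))) *\<^sub>R f t)
        + (cos (\<omega> * (t - s)) *\<^sub>R (- (\<omega>\<^sup>2 *\<^sub>R f t)) + (- (\<omega> * sin (\<omega> * (t - s)))) *\<^sub>R f' t) = 0"
      by (simp add: power2_eq_square mult_ac)
    ultimately show ?thesis using has_vector_derivative_at_within by metis
  qed
  from has_vector_derivative_zero_constant[OF is_interval_convex[OF I(1)] this]
  obtain c2 where c2: "\<And>t. t \<in> I \<Longrightarrow> Q t = c2" by blast
  have "P t = f s" "Q t = f' s"
    using c1[OF I(3)] c1[OF I(4)] c2[OF I(3)] c2[OF I(4)] by (simp_all add: P_def Q_def)
  then have "cos (\<omega> * (t - s)) *\<^sub>R f s + (sin (\<omega> * (t - s)) / \<omega>) *\<^sub>R f' s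
     = cos (\<omega> * (t - s)) *\<^sub>R P t + (sin (\<omega> * (t - s)) / \<omega>) *\<^sub>R Q t" by simp
  also have "\<dots> = ((cos (\<omega> * (t - s)))\<^sup>2 + (sin (\<omega> * (t - s)))\<^sup>2) *\<^sub>R f t"
    using w unfolding P_def Q_def
    by (simp add: scaleR_diff_right scaleR_add_right power2_eq_square mult_ac)
      (simp add: sin_cos_squared_add3 flip: scaleR_add_left)
  finally show ?thesis by simp
qed

text \<open>Differentiating |X|^2 = 1 twice gives X'' \<bullet> X = -|X'|^2, and the speed is
  constant because X'' is parallel to X, hence orthogonal to X'. So X solves the oscillator equation
  whose frequency is the initial speed.\<close>

lemma sphere_geodesic_unique:
  fixes X X' X'' :: "real \<Rightarrow> 'a::real_inner"
  assumes I: "is_interval I" "open I" "s \<in> I" "t \<in> I"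
    and X: "\<And>t. t \<in> I \<Longrightarrow> (X has_vector_derivative X' t) (at t)"
    and X': "\<And>t. t \<in> I \<Longrightarrow> (X' has_vector_derivative X'' t) (at t)"
    and unit: "\<And>t. t \<in> I \<Longrightarrow> X t \<bullet> X t = 1" and normal: "\<And>t. t \<in> I \<Longrightarrow> X'' t = (X'' t \<bullet> X t) *\<^sub>R X t"
    and ne: "X' s \<noteq> 0"
  shows "X t = cos (norm (X' s) * (t - s)) *\<^sub>R X s + (sin (norm (X' s) * (t - s)) / norm (X' s)) *\<^sub>R X' s"
proof -
  have const: "D = 0" if "(h has_vector_derivative D) (at t)" "\<And>t. t \<in> I \<Longrightarrow> h t = c" "t \<in> I" for h :: "real \<Rightarrow> real" and D c t
  proof -
    have "((\<lambda>t. c) has_vector_derivative D) (at t)"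
      by (rule has_vector_derivative_transform_within_open[OF that(1) I(2) that(3)]) (rule that(2))
    then show ?thesis using vector_derivative_unique_at[OF has_vector_derivative_const] by metis
  qed
  have inner: "((\<lambda>t. F t \<bullet> G t) has_vector_derivative F t \<bullet> G' + F' \<bullet> G t) (at t)"
    if "(F has_vector_derivative F') (at t)" "(G has_vector_derivative G') (at t)" for F G :: "real \<Rightarrow> 'a" and F' G' t
    by (rule bounded_bilinear.has_vector_derivative[OF bounded_bilinear_inner that])
  have o: "X t \<bullet> X' t = 0" if "t \<in> I" for t
    using const[OF inner[OF X[OF that] X[OF that]] unit that] by (simp add: inner_commute)
  have o2: "X'' t \<bullet> X t = - (X' t \<bullet> X' t)" if "t \<in> I" for t
    using const[OF inner[OF X[OF that] X'[OF that]] o that] by (simp add: inner_commute)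
  have "((\<lambda>t. X' t \<bullet> X' t) has_vector_derivative 0) (at t within I)" if t: "t \<in> I" for t
  proof -
    have "X' t \<bullet> X'' t + X'' t \<bullet> X' t = 0"
      using o[OF t] by (subst (1 2) normal[OF t]) (simp add: inner_commute)
    then show ?thesis
      using inner[OF X'[OF t] X'[OF t]] has_vector_derivative_at_within by metis
  qed
  from has_vector_derivative_zero_constant[OF is_interval_convex[OF I(1)] this]
  obtain k where k: "\<And>t. t \<in> I \<Longrightarrow> X' t \<bullet> X' t = k" by blast
  have "X'' t = - ((norm (X' s))\<^sup>2 *\<^sub>R X t)" if "t \<in> I" for t
    using normal[OF that] o2[OF that] k[OF that] k[OF I(3)] by (simp add: power2_norm_eq_inner)
  then show ?thesis
    using ne X X' by (intro harmonic_oscillator_unique[OF I]) auto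
qed

section \<open>Null geodesics\<close>

text \<open>The phase z is bundled with the orthonormal pair because together they are exactly what
  starts a null geodesic, up to the scale of its velocity.\<close>

definition frame :: "real^3 \<Rightarrow> real^3 \<Rightarrow> complex \<Rightarrow> bool" where
  "frame x w z \<longleftrightarrow> x \<bullet> x = 1 \<and> w \<bullet> w = 1 \<and> x \<bullet> w = 0 \<and> norm z = 1"

definition rot_fst :: "real \<Rightarrow> real^3 \<Rightarrow> real^3 \<Rightarrow> real^3" where
  "rot_fst \<theta> x w = cos \<theta> *\<^sub>R x + sin \<theta> *\<^sub>R w"

definition rot_snd :: "real \<Rightarrow> real^3 \<Rightarrow> real^3 \<Rightarrow> real^3" where
  "rot_snd \<theta> x w = cos \<theta> *\<^sub>R w - sin \<theta> *\<^sub>R x"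

lemma rot_rot:
  "rot_fst \<alpha> (rot_fst \<theta> x w) (rot_snd \<theta> x w) = rot_fst (\<theta> + \<alpha>) x w"
  "rot_snd \<alpha> (rot_fst \<theta> x w) (rot_snd \<theta> x w) = rot_snd (\<theta> + \<alpha>) x w"
  by (simp_all add: rot_fst_def rot_snd_def cos_add sin_add algebra_simps)

lemma rot_0 [simp]: "rot_fst 0 x w = x" "rot_snd 0 x w = w"
  by (simp_all add: rot_fst_def rot_snd_def)

lemma frame_rot:
  assumes "frame x w z"
  shows "frame (rot_fst \<theta> x w) (rot_snd \<theta> x w) (z * cis \<alpha>)"
proof -
  have "x \<bullet> x = 1" "w \<bullet> w = 1" "x \<bullet> w = 0" "w \<bullet> x = 0" "norm z = 1"
    using assms unfolding frame_def by (auto simp: inner_commute)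
  then show ?thesis
    unfolding frame_def rot_fst_def rot_snd_def
    by (simp add: inner_add_left inner_add_right inner_diff_left inner_diff_right norm_mult
        sin_cos_squared_add3 power2_eq_square[symmetric])
qed

lemma has_vector_derivative_cis_mult:
  "((\<lambda>s. cis (a * s)) has_vector_derivative of_real a * (\<i> * cis (a * s))) (at s)"
proof -
  have "((\<lambda>s. s *\<^sub>R (\<i> * of_real a)) has_vector_derivative \<i> * of_real a) (at s)"
    by (auto intro!: derivative_eq_intros)
  from field_vector_diff_chain_at[OF this DERIV_exp] show ?thesis
    by (simp add: o_def cis_conv_exp scaleR_conv_of_real mult_ac)
qed

locale rational_spacetime =
  fixes c d :: nat
  assumes c: "c \<ge> 1" and d: "d \<ge> 1"
begin

abbreviation "ST \<equiv> S2xS1 c d"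

text \<open>The point at angle \<open>\<theta>\<close> of the lightlike curve through \<open>(x, z)\<close> whose spatial part starts in the
  direction \<open>w\<close>, and its direction there, normalised by \<open>dt = 1\<close>.\<close>

definition gpoint :: "real \<Rightarrow> real^3 \<Rightarrow> real^3 \<Rightarrow> complex \<Rightarrow> (real^3) \<times> complex" where
  "gpoint \<theta> x w z = (rot_fst \<theta> x w, z * cis (c / d * \<theta>))"

definition gdir :: "real \<Rightarrow> real^3 \<Rightarrow> real^3 \<Rightarrow> complex \<Rightarrow> (real^3) \<times> complex" where
  "gdir \<theta> x w z = ((d / c) *\<^sub>R rot_snd \<theta> x w, \<i> * z * cis (c / d * \<theta>))"

definition gset :: "real^3 \<Rightarrow> real^3 \<Rightarrow> complex \<Rightarrow> ((real^3) \<times> complex) set" where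
  "gset x w z = range (\<lambda>\<theta>. gpoint \<theta> x w z)"

lemma gpoint_rot:
  "gpoint \<alpha> (rot_fst \<theta> x w) (rot_snd \<theta> x w) (z * cis (c / d * \<theta>)) = gpoint (\<theta> + \<alpha>) x w z"
  "gdir \<alpha> (rot_fst \<theta> x w) (rot_snd \<theta> x w) (z * cis (c / d * \<theta>)) = gdir (\<theta> + \<alpha>) x w z"
  by (simp_all add: gpoint_def gdir_def rot_rot mult.assoc cis_mult ring_distribs)

lemma gset_rot: "gset (rot_fst \<theta> x w) (rot_snd \<theta> x w) (z * cis (c / d * \<theta>)) = gset x w z"
proof -
  have "range (\<lambda>\<alpha>. gpoint (\<theta> + \<alpha>) x w z) = (\<lambda>\<theta>. gpoint \<theta> x w z) ` range ((+) \<theta>)"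
    by (simp only: image_image)
  also have "range ((+) \<theta>) = UNIV" by (rule surj_plus)
  finally show ?thesis unfolding gset_def gpoint_rot .
qed

lemma gpoint_in_sphere: "frame x w z \<Longrightarrow> gpoint \<theta> x w z \<in> sphere 0 1 \<times> sphere 0 1"
  using frame_rot[of x w z \<theta> "c / d * \<theta>"] by (simp add: gpoint_def frame_def norm_eq_1)

text \<open>The parameter \<tau> is the rate of t: at parameter s the angle is (d/c) \<tau> s, so
  the phase has turned by \<tau> s.\<close>

abbreviation "gcurve \<tau> x w z \<equiv> \<lambda>s. gpoint (d / c * \<tau> * s) x w z"

lemma gcurve_derivative:
  "(gcurve \<tau> x w z has_vector_derivative \<tau> *\<^sub>R gdir (d / c * \<tau> * s) x w z) (at s)"
  unfolding gpoint_def gdir_def rot_fst_def rot_snd_def scaleR_Pair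
proof (rule has_vector_derivative_Pair)
  show "((\<lambda>s. cos (d / c * \<tau> * s) *\<^sub>R x + sin (d / c * \<tau> * s) *\<^sub>R w) has_vector_derivative
      \<tau> *\<^sub>R (d / c) *\<^sub>R (cos (d / c * \<tau> * s) *\<^sub>R w - sin (d / c * \<tau> * s) *\<^sub>R x)) (at s)"
    by (rule has_vector_derivative_eq_rhs, (rule derivative_intros has_vector_derivative_scaleR)+)
      (auto intro!: derivative_eq_intros simp: algebra_simps)
  have "((\<lambda>s. z * cis (\<tau> * s)) has_vector_derivative \<tau> *\<^sub>R (\<i> * z * cis (\<tau> * s))) (at s)"
    by (rule has_vector_derivative_eq_rhs[OF has_vector_derivative_mult_right[OF has_vector_derivative_cis_mult]])
      (simp add: scaleR_conv_of_real mult_ac)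
  moreover have "c / d * (d / c * \<tau> * s) = \<tau> * s" for s using c d by simp
  ultimately show "((\<lambda>s. z * cis (c / d * (d / c * \<tau> * s))) has_vector_derivative
      \<tau> *\<^sub>R (\<i> * z * cis (c / d * (d / c * \<tau> * s)))) (at s)" by simp
qed

lemma velocity_gcurve: "velocity (gcurve \<tau> x w z) s = \<tau> *\<^sub>R gdir (d / c * \<tau> * s) x w z"
  unfolding velocity_def by (rule vector_derivative_at[OF gcurve_derivative])

text \<open>The direction curve is, componentwise, a multiple of a lightlike curve rotated by a quarter turn.\<close>

lemma velocity_velocity_gcurve:
  "velocity (velocity (gcurve \<tau> x w z)) s =
    (- (d / c * \<tau>)\<^sup>2 *\<^sub>R fst (gcurve \<tau> x w z s), - \<tau>\<^sup>2 *\<^sub>R snd (gcurve \<tau> x w z s))"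
proof -
  have eq: "velocity (gcurve \<tau> x w z) = (\<lambda>s. ((d / c * \<tau>) *\<^sub>R fst (gcurve \<tau> w (- x) z s), of_real \<tau> * \<i> * snd (gcurve \<tau> x w z s)))"
    unfolding fun_eq_iff velocity_gcurve
    by (simp add: gpoint_def gdir_def rot_fst_def rot_snd_def scaleR_conv_of_real[where 'a = complex] mult_ac)
  have 1: "((\<lambda>s. fst (gcurve \<tau> w (- x) z s)) has_vector_derivative fst (\<tau> *\<^sub>R gdir (d / c * \<tau> * s) w (- x) z)) (at s)"
    by (rule bounded_linear.has_vector_derivative[OF bounded_linear_fst gcurve_derivative])
  have 2: "((\<lambda>s. snd (gcurve \<tau> x w z s)) has_vector_derivative snd (\<tau> *\<^sub>R gdir (d / c * \<tau> * s) x w z)) (at s)"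
    by (rule bounded_linear.has_vector_derivative[OF bounded_linear_snd gcurve_derivative])
  have "(velocity (gcurve \<tau> x w z) has_vector_derivative
      ((d / c * \<tau>) *\<^sub>R fst (\<tau> *\<^sub>R gdir (d / c * \<tau> * s) w (- x) z),
        of_real \<tau> * \<i> * snd (\<tau> *\<^sub>R gdir (d / c * \<tau> * s) x w z))) (at s)"
    unfolding eq
    by (intro has_vector_derivative_Pair has_vector_derivative_mult_right 2
        bounded_linear.has_vector_derivative[OF bounded_linear_scaleR_right 1])
  from vector_derivative_at[OF this] show ?thesis
    unfolding velocity_def[of "velocity _"]
    by (simp add: gdir_def gpoint_def rot_fst_def rot_snd_def power2_eq_square
        scaleR_conv_of_real[where 'a = complex] algebra_simps)
qed

text \<open>The square of dt is replaced by the Euclidean product of C, which agrees with it on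
  vectors tangent to the circle and does not depend on the point.\<close>

definition ambient :: "(real^3) \<times> complex \<Rightarrow> (real^3) \<times> complex \<Rightarrow> real" where
  "ambient v w = fst v \<bullet> fst w - (d\<^sup>2 / c\<^sup>2) * (snd v \<bullet> snd w)"

lemma points_ST: "points ST = sphere 0 1 \<times> sphere 0 1"
  by (simp add: S2xS1_def)

lemma tangent_ST: "p \<in> sphere 0 1 \<times> sphere 0 1 \<Longrightarrow> T \<in> tangent_space (points ST) p \<longleftrightarrow> fst p \<bullet> fst T = 0 \<and> snd p \<bullet> snd T = 0"
  by (simp add: points_ST tangent_space_product_spheres)

text \<open>Expansion of a \<bullet> b in the orthonormal basis z, iz of C, in which the z-component
  drops out.\<close>

lemma d_angle_mult:
  assumes "norm z = 1" "z \<bullet> a = 0"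
  shows "d_angle z a * d_angle z b = a \<bullet> b"
proof -
  have n: "(Re z)\<^sup>2 + (Im z)\<^sup>2 = 1" using assms(1) by (simp add: cmod_def)
  have "d_angle z a * d_angle z b = ((Re z)\<^sup>2 + (Im z)\<^sup>2) * (a \<bullet> b) - (z \<bullet> a) * (z \<bullet> b)"
    by (simp add: d_angle_def inner_complex_def power2_eq_square algebra_simps)
  then show ?thesis using n assms(2) by simp
qed

lemma tangent_circle:
  assumes "norm z = 1" "z \<bullet> a = 0"
  shows "a = \<i> * z * of_real (d_angle z a)"
proof -
  have n: "(Re z)\<^sup>2 + (Im z)\<^sup>2 = 1" using assms(1) by (simp add: cmod_def)
  have o: "Re z * Re a + Im z * Im a = 0" using assms(2) by (simp add: inner_complex_def)
  have "Re a = ((Re z)\<^sup>2 + (Im z)\<^sup>2) * Re a" "Im a = ((Re z)\<^sup>2 + (Im z)\<^sup>2) * Im a" using n by simp_all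
  moreover have "((Re z)\<^sup>2 + (Im z)\<^sup>2) * Re a = Re z * (Re z * Re a + Im z * Im a) + Im z * (Im z * Re a - Re z * Im a)"
    "((Re z)\<^sup>2 + (Im z)\<^sup>2) * Im a = Im z * (Re z * Re a + Im z * Im a) + Re z * (Re z * Im a - Im z * Re a)"
    by (simp_all add: power2_eq_square algebra_simps)
  ultimately show ?thesis
    unfolding o by (simp add: complex_eq_iff d_angle_def algebra_simps)
qed

lemma bounded_bilinear_ambient: "bounded_bilinear ambient"
  unfolding bilinear_conv_bounded_bilinear[symmetric] ambient_def
  by (auto simp: bilinear_def linear_iff algebra_simps add_divide_distrib)

sublocale ambient_metric ST ambient
proof (rule ambient_metric.intro[OF bounded_bilinear_ambient])
  show "ambient v w = ambient w v" for v w by (simp add: ambient_def inner_commute)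
  show "atlas ST = submanifold_charts (points ST)" by (simp add: S2xS1_def)
next
  fix p v w
  assume "p \<in> points ST" "v \<in> tangent_space (points ST) p" "w \<in> tangent_space (points ST) p"
  then show "metric ST p v w = ambient v w"
    by (cases p; cases v; cases w)
      (auto simp: points_ST tangent_ST S2xS1_def ambient_def d_angle_mult tangent_space_product_spheres)
next
  fix p v
  assume p: "p \<in> points ST" and v: "v \<in> tangent_space (points ST) p"
    and o: "\<And>w. w \<in> tangent_space (points ST) p \<Longrightarrow> ambient v w = 0"
  have p': "p \<in> sphere 0 1 \<times> sphere 0 1" using p by (simp add: points_ST)
  \<comment> \<open>Changing the sign of the circle component turns the Lorentzian product with v
    into a sum of squares, and the changed vector is tangent again.\<close>
  have "(fst v, - snd v) \<in> tangent_space (points ST) p"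
    using v unfolding tangent_ST[OF p'] by simp
  from o[OF this] have "fst v \<bullet> fst v + (d\<^sup>2 / c\<^sup>2) * (snd v \<bullet> snd v) = 0" by (simp add: ambient_def)
  moreover have "fst v \<bullet> fst v \<ge> 0" "(d\<^sup>2 / c\<^sup>2) * (snd v \<bullet> snd v) \<ge> 0" by simp_all
  ultimately have "fst v \<bullet> fst v = 0" "(d\<^sup>2 / c\<^sup>2) * (snd v \<bullet> snd v) = 0" by linarith+
  then show "v = 0" using c d by (simp add: prod_eq_iff)
qed

lemma geodesic_ST_iff:
  "geodesic ST I \<gamma> \<longleftrightarrow> open I \<and> is_interval I \<and> I \<noteq> {} \<and> smooth_on I \<gamma> \<and> \<gamma> ` I \<subseteq> sphere 0 1 \<times> sphere 0 1 \<and>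
    (\<forall>t\<in>I. \<forall>T. fst (\<gamma> t) \<bullet> fst T = 0 \<longrightarrow> snd (\<gamma> t) \<bullet> snd T = 0 \<longrightarrow> ambient (velocity (velocity \<gamma>) t) T = 0)"
proof -
  have "geodesic ST I \<gamma> \<longleftrightarrow> open I \<and> is_interval I \<and> I \<noteq> {} \<and> smooth_on I \<gamma> \<and> \<gamma> ` I \<subseteq> points ST \<and>
    (\<forall>t\<in>I. \<forall>T\<in>tangent_space (points ST) (\<gamma> t). ambient (velocity (velocity \<gamma>) t) T = 0)"
    by (rule geodesic_iff) (use product_spheres_charts_cover in \<open>simp add: points_ST\<close>)
  also have "\<dots> \<longleftrightarrow> open I \<and> is_interval I \<and> I \<noteq> {} \<and> smooth_on I \<gamma> \<and> \<gamma> ` I \<subseteq> sphere 0 1 \<times> sphere 0 1 \<and>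
    (\<forall>t\<in>I. \<forall>T. fst (\<gamma> t) \<bullet> fst T = 0 \<longrightarrow> snd (\<gamma> t) \<bullet> snd T = 0 \<longrightarrow> ambient (velocity (velocity \<gamma>) t) T = 0)"
    unfolding points_ST
    by (intro conj_cong HOL.refl ball_cong)
      (simp only: Ball_def tangent_space_product_spheres[OF subsetD[OF _ imageI]] mem_Collect_eq, blast)
  finally show ?thesis .
qed

lemma geodesic_gcurve:
  assumes "frame x w z"
  shows "geodesic ST UNIV (gcurve \<tau> x w z)"
  unfolding geodesic_ST_iff
proof (intro conjI ballI allI impI)
  have "Cinf_on UNIV (gcurve \<tau> x w z)"
    unfolding gpoint_def rot_fst_def by (intro Cinf_intros open_UNIV)
  then show "smooth_on UNIV (gcurve \<tau> x w z)" by (simp only: smooth_on_open[OF open_UNIV])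
  show "range (gcurve \<tau> x w z) \<subseteq> sphere 0 1 \<times> sphere 0 1"
    using gpoint_in_sphere[OF assms] by blast
  show "ambient (velocity (velocity (gcurve \<tau> x w z)) t) T = 0"
    if "fst (gcurve \<tau> x w z t) \<bullet> fst T = 0" "snd (gcurve \<tau> x w z t) \<bullet> snd T = 0" for t T
    unfolding velocity_velocity_gcurve ambient_def using that by simp
qed auto

text \<open>Test vectors may be taken in one factor alone, so each component has normal acceleration
  in its own sphere and runs through a great circle at constant speed. The speeds (d/c) \<tau> and
  \<tau> are the norms of the two components of the initial velocity.\<close>

lemma geodesic_unique:
  assumes g: "geodesic ST I \<eta>" and s: "s \<in> I" and f: "frame x w z" and tau: "\<tau> > 0"
    and init: "\<eta> s = (x, z)" "velocity \<eta> s = \<tau> *\<^sub>R gdir 0 x w z" and t: "t \<in> I"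
  shows "\<eta> t = gcurve \<tau> x w z (t - s)"
proof -
  have I: "is_interval I" "open I" and sm: "smooth_on I \<eta>" and im: "\<eta> ` I \<subseteq> sphere 0 1 \<times> sphere 0 1"
    and ode: "\<And>t T. t \<in> I \<Longrightarrow> fst (\<eta> t) \<bullet> fst T = 0 \<Longrightarrow> snd (\<eta> t) \<bullet> snd T = 0 \<Longrightarrow> ambient (velocity (velocity \<eta>) t) T = 0"
    using g unfolding geodesic_ST_iff by auto
  have d1: "(\<eta> has_vector_derivative velocity \<eta> t) (at t)" if "t \<in> I" for t
    unfolding velocity_def by (rule smooth_on_curve(1)[OF sm I(2) that])
  have "Cinf_on I (velocity \<eta>)" unfolding velocity_def by (rule smooth_on_curve(2)[OF sm I(2) t])
  then have sm2: "smooth_on I (velocity \<eta>)" by (simp only: smooth_on_open[OF I(2)])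
  have d2: "(velocity \<eta> has_vector_derivative velocity (velocity \<eta>) t) (at t)" if "t \<in> I" for t
    unfolding velocity_def[of "velocity \<eta>"] by (rule smooth_on_curve(1)[OF sm2 I(2) that])
  let ?A = "velocity (velocity \<eta>)"
  have unit: "fst (\<eta> t) \<bullet> fst (\<eta> t) = 1" "snd (\<eta> t) \<bullet> snd (\<eta> t) = 1" if "t \<in> I" for t
    using subsetD[OF im imageI[OF that]] by (auto simp: mem_Times_iff norm_eq_1)
  have n1: "fst (?A t) = (fst (?A t) \<bullet> fst (\<eta> t)) *\<^sub>R fst (\<eta> t)" if "t \<in> I" for t
  proof -
    \<comment> \<open>The tangential part of the acceleration is used as its own test
      vector.\<close>
    let ?v = "fst (?A t) - (fst (?A t) \<bullet> fst (\<eta> t)) *\<^sub>R fst (\<eta> t)"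
    have o: "fst (\<eta> t) \<bullet> ?v = 0" using unit[OF that] by (simp add: inner_diff_right inner_commute)
    then have "fst (?A t) \<bullet> ?v = 0" using ode[OF that, of "(?v, 0)"] by (simp add: ambient_def)
    then have "?v \<bullet> ?v = 0" using o by (simp add: inner_diff_left inner_diff_right inner_commute)
    then show ?thesis by simp
  qed
  have n2: "snd (?A t) = (snd (?A t) \<bullet> snd (\<eta> t)) *\<^sub>R snd (\<eta> t)" if "t \<in> I" for t
  proof -
    let ?v = "snd (?A t) - (snd (?A t) \<bullet> snd (\<eta> t)) *\<^sub>R snd (\<eta> t)"
    have o: "snd (\<eta> t) \<bullet> ?v = 0" using unit[OF that] by (simp add: inner_diff_right inner_commute)
    then have "snd (?A t) \<bullet> ?v = 0" using ode[OF that, of "(0, ?v)"] c d by (simp add: ambient_def)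
    then have "?v \<bullet> ?v = 0" using o by (simp add: inner_diff_left inner_diff_right inner_commute)
    then show ?thesis by simp
  qed
  have v: "fst (velocity \<eta> s) = (d / c * \<tau>) *\<^sub>R w" "snd (velocity \<eta> s) = of_real \<tau> * \<i> * z"
    unfolding init gdir_def by (simp_all add: scaleR_conv_of_real[where 'a = complex] mult_ac)
  have nv: "norm (fst (velocity \<eta> s)) = d / c * \<tau>" "norm (snd (velocity \<eta> s)) = \<tau>"
  proof -
    have "norm w = 1" "norm z = 1" using f by (simp_all add: frame_def norm_eq_1)
    then show "norm (fst (velocity \<eta> s)) = d / c * \<tau>" "norm (snd (velocity \<eta> s)) = \<tau>"
      unfolding v using tau by (simp_all add: norm_mult)
  qed
  have "norm (fst (velocity \<eta> s)) > 0" "norm (snd (velocity \<eta> s)) > 0"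
    unfolding nv using tau c d by simp_all
  then have ne: "fst (velocity \<eta> s) \<noteq> 0" "snd (velocity \<eta> s) \<noteq> 0" by simp_all
  have "fst (\<eta> t) = cos (norm (fst (velocity \<eta> s)) * (t - s)) *\<^sub>R fst (\<eta> s)
      + (sin (norm (fst (velocity \<eta> s)) * (t - s)) / norm (fst (velocity \<eta> s))) *\<^sub>R fst (velocity \<eta> s)"
    by (rule sphere_geodesic_unique[OF I s t bounded_linear.has_vector_derivative[OF bounded_linear_fst d1]
          bounded_linear.has_vector_derivative[OF bounded_linear_fst d2] unit(1) n1 ne(1)])
  then have 1: "fst (\<eta> t) = rot_fst (d / c * \<tau> * (t - s)) x w"
    unfolding nv unfolding v unfolding init(1) rot_fst_def using tau c d by simp
  have "snd (\<eta> t) = cos (norm (snd (velocity \<eta> s)) * (t - s)) *\<^sub>R snd (\<eta> s)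
      + (sin (norm (snd (velocity \<eta> s)) * (t - s)) / norm (snd (velocity \<eta> s))) *\<^sub>R snd (velocity \<eta> s)"
    by (rule sphere_geodesic_unique[OF I s t bounded_linear.has_vector_derivative[OF bounded_linear_snd d1]
          bounded_linear.has_vector_derivative[OF bounded_linear_snd d2] unit(2) n2 ne(2)])
  then have "snd (\<eta> t) = z * cis (\<tau> * (t - s))"
    unfolding nv unfolding v unfolding init(1) using tau
    by (simp add: complex_eq_iff algebra_simps)
  then show ?thesis using 1 c d by (simp add: gpoint_def prod_eq_iff)
qed

text \<open>Here \<tau> is the value of dt on v. It is positive because v points to the future;
  nullity makes the spatial part of length (d/c) \<tau>, and w is its direction.\<close>

lemma future_null_iff:
  "((x, z), v) \<in> future_null ST \<longleftrightarrow> (\<exists>w \<tau>. frame x w z \<and> \<tau> > 0 \<and> v = \<tau> *\<^sub>R gdir 0 x w z)"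
proof
  assume "((x, z), v) \<in> future_null ST"
  then have p: "(x, z) \<in> points ST" and T: "v \<in> tangent_space (points ST) (x, z)" and "v \<noteq> 0"
    and null: "metric ST (x, z) v v = 0" and fut: "metric ST (x, z) v (time_field ST (x, z)) < 0"
    unfolding future_null_def by auto
  have n: "norm x = 1" "norm z = 1" using p by (auto simp: points_ST)
  then have o: "x \<bullet> fst v = 0" "z \<bullet> snd v = 0" using T tangent_ST[of "(x, z)" v] by auto
  let ?k = "(real d)\<^sup>2 / (real c)\<^sup>2" and ?\<tau> = "d_angle z (snd v)"
  have k: "?k > 0" using c d by simp
  have "d_angle z (\<i> * z) = 1"
    using n(2) by (simp add: d_angle_def cmod_def power2_eq_square)
  then have "?k * ?\<tau> > 0" using fut by (cases v) (simp add: S2xS1_def)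
  then have tau: "?\<tau> > 0" using k zero_less_mult_pos by blast
  have "fst v \<bullet> fst v = ?k * (?\<tau> * ?\<tau>)" using null by (cases v) (simp add: S2xS1_def)
  then have vv: "fst v \<bullet> fst v = (d / c * ?\<tau>)\<^sup>2" by (simp add: power2_eq_square)
  let ?w = "(1 / (d / c * ?\<tau>)) *\<^sub>R fst v"
  have pos: "d / c * ?\<tau> > 0" using tau c d by simp
  have "(1 / P) * ((1 / P) * P\<^sup>2) = 1" if "P > 0" for P :: real
    using that by (simp add: power2_eq_square)
  from this[OF pos] have "?w \<bullet> ?w = 1" by (simp only: inner_scaleR_left inner_scaleR_right vv)
  moreover have "x \<bullet> x = 1" "x \<bullet> ?w = 0" using n o by (simp_all add: norm_eq_1)
  ultimately have "frame x ?w z" unfolding frame_def using n by blast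
  moreover have "v = ?\<tau> *\<^sub>R gdir 0 x ?w z"
    using tangent_circle[OF n(2) o(2)] tau c d
    by (simp add: gdir_def prod_eq_iff scaleR_conv_of_real[where 'a = complex] mult_ac)
  ultimately show "\<exists>w \<tau>. frame x w z \<and> \<tau> > 0 \<and> v = \<tau> *\<^sub>R gdir 0 x w z" using tau by blast
next
  assume "\<exists>w \<tau>. frame x w z \<and> \<tau> > 0 \<and> v = \<tau> *\<^sub>R gdir 0 x w z"
  then obtain w \<tau> where f: "frame x w z" and tau: "\<tau> > 0" and v: "v = \<tau> *\<^sub>R gdir 0 x w z" by blast
  have n: "x \<bullet> x = 1" "norm z = 1" "w \<bullet> w = 1" "x \<bullet> w = 0" and nx: "norm x = 1"
    using f by (auto simp: frame_def norm_eq_1)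
  have sq: "Re z * Re z + Im z * Im z = 1" using n(2) by (simp add: cmod_def power2_eq_square)
  have v': "fst v = (d / c * \<tau>) *\<^sub>R w" "snd v = of_real \<tau> * (\<i> * z)"
    unfolding v by (simp_all add: gdir_def scaleR_conv_of_real[where 'a = complex] mult_ac)
  have zo: "z \<bullet> snd v = 0" unfolding v' by (simp add: inner_complex_def)
  have da: "d_angle z (snd v) = \<tau>" "d_angle z (\<i> * z) = 1"
  proof -
    have "d_angle z (snd v) = \<tau> * (Re z * Re z + Im z * Im z)"
      unfolding v' by (simp add: d_angle_def algebra_simps)
    then show "d_angle z (snd v) = \<tau>" using sq by simp
    show "d_angle z (\<i> * z) = 1" using sq by (simp add: d_angle_def)
  qed
  have "v \<noteq> 0" using da(1) tau by (auto simp: d_angle_def)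
  moreover have "v \<in> tangent_space (points ST) (x, z)"
    using tangent_ST[of "(x, z)" v] nx n zo v' by simp
  moreover have "metric ST (x, z) v v = 0"
  proof -
    have "fst v \<bullet> fst v = (real d)\<^sup>2 / (real c)\<^sup>2 * (\<tau> * \<tau>)" unfolding v' using n by (simp add: power2_eq_square)
    then show ?thesis using da by (cases v) (simp add: S2xS1_def)
  qed
  moreover have "metric ST (x, z) v (time_field ST (x, z)) < 0"
    using da tau c d by (cases v) (simp add: S2xS1_def)
  ultimately show "((x, z), v) \<in> future_null ST"
    unfolding future_null_def using nx n by (simp add: points_ST)
qed

lemma future_null_gpoint:
  assumes "frame x w z" "\<tau> > 0"
  shows "(gpoint \<theta> x w z, \<tau> *\<^sub>R gdir \<theta> x w z) \<in> future_null ST"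
proof -
  have "gdir \<theta> x w z = gdir 0 (rot_fst \<theta> x w) (rot_snd \<theta> x w) (z * cis (c / d * \<theta>))"
    using gpoint_rot(2)[of 0 \<theta> x w z] by simp
  then show ?thesis
    unfolding gpoint_def future_null_iff
    by (intro exI[of _ "rot_snd \<theta> x w"] exI[of _ \<tau>] conjI frame_rot[OF assms(1)] assms(2)) simp
qed

text \<open>The frame is first rotated by \<theta> so that \<open>geodesic_unique\<close> applies.
  An initial point at an arbitrary angle is what the induction over \<open>same_leaf\<close>
  provides.\<close>

lemma geodesic_unique_gpoint:
  assumes g: "geodesic ST I \<eta>" and s: "s \<in> I" and f: "frame x w z" and tau: "\<tau> > 0"
    and init: "\<eta> s = gpoint \<theta> x w z" "velocity \<eta> s = \<tau> *\<^sub>R gdir \<theta> x w z" and t: "t \<in> I"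
  shows "\<eta> t = gpoint (d / c * \<tau> * (t - s) + \<theta>) x w z"
    and "velocity \<eta> t = \<tau> *\<^sub>R gdir (d / c * \<tau> * (t - s) + \<theta>) x w z"
proof -
  let ?x = "rot_fst \<theta> x w" and ?w = "rot_snd \<theta> x w" and ?z = "z * cis (c / d * \<theta>)"
  note f' = frame_rot[OF f, of \<theta> "c / d * \<theta>"]
  have "\<eta> s = (?x, ?z)" "velocity \<eta> s = \<tau> *\<^sub>R gdir 0 ?x ?w ?z"
    unfolding init gpoint_rot by (simp_all add: gpoint_def)
  then have eq: "\<eta> t = gcurve \<tau> ?x ?w ?z (t - s)" if "t \<in> I" for t
    using geodesic_unique[OF g s f' tau _ _ that] by blast
  show "\<eta> t = gpoint (d / c * \<tau> * (t - s) + \<theta>) x w z"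
    unfolding eq[OF t] gpoint_rot by (simp only: add.commute)
  have oI: "open I" using g by (simp add: geodesic_def)
  have "((\<lambda>t. t - s) has_vector_derivative 1) (at t)" by (auto intro!: derivative_eq_intros)
  from vector_diff_chain_at[OF this gcurve_derivative[of \<tau> ?x ?w ?z "t - s"]]
  have "(gcurve \<tau> ?x ?w ?z \<circ> (\<lambda>t. t - s) has_vector_derivative \<tau> *\<^sub>R gdir (d / c * \<tau> * (t - s)) ?x ?w ?z) (at t)" by simp
  then have "(\<eta> has_vector_derivative \<tau> *\<^sub>R gdir (d / c * \<tau> * (t - s)) ?x ?w ?z) (at t)"
    by (rule has_vector_derivative_transform_within_open[OF _ oI t]) (simp add: eq)
  then show "velocity \<eta> t = \<tau> *\<^sub>R gdir (d / c * \<tau> * (t - s) + \<theta>) x w z"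
    unfolding velocity_def gpoint_rot by (simp only: vector_derivative_at add.commute)
qed

text \<open>Geodesics move along the curve of the frame with a constant factor in the velocity, and
  the Euler field changes that factor alone. Conversely, one geodesic reaches every angle and one
  further scaling every positive factor.\<close>

lemma leaf_eq:
  assumes f: "frame x w z" and tau: "\<tau> > 0"
  shows "leaf ST (gpoint 0 x w z, \<tau> *\<^sub>R gdir 0 x w z) = {(gpoint \<theta> x w z, \<sigma> *\<^sub>R gdir \<theta> x w z) | \<theta> \<sigma>. \<sigma> > 0}"
    (is "leaf ST ?p = ?L")
proof (intro set_eqI iffI)
  fix q assume "q \<in> leaf ST ?p"
  then have "same_leaf ST ?p q" by (simp add: leaf_def)
  then show "q \<in> ?L"
  proof (induction ?p q rule: same_leaf.induct)
    case refl
    then show ?case using tau by blast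
  next
    case (spray \<gamma> s I t)
    then obtain \<theta> \<sigma> where "\<sigma> > 0" "\<gamma> s = gpoint \<theta> x w z" "velocity \<gamma> s = \<sigma> *\<^sub>R gdir \<theta> x w z" by blast
    from geodesic_unique_gpoint[OF spray(3,4) f this spray(5)] show ?case using \<open>\<sigma> > 0\<close> by blast
  next
    case (euler y v s)
    then obtain \<theta> \<sigma> where "\<sigma> > 0" "y = gpoint \<theta> x w z" "v = \<sigma> *\<^sub>R gdir \<theta> x w z" by blast
    then show ?case unfolding mem_Collect_eq by (intro exI[of _ \<theta>] exI[of _ "exp s * \<sigma>"]) simp
  qed
next
  fix q assume "q \<in> ?L"
  then obtain \<theta> \<sigma> where q: "\<sigma> > 0" "q = (gpoint \<theta> x w z, \<sigma> *\<^sub>R gdir \<theta> x w z)" by blast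
  let ?\<gamma> = "gcurve \<tau> x w z"
  have "same_leaf ST ?p ?p" by (rule same_leaf.refl) (rule future_null_gpoint[OF f tau])
  then have "same_leaf ST ?p (?\<gamma> 0, velocity ?\<gamma> 0)" unfolding velocity_gcurve by simp
  then have "same_leaf ST ?p (?\<gamma> (\<theta> / (d / c * \<tau>)), velocity ?\<gamma> (\<theta> / (d / c * \<tau>)))"
    by (rule same_leaf.spray[OF _ geodesic_gcurve[OF f]]) auto
  moreover have "d / c * \<tau> * (\<theta> / (d / c * \<tau>)) = \<theta>" using tau c d by simp
  ultimately have "same_leaf ST ?p (gpoint \<theta> x w z, \<tau> *\<^sub>R gdir \<theta> x w z)"
    unfolding velocity_gcurve by simp
  then have "same_leaf ST ?p (gpoint \<theta> x w z, exp (ln (\<sigma> / \<tau>)) *\<^sub>R \<tau> *\<^sub>R gdir \<theta> x w z)"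
    by (rule same_leaf.euler)
  then show "q \<in> leaf ST ?p" using q tau by (simp add: leaf_def)
qed

lemma fst_leaf_eq:
  assumes "frame x w z" "\<tau> > 0"
  shows "fst ` leaf ST ((x, z), \<tau> *\<^sub>R gdir 0 x w z) = gset x w z"
proof -
  have p: "(x, z) = gpoint 0 x w z" by (simp add: gpoint_def)
  show ?thesis
    unfolding p leaf_eq[OF assms] gset_def
  proof (intro set_eqI iffI)
    fix y assume "y \<in> range (\<lambda>\<theta>. gpoint \<theta> x w z)"
    then obtain \<theta> where "y = gpoint \<theta> x w z" by blast
    then show "y \<in> fst ` {(gpoint \<theta> x w z, \<sigma> *\<^sub>R gdir \<theta> x w z) | \<theta> \<sigma>. \<sigma> > 0}"
      by (intro image_eqI[of _ _ "(gpoint \<theta> x w z, gdir \<theta> x w z)"] CollectI exI[of _ \<theta>] exI[of _ 1]) simp_all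
  qed auto
qed

text \<open>A null geodesic is a piece of some \<open>gcurve\<close>, which is defined on the whole
  line. Maximality therefore forces I = UNIV, and the image is a full \<open>gset\<close>.\<close>

lemma null_geodesics_eq: "null_geodesics ST = (\<lambda>p. fst ` leaf ST p) ` future_null ST"
proof (intro set_eqI iffI)
  fix A assume "A \<in> null_geodesics ST"
  then obtain I \<gamma> where A: "A = \<gamma> ` I" and m: "maximal_geodesic ST I \<gamma>"
    and n: "\<forall>t\<in>I. (\<gamma> t, velocity \<gamma> t) \<in> future_null ST"
    unfolding null_geodesics_def by blast
  have g: "geodesic ST I \<gamma>" using m by (simp add: maximal_geodesic_def)
  then obtain s where s: "s \<in> I" unfolding geodesic_def by blast
  obtain x z where xz: "\<gamma> s = (x, z)" by (cases "\<gamma> s")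
  obtain w \<tau> where f: "frame x w z" and tau: "\<tau> > 0" and v: "velocity \<gamma> s = \<tau> *\<^sub>R gdir 0 x w z"
    using bspec[OF n s] unfolding xz future_null_iff by blast
  have eq: "\<gamma> t = gcurve \<tau> x w z (t - s)" if "t \<in> I" for t
    by (rule geodesic_unique[OF g s f tau xz v that])
  \<comment> \<open>Rotating the frame by this angle absorbs the time shift by s, so that the
    extension has the form \<open>gcurve\<close> in the unshifted parameter.\<close>
  let ?\<theta> = "- (d / c * \<tau> * s)"
  let ?x = "rot_fst ?\<theta> x w" and ?w = "rot_snd ?\<theta> x w" and ?z = "z * cis (c / d * ?\<theta>)"
  have eq': "gcurve \<tau> x w z (t - s) = gcurve \<tau> ?x ?w ?z t" for t
    unfolding gpoint_rot by (simp add: algebra_simps diff_divide_distrib)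
  have "geodesic ST UNIV (gcurve \<tau> ?x ?w ?z)" by (rule geodesic_gcurve[OF frame_rot[OF f]])
  moreover have "\<forall>t\<in>I. gcurve \<tau> ?x ?w ?z t = \<gamma> t" unfolding eq'[symmetric] using eq by simp
  ultimately have "UNIV = I"
    using m[unfolded maximal_geodesic_def, THEN conjunct2, rule_format, of UNIV "gcurve \<tau> ?x ?w ?z"] by blast
  then have "I = UNIV" by (rule sym)
  have "A = gset x w z"
    unfolding gset_def
  proof (intro set_eqI iffI)
    fix y assume "y \<in> range (\<lambda>\<theta>. gpoint \<theta> x w z)"
    then obtain \<theta> where y: "y = gpoint \<theta> x w z" by blast
    have "gcurve \<tau> x w z ((\<theta> / (d / c * \<tau>) + s) - s) = y"
      using tau c d y by simp
    then show "y \<in> A" unfolding A \<open>I = UNIV\<close> using eq \<open>I = UNIV\<close> by (metis UNIV_I rangeI)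
  qed (use A eq in auto)
  then show "A \<in> (\<lambda>p. fst ` leaf ST p) ` future_null ST"
    using fst_leaf_eq[OF f tau] bspec[OF n s] unfolding xz v by blast
next
  fix A assume "A \<in> (\<lambda>p. fst ` leaf ST p) ` future_null ST"
  then obtain x z v where v: "((x, z), v) \<in> future_null ST" and A: "A = fst ` leaf ST ((x, z), v)" by auto
  then obtain w \<tau> where f: "frame x w z" and tau: "\<tau> > 0" and v: "v = \<tau> *\<^sub>R gdir 0 x w z"
    unfolding future_null_iff by blast
  let ?\<gamma> = "gcurve 1 x w z"
  have "A = gset x w z" unfolding A v by (rule fst_leaf_eq[OF f tau])
  also have "\<dots> = ?\<gamma> ` UNIV"
  proof -
    have "range (\<lambda>s. d / c * 1 * s) = (UNIV :: real set)"
      unfolding surj_def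
    proof
      fix y :: real
      show "\<exists>s. y = d / c * 1 * s" by (rule exI[of _ "y * c / d"]) (use c d in simp)
    qed
    then show ?thesis
      unfolding gset_def image_image[of "\<lambda>\<theta>. gpoint \<theta> x w z" "\<lambda>s. d / c * 1 * s" UNIV, symmetric] by (simp only:)
  qed
  finally have "A = ?\<gamma> ` UNIV" .
  moreover have "maximal_geodesic ST UNIV ?\<gamma>"
    unfolding maximal_geodesic_def using geodesic_gcurve[OF f] by blast
  moreover have "(?\<gamma> t, velocity ?\<gamma> t) \<in> future_null ST" for t
    unfolding velocity_gcurve by (rule future_null_gpoint[OF f]) simp
  ultimately show "A \<in> null_geodesics ST" unfolding null_geodesics_def by blast
qed

text \<open>A common base point fixes \<theta>, after which w' can differ from the rotated w only by
  its sign. Following the curve to the angle pi/(2c) decides the sign: the reversed direction would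
  make twice this angle, pi/c, an integer multiple of 2 pi/c, that is, equate the odd number 1 + 2md
  with the even number 2nc.\<close>

lemma gset_eqE:
  assumes f: "frame x w z" "frame x' w' z'" and eq: "gset x w z = gset x' w' z'"
  obtains \<theta> where "x' = rot_fst \<theta> x w" "w' = rot_snd \<theta> x w" "z' = z * cis (c / d * \<theta>)"
proof -
  have "gpoint 0 x' w' z' \<in> gset x w z" unfolding eq unfolding gset_def by blast
  then obtain \<theta> where th: "x' = rot_fst \<theta> x w" "z' = z * cis (c / d * \<theta>)"
    by (auto simp: gset_def gpoint_def)
  let ?w = "rot_snd \<theta> x w" and ?\<alpha> = "pi / (2 * c)"
  have f': "x' \<bullet> x' = 1" "x' \<bullet> w' = 0" "x' \<bullet> ?w = 0" "norm z' = 1"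
    using f(2) frame_rot[OF f(1), of \<theta> 0] unfolding th by (auto simp: frame_def)
  have "gset x' ?w z' = gset x' w' z'" using eq gset_rot[of \<theta> x w z] unfolding th by simp
  then have "gpoint ?\<alpha> x' w' z' \<in> gset x' ?w z'" unfolding gset_def by blast
  then obtain \<beta> where b: "rot_fst ?\<alpha> x' w' = rot_fst \<beta> x' ?w" "z' * cis (c / d * ?\<alpha>) = z' * cis (c / d * \<beta>)"
    by (auto simp: gset_def gpoint_def)
  have cos: "cos ?\<alpha> = cos \<beta>"
    using arg_cong[OF b(1), of "\<lambda>y. x' \<bullet> y"] f' by (simp add: rot_fst_def inner_add_right)
  have apos: "0 < ?\<alpha>" "?\<alpha> < pi" using c by (auto simp: field_simps)
  have spos: "sin ?\<alpha> > 0" using apos by (rule sin_gt_zero)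
  have "cis (c / d * \<beta> - c / d * ?\<alpha>) = 1"
    using b(2) f'(4) by (auto simp flip: cis_divide)
  then obtain m :: int where m: "c / d * \<beta> - c / d * ?\<alpha> = 2 * pi * m"
    unfolding cis_conv_exp exp_eq_1 by (auto simp: mult_ac)
  have "(sin \<beta>)\<^sup>2 = (sin ?\<alpha>)\<^sup>2" using cos by (simp add: sin_squared_eq)
  then have "sin \<beta> = sin ?\<alpha> \<or> sin \<beta> = - sin ?\<alpha>" by (simp add: power2_eq_iff)
  then have "sin \<beta> = sin ?\<alpha>"
  proof
    assume neg: "sin \<beta> = - sin ?\<alpha>"
    have "cos (?\<alpha> + \<beta>) = 1"
      unfolding cos_add neg cos[symmetric] by (simp add: sin_cos_squared_add3)
    then obtain n :: int where n: "?\<alpha> + \<beta> = real_of_int n * 2 * pi" unfolding cos_one_2pi_int by blast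
    have "\<beta> = ?\<alpha> + 2 * pi * real_of_int m * d / c" using m c d by (simp add: field_simps)
    then have "2 * ?\<alpha> + 2 * pi * real_of_int m * d / c = real_of_int n * 2 * pi" using n by simp
    then have "pi * (1 + 2 * real_of_int m * d) = pi * (2 * real_of_int n * c)" using c by (simp add: field_simps)
    then have "real_of_int (1 + 2 * m * int d) = real_of_int (2 * n * int c)" by simp
    then have "1 + 2 * m * int d = 2 * n * int c" by (simp only: of_int_eq_iff)
    from arg_cong[OF this, of even] show ?thesis by simp
  qed
  then have "w' = ?w" using b(1) cos spos by (simp add: rot_fst_def)
  then show thesis using th by (intro that)
qed

end

section \<open>The spinor map\<close>

text \<open>A pair \<open>(x, w)\<close> of real vectors is encoded by the complex vector \<open>x - \<i>w\<close>, so that rotating the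
  pair by \<open>\<theta>\<close> is multiplication by \<open>cis \<theta>\<close>.\<close>

definition re_vec :: "complex^3 \<Rightarrow> real^3" where "re_vec F = (\<chi> i. Re (F $ i))"

definition nim_vec :: "complex^3 \<Rightarrow> real^3" where "nim_vec F = (\<chi> i. - Im (F $ i))"

definition cvec :: "real^3 \<Rightarrow> real^3 \<Rightarrow> complex^3" where "cvec x w = (\<chi> i. Complex (x $ i) (- w $ i))"

lemma re_nim_cvec [simp]: "re_vec (cvec x w) = x" "nim_vec (cvec x w) = w" "cvec (re_vec F) (nim_vec F) = F"
  by (simp_all add: re_vec_def nim_vec_def cvec_def vec_eq_iff)

lemma re_nim_cis:
  "re_vec (cis \<theta> *s F) = rot_fst \<theta> (re_vec F) (nim_vec F)"
  "nim_vec (cis \<theta> *s F) = rot_snd \<theta> (re_vec F) (nim_vec F)"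
  by (simp_all add: re_vec_def nim_vec_def rot_fst_def rot_snd_def vec_eq_iff algebra_simps)

lemma cvec_rot: "cvec (rot_fst \<theta> x w) (rot_snd \<theta> x w) = cis \<theta> *s cvec x w"
  by (metis re_nim_cis re_nim_cvec)

text \<open>The spinor map realises the double covering \<open>S\<^sup>3 \<rightarrow> SO(3)\<close> on orthonormal pairs.\<close>

definition spinor :: "complex \<times> complex \<Rightarrow> complex^3" where
  "spinor q = (\<chi> i. if i = 1 then (fst q)\<^sup>2 - (snd q)\<^sup>2
     else if i = 2 then \<i> * ((fst q)\<^sup>2 + (snd q)\<^sup>2) else - 2 * (fst q * snd q))"

lemma spinor_nth:
  "spinor q $ 1 = (fst q)\<^sup>2 - (snd q)\<^sup>2" "spinor q $ 2 = \<i> * ((fst q)\<^sup>2 + (snd q)\<^sup>2)"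
  "spinor q $ 3 = - 2 * (fst q * snd q)"
  by (simp_all add: spinor_def)

lemma spinor_cscale: "spinor (cscale a q) = a\<^sup>2 *s spinor q"
  by (simp add: vec_eq_iff forall_3 spinor_nth cscale_def power_mult_distrib algebra_simps power2_eq_square)

lemma spinor_inner:
  defines "n \<equiv> \<lambda>q::complex \<times> complex. (norm q)\<^sup>2"
  shows "re_vec (spinor q) \<bullet> re_vec (spinor q) = (n q)\<^sup>2" "nim_vec (spinor q) \<bullet> nim_vec (spinor q) = (n q)\<^sup>2"
    "re_vec (spinor q) \<bullet> nim_vec (spinor q) = 0"
proof -
  have n: "n q = Re (fst q) * Re (fst q) + Im (fst q) * Im (fst q) + (Re (snd q) * Re (snd q) + Im (snd q) * Im (snd q))"
    by (simp add: n_def norm_prod_def cmod_power2 power2_eq_square[of "Re _"] power2_eq_square[of "Im _"])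
  show "re_vec (spinor q) \<bullet> re_vec (spinor q) = (n q)\<^sup>2" "nim_vec (spinor q) \<bullet> nim_vec (spinor q) = (n q)\<^sup>2"
    "re_vec (spinor q) \<bullet> nim_vec (spinor q) = 0"
    unfolding n
    by (simp_all add: inner_vec_def sum_3 re_vec_def nim_vec_def spinor_nth power2_eq_square algebra_simps)
qed

lemma frame_spinor: "norm q = 1 \<Longrightarrow> norm z = 1 \<Longrightarrow> frame (re_vec (spinor q)) (nim_vec (spinor q)) z"
  unfolding frame_def spinor_inner by simp

text \<open>Orthonormality makes F = x - iw isotropic. If F is the spinor image of (a, b), then F1 -
  iF2 = 2a^2, F1 + iF2 = -2b^2 and F3 = -2ab. So a is a square root, b follows from the product ab,
  and isotropy supplies the equation for b^2; if a = 0, then b is the square root instead. The norm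
  of q comes from that of x.\<close>

lemma spinor_surj:
  assumes "frame x w z"
  obtains q where "norm q = 1" "spinor q = cvec x w"
proof -
  let ?F = "cvec x w"
  have inner: "x \<bullet> x = 1" "w \<bullet> w = 1" "x \<bullet> w = 0" using assms by (auto simp: frame_def)
  have iso: "(?F$1)\<^sup>2 + (?F$2)\<^sup>2 + (?F$3)\<^sup>2 = 0"
  proof -
    have "(?F$1)\<^sup>2 + (?F$2)\<^sup>2 + (?F$3)\<^sup>2 = Complex (x \<bullet> x - w \<bullet> w) (- 2 * (x \<bullet> w))"
      by (simp add: cvec_def inner_vec_def sum_3 complex_eq_iff power2_eq_square algebra_simps)
    then show ?thesis using inner by (simp add: Complex_eq_0)
  qed
  have "\<exists>q. spinor q = ?F"
  proof (cases "?F$1 - \<i> * ?F$2 = 0")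
    case True
    then have F1: "?F$1 = \<i> * ?F$2" by simp
    then have "?F$3 = 0" using iso by (simp add: power_mult_distrib)
    let ?b = "csqrt (- (?F$1))"
    have "spinor (0, ?b) = ?F"
      using F1 \<open>?F$3 = 0\<close> by (simp add: vec_eq_iff forall_3 spinor_nth)
    then show ?thesis ..
  next
    case False
    let ?D = "?F$1 - \<i> * ?F$2"
    let ?a = "csqrt (?D / 2)" and ?b = "- ?F$3 / (2 * csqrt (?D / 2))"
    have a: "?a\<^sup>2 = ?D / 2" "?a \<noteq> 0" using False by auto
    have "?b\<^sup>2 = (?F$3)\<^sup>2 / (4 * ?a\<^sup>2)" by (simp add: power_divide power_mult_distrib)
    also have "4 * ?a\<^sup>2 = 2 * ?D" unfolding a(1) by simp
    also have "(?F$3)\<^sup>2 = - (?F$1 + \<i> * ?F$2) * ?D"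
      using iso by (simp add: algebra_simps power2_eq_square eq_neg_iff_add_eq_0)
    also have "- (?F$1 + \<i> * ?F$2) * ?D / (2 * ?D) = - (?F$1 + \<i> * ?F$2) / 2"
    proof -
      have "m * D / (2 * D) = m / 2" if "D \<noteq> 0" for m D :: complex using that by simp
      from this[OF False] show ?thesis .
    qed
    finally have b: "?b\<^sup>2 = - (?F$1 + \<i> * ?F$2) / 2" .
    have ab: "?a * ?b = - ?F$3 / 2" using a(2) by simp
    have "spinor (?a, ?b) = ?F"
      unfolding vec_eq_iff forall_3 spinor_nth fst_conv snd_conv a(1) b ab
      by (simp add: field_simps)
    then show ?thesis ..
  qed
  then obtain q where q: "spinor q = ?F" ..
  have "((norm q)\<^sup>2)\<^sup>2 = 1" using spinor_inner(1)[of q] inner(1) by (simp add: q)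
  then have "(norm q)\<^sup>2 = 1 \<or> (norm q)\<^sup>2 = - 1" by (simp only: power2_eq_1_iff)
  then have "(norm q)\<^sup>2 = 1" using zero_le_power2[of "norm q"] by linarith
  then have "norm q = 1 \<or> norm q = - 1" by (simp only: power2_eq_1_iff)
  then have "norm q = 1" using norm_ge_zero[of q] by linarith
  then show thesis using q that by blast
qed

text \<open>The squares determine the two components up to separate signs, and the product of the
  components ties the signs together.\<close>

lemma spinor_inj:
  assumes "spinor q = spinor q'"
  shows "q' = q \<or> q' = cscale (- 1) q"
proof -
  have F: "(fst q)\<^sup>2 - (snd q)\<^sup>2 = (fst q')\<^sup>2 - (snd q')\<^sup>2" "(fst q)\<^sup>2 + (snd q)\<^sup>2 = (fst q')\<^sup>2 + (snd q')\<^sup>2"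
    "fst q * snd q = fst q' * snd q'"
    using assms by (simp_all add: vec_eq_iff forall_3 spinor_nth)
  have "2 * (fst q')\<^sup>2 = 2 * (fst q)\<^sup>2" "2 * (snd q')\<^sup>2 = 2 * (snd q)\<^sup>2"
    using F(1,2) by algebra+
  then have s: "fst q' = fst q \<or> fst q' = - fst q" "snd q' = snd q \<or> snd q' = - snd q"
    by (simp_all add: power2_eq_iff)
  show ?thesis
    using s F(3) by (auto simp: prod_eq_iff cscale_def)
qed

text \<open>Inverts the spinor map near \<open>y\<close>: for \<open>F = spinor q\<close> the vector \<open>spinor_mat y F\<close> is \<open>\<lambda>q\<close> and
  \<open>spinor_sq y F\<close> is \<open>\<lambda>\<^sup>2\<close>, where \<open>\<lambda>\<close> is the Hermitian product of \<open>q\<close> and \<open>y\<close>.\<close>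

definition spinor_mat :: "complex \<times> complex \<Rightarrow> complex^3 \<Rightarrow> complex \<times> complex" where
  "spinor_mat y F = ((F$1 - \<i> * F$2) / 2 * cnj (fst y) - F$3 / 2 * cnj (snd y),
     - (F$3 / 2) * cnj (fst y) - (F$1 + \<i> * F$2) / 2 * cnj (snd y))"

definition spinor_sq :: "complex \<times> complex \<Rightarrow> complex^3 \<Rightarrow> complex" where
  "spinor_sq y F = sphere_coord_a y (spinor_mat y F)"

definition spinor_inv :: "complex \<times> complex \<Rightarrow> complex^3 \<Rightarrow> complex \<times> complex" where
  "spinor_inv y F = cscale (inverse (csqrt (spinor_sq y F))) (spinor_mat y F)"

text \<open>For q = (a, b) the coefficients formed from F are a^2, ab and b^2, the entries of q q^T.
  Applied to the conjugate of y this rank one matrix returns q times the Hermitian product of q and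
  y.\<close>

lemma spinor_mat_spinor: "spinor_mat y (spinor q) = cscale (sphere_coord_a y q) q"
proof -
  have ii: "\<i> * (\<i> * a) = - a" for a by (simp flip: mult.assoc)
  have "(spinor q $ 1 - \<i> * spinor q $ 2) / 2 = (fst q)\<^sup>2" "(spinor q $ 1 + \<i> * spinor q $ 2) / 2 = - (snd q)\<^sup>2"
    "spinor q $ 3 / 2 = - (fst q * snd q)"
    unfolding spinor_nth ii by simp_all
  then show ?thesis
    unfolding spinor_mat_def by (simp only:) (simp add: cscale_def sphere_coord_a_def power2_eq_square algebra_simps)
qed

lemma spinor_sq_spinor: "spinor_sq y (spinor q) = (sphere_coord_a y q)\<^sup>2"
  unfolding spinor_sq_def spinor_mat_spinor
  by (simp add: cscale_def sphere_coord_a_def power2_eq_square algebra_simps)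

text \<open>The principal square root of \<lambda>^2 is \<lambda> or -\<lambda>, whence the
  sign.\<close>

lemma spinor_inv_spinor:
  assumes "spinor_sq y (spinor q) \<noteq> 0"
  shows "spinor_inv y (spinor q) = q \<or> spinor_inv y (spinor q) = cscale (- 1) q"
proof -
  let ?l = "sphere_coord_a y q"
  have l: "?l \<noteq> 0" using assms unfolding spinor_sq_spinor by auto
  have "(csqrt (?l\<^sup>2))\<^sup>2 = ?l\<^sup>2" by simp
  then have "csqrt (?l\<^sup>2) = ?l \<or> csqrt (?l\<^sup>2) = - ?l" by (simp only: power2_eq_iff)
  then show ?thesis
    unfolding spinor_inv_def spinor_sq_spinor spinor_mat_spinor cscale_cscale
    using l by (auto simp: cscale_1)
qed

lemma sphere_coord_a_self: "norm y = 1 \<Longrightarrow> sphere_coord_a y y = 1"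
  unfolding sphere_coord_a_def using sphere3_eq by blast

lemma spinor_inv_self: "norm y = 1 \<Longrightarrow> spinor_inv y (spinor y) = y"
  by (simp add: spinor_inv_def spinor_sq_spinor spinor_mat_spinor sphere_coord_a_self cscale_1)

lemma cis_int_2pi: "cis (2 * pi * real_of_int n) = 1"
  by (simp add: cis_multiple_2pi)

context rational_spacetime
begin

section \<open>Orbits on the 3-sphere and null geodesics\<close>

definition sphere_gset :: "complex \<times> complex \<Rightarrow> ((real^3) \<times> complex) set" where
  "sphere_gset q = gset (re_vec (spinor q)) (nim_vec (spinor q)) 1"

lemma lens_root_cis:
  fixes n :: int
  obtains k where "lens_root (2 * c) ^ k = cis (pi * n / c)"
proof -
  let ?k = "nat (n mod (2 * int c))"
  have "int ?k = n mod (2 * int c)" using c by simp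
  then have "n = 2 * int c * (n div (2 * int c)) + int ?k" by simp
  from arg_cong[OF this, of real_of_int]
  have "real_of_int n = 2 * real c * real_of_int (n div (2 * int c)) + real ?k"
    by (simp only: of_int_add of_int_mult of_int_numeral of_int_of_nat_eq)
  moreover have "pi * (2 * real c * a + b) / c = 2 * pi * a + 2 * pi * b / real (2 * c)" for a b :: real
    using c by (simp add: field_simps)
  ultimately have "pi * n / c = 2 * pi * real_of_int (n div (2 * int c)) + 2 * pi * ?k / real (2 * c)"
    by metis
  then have "cis (pi * n / c) = cis (2 * pi * ?k / real (2 * c))"
    by (simp only: cis_mult[symmetric] cis_int_2pi mult_1_left)
  then show thesis using that[of ?k] unfolding lens_root_power by simp
qed

lemma sphere_gset_cscale_minus: "sphere_gset (cscale (- 1) q) = sphere_gset q"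
  unfolding sphere_gset_def spinor_cscale by simp

text \<open>Both phases are 1, so the connecting rotation satisfies c \<theta>/d = 2 pi m, and q is
  multiplied by \<open>cis\<close> of its half, pi m d/c. The sign left open by the double covering
  adds c to the numerator, since -1 = cis (pi c/c).\<close>

lemma sphere_gset_imp_lens_orbit:
  assumes q: "norm q = 1" "norm q' = 1" and eq: "sphere_gset q = sphere_gset q'"
  shows "lens_orbit (2 * c) q = lens_orbit (2 * c) q'"
proof -
  obtain \<theta> where th: "re_vec (spinor q') = rot_fst \<theta> (re_vec (spinor q)) (nim_vec (spinor q))"
    "nim_vec (spinor q') = rot_snd \<theta> (re_vec (spinor q)) (nim_vec (spinor q))" "1 = 1 * cis (c / d * \<theta>)"
    by (rule gset_eqE[OF frame_spinor[OF q(1)] frame_spinor[OF q(2)] eq[unfolded sphere_gset_def]]) simp_all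
  have "exp (\<i> * of_real (c / d * \<theta>)) = 1" using th(3) by (simp only: cis_conv_exp mult_1_left)
  then obtain m :: int where "c / d * \<theta> = 2 * pi * m" unfolding exp_eq_1 by (auto simp: mult_ac)
  then have theta: "\<theta> / 2 = pi * real_of_int (m * int d) / c" using c d by (simp add: field_simps)
  have "spinor q' = cis \<theta> *s spinor q"
    by (metis th(1,2) re_nim_cis re_nim_cvec(3))
  also have "cis \<theta> = (cis (\<theta> / 2))\<^sup>2" by (simp add: power2_eq_square cis_mult)
  finally have "spinor (cscale (cis (\<theta> / 2)) q) = spinor q'" by (simp only: spinor_cscale)
  then have "q' = cscale (cis (\<theta> / 2)) q \<or> q' = cscale (- 1) (cscale (cis (\<theta> / 2)) q)"
    by (rule spinor_inj)
  then have "\<exists>n::int. q' = cscale (cis (pi * n / c)) q"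
  proof
    assume "q' = cscale (cis (\<theta> / 2)) q"
    then show ?thesis unfolding theta by blast
  next
    assume "q' = cscale (- 1) (cscale (cis (\<theta> / 2)) q)"
    moreover have "- 1 * cis (\<theta> / 2) = cis (pi * real_of_int (m * int d + int c) / c)"
    proof -
      have "pi * real_of_int (m * int d + int c) / c = pi + \<theta> / 2"
        unfolding theta using c by (simp add: field_simps)
      then show ?thesis by (simp only: cis_mult[symmetric] cis_pi)
    qed
    ultimately show ?thesis unfolding cscale_cscale by metis
  qed
  then obtain n :: int where n: "q' = cscale (cis (pi * n / c)) q" ..
  obtain k where "lens_root (2 * c) ^ k = cis (pi * n / c)" by (rule lens_root_cis)
  then have "q' = cscale (lens_root (2 * c) ^ k) q" using n by simp
  moreover have "2 * c > 0" using c by simp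
  ultimately show ?thesis using lens_orbit_eq_iff by blast
qed

lemma lens_orbit_imp_sphere_gset:
  assumes "gcd c d = 1" and eq: "lens_orbit (2 * c) q = lens_orbit (2 * c) q'"
  shows "sphere_gset q = sphere_gset q'"
proof -
  have "2 * c > 0" using c by simp
  then obtain k where k: "q' = cscale (lens_root (2 * c) ^ k) q" using eq lens_orbit_eq_iff by blast
  \<comment> \<open>Since uc + vd = 1, k equals dvk + cuk, so the rotation by 2 pi k/c is the
    rotation by \<theta> = 2 pi d v k/c. For this representative c \<theta>/d = 2 pi v k, which
    leaves the phase unchanged.\<close>
  obtain u v :: int where uv: "u * int c + v * int d = 1"
    using bezout_int[of "int c" "int d"] assms(1) by (auto simp: gcd_int_int_eq)
  define \<theta> where "\<theta> = 2 * pi * real_of_int (int d * v * int k) / c"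
  have "int d * v * int k = int k - int c * (u * int k)"
    using arg_cong[OF uv, of "\<lambda>r. r * int k"] by (simp add: algebra_simps)
  from arg_cong[OF this, of real_of_int]
  have "real_of_int (int d * v * int k) = real k - real c * real_of_int (u * int k)"
    by (simp only: of_int_diff of_int_mult of_int_of_nat_eq)
  then have "\<theta> + 2 * pi * real_of_int (u * int k) = 2 * pi * k / c"
    unfolding \<theta>_def using c by (simp only:) (simp add: field_simps)
  then have "cis (2 * pi * k / c) = cis \<theta> * cis (2 * pi * real_of_int (u * int k))"
    by (simp only: cis_mult)
  then have "cis (2 * pi * k / c) = cis \<theta>" by (simp only: cis_int_2pi mult_1_right)
  moreover have "(lens_root (2 * c) ^ k)\<^sup>2 = cis (2 * pi * k / c)"
    unfolding lens_root_power power2_eq_square cis_mult by (simp add: mult.assoc)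
  ultimately have s: "spinor q' = cis \<theta> *s spinor q" unfolding k spinor_cscale by simp
  have "c / d * \<theta> = 2 * pi * real_of_int (v * int k)"
    unfolding \<theta>_def using c d by (simp add: field_simps)
  then have "cis (c / d * \<theta>) = 1" by (simp only: cis_int_2pi)
  then show ?thesis
    using gset_rot[of \<theta> "re_vec (spinor q)" "nim_vec (spinor q)" 1]
    unfolding sphere_gset_def s re_nim_cis by simp
qed

text \<open>Running back along the geodesic by the angle (d/c) Arg z leads to the phase 1, where the
  frame is the image of a spinor.\<close>

lemma gset_eq_sphere_gset:
  assumes "frame x w z"
  obtains q where "norm q = 1" "gset x w z = sphere_gset q"
proof -
  have "norm z = 1" using assms by (simp add: frame_def)
  moreover from this have "z \<noteq> 0" by auto
  ultimately have "cis (Arg z) = z" using cis_Arg[of z] by (simp add: sgn_div_norm)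
  then obtain \<alpha> where z: "z = cis \<alpha>" by metis
  let ?\<theta> = "- (d / c * \<alpha>)"
  have "z * cis (c / d * ?\<theta>) = 1" unfolding z cis_mult using c d by simp
  then have g: "gset x w z = gset (rot_fst ?\<theta> x w) (rot_snd ?\<theta> x w) 1"
    using gset_rot[of ?\<theta> x w z] by simp
  have "frame (rot_fst ?\<theta> x w) (rot_snd ?\<theta> x w) (z * cis 0)" by (rule frame_rot[OF assms])
  then obtain q where q: "norm q = 1" "spinor q = cvec (rot_fst ?\<theta> x w) (rot_snd ?\<theta> x w)"
    by (rule spinor_surj)
  have "gset x w z = sphere_gset q" unfolding sphere_gset_def q(2) re_nim_cvec by (rule g)
  with q(1) show thesis by (rule that)
qed

abbreviation "null_proj \<equiv> \<lambda>p. fst ` leaf ST p"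

lemma future_nullE:
  assumes "p \<in> future_null ST"
  obtains x w z \<tau> where "frame x w z" "\<tau> > 0" "p = ((x, z), \<tau> *\<^sub>R gdir 0 x w z)" "null_proj p = gset x w z"
proof -
  obtain x z v where p: "p = ((x, z), v)" by (cases p) auto
  obtain w \<tau> where w: "frame x w z" "\<tau> > 0" "v = \<tau> *\<^sub>R gdir 0 x w z"
    using assms unfolding p future_null_iff by blast
  show thesis by (rule that[OF w(1,2)]) (use p w fst_leaf_eq[OF w(1,2)] in auto)
qed

text \<open>The connecting rotation \<theta>, the phase z and the scale \<tau> of p are frozen and
  only the spinor frame varies with q, so the lift is a smooth map on the whole ambient
  space.\<close>

lemma lift_from_sphere:
  assumes p: "p \<in> future_null ST" and y: "norm y = 1" and eq: "null_proj p = sphere_gset y"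
  shows "\<exists>\<Phi>. Cinf_on UNIV \<Phi> \<and> \<Phi> y = p \<and> (\<forall>q. norm q = 1 \<longrightarrow> \<Phi> q \<in> future_null ST \<and> null_proj (\<Phi> q) = sphere_gset q)"
proof -
  obtain x w z \<tau> where f: "frame x w z" and tau: "\<tau> > 0" and p: "p = ((x, z), \<tau> *\<^sub>R gdir 0 x w z)"
    and pr: "null_proj p = gset x w z"
    by (rule future_nullE[OF p])
  obtain \<theta> where th: "x = rot_fst \<theta> (re_vec (spinor y)) (nim_vec (spinor y))"
    "w = rot_snd \<theta> (re_vec (spinor y)) (nim_vec (spinor y))" "z = 1 * cis (c / d * \<theta>)"
    by (rule gset_eqE[OF frame_spinor[OF y] f eq[unfolded pr sphere_gset_def, symmetric]]) simp_all
  let ?X = "\<lambda>q. rot_fst \<theta> (re_vec (spinor q)) (nim_vec (spinor q))"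
    and ?W = "\<lambda>q. rot_snd \<theta> (re_vec (spinor q)) (nim_vec (spinor q))"
  let ?\<Phi> = "\<lambda>q. ((?X q, z), \<tau> *\<^sub>R gdir 0 (?X q) (?W q) z)"
  have sp: "Cinf_on UNIV (\<lambda>q. spinor q $ i)" for i
  proof -
    have "Cinf_on UNIV (\<lambda>q::complex \<times> complex. (fst q)\<^sup>2 - (snd q)\<^sup>2)"
      "Cinf_on UNIV (\<lambda>q::complex \<times> complex. \<i> * ((fst q)\<^sup>2 + (snd q)\<^sup>2))"
      "Cinf_on UNIV (\<lambda>q::complex \<times> complex. - 2 * (fst q * snd q))"
      by (intro Cinf_intros open_UNIV)+
    then show ?thesis unfolding spinor_def by (cases "i = 1"; cases "i = 2") simp_all
  qed
  have "Cinf_on UNIV ?X" "Cinf_on UNIV ?W"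
    unfolding rot_fst_def rot_snd_def re_vec_def nim_vec_def by (intro Cinf_intros sp open_UNIV)+
  then have "Cinf_on UNIV ?\<Phi>"
    unfolding gdir_def rot_0 by (intro Cinf_intros open_UNIV)
  moreover have "?\<Phi> y = p" unfolding p th(1,2)[symmetric] by (rule HOL.refl)
  moreover have "?\<Phi> q \<in> future_null ST \<and> null_proj (?\<Phi> q) = sphere_gset q" if "norm q = 1" for q
  proof -
    have z: "z = 1 * cis (c / d * \<theta>)" by (rule th(3))
    have f: "frame (?X q) (?W q) z" unfolding z by (rule frame_rot[OF frame_spinor[OF that]]) simp
    have "?\<Phi> q \<in> future_null ST" unfolding future_null_iff using f tau by blast
    moreover have "null_proj (?\<Phi> q) = gset (?X q) (?W q) z" by (rule fst_leaf_eq[OF f tau])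
    moreover have "\<dots> = sphere_gset q" unfolding z gset_rot sphere_gset_def by (rule HOL.refl)
    ultimately show ?thesis by simp
  qed
  ultimately show ?thesis by (intro exI[of _ ?\<Phi>]) simp
qed

text \<open>The frame is recovered from the tangent vector and run back to the phase 1, and then the
  spinor map is inverted near y. U avoids the branch cuts of the logarithm and the square root; at p
  both arguments are 1.\<close>

lemma lift_to_sphere:
  assumes p: "p \<in> future_null ST" and y: "norm y = 1" and eq: "null_proj p = sphere_gset y"
  shows "\<exists>U \<Phi>. open U \<and> p \<in> U \<and> Cinf_on U \<Phi> \<and> \<Phi> p = y \<and>
    (\<forall>p'\<in>U \<inter> future_null ST. norm (\<Phi> p') = 1 \<and> null_proj p' = sphere_gset (\<Phi> p'))"
proof -
  obtain x0 w0 z0 \<tau>0 where f0: "frame x0 w0 z0" and tau0: "\<tau>0 > 0" and p0: "p = ((x0, z0), \<tau>0 *\<^sub>R gdir 0 x0 w0 z0)"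
    and pr: "null_proj p = gset x0 w0 z0"
    by (rule future_nullE[OF p])
  obtain \<theta> where th: "x0 = rot_fst \<theta> (re_vec (spinor y)) (nim_vec (spinor y))"
    "w0 = rot_snd \<theta> (re_vec (spinor y)) (nim_vec (spinor y))" "z0 = 1 * cis (c / d * \<theta>)"
    by (rule gset_eqE[OF frame_spinor[OF y] f0 eq[unfolded pr sphere_gset_def, symmetric]]) simp_all
  \<comment> \<open>On C^+, Z is the phase relative to z0, T is the value of dt, W is the unit
    spatial direction, and E rotates by -(\<theta> + (d/c) Arg Z), which undoes the phase. Including
    \<theta>, the rotation from the spinor frame of y to the frame of p, makes F p equal to
    \<open>spinor y\<close> and not merely to another frame of the same geodesic.\<close>
  define Z where "Z = (\<lambda>p :: ((real^3) \<times> complex) \<times> (real^3) \<times> complex. snd (fst p) * cnj z0)"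
  define T where "T = (\<lambda>p :: ((real^3) \<times> complex) \<times> (real^3) \<times> complex. Im (cnj (snd (fst p)) * snd (snd p)))"
  define W where "W = (\<lambda>p. (c / (d * T p)) *\<^sub>R fst (snd p))"
  define E where "E = (\<lambda>p. cis (- \<theta>) * exp (- of_real (d / c) * Ln (Z p)))"
  define F where "F = (\<lambda>p. E p *s cvec (fst (fst p)) (W p))"
  define U1 where "U1 = {p. T p > 0} \<inter> Z -` (- \<real>\<^sub>\<le>\<^sub>0)"
  have CZ: "Cinf_on S Z" and CT: "Cinf_on S T" if "open S" for S
    unfolding Z_def T_def using that by (intro Cinf_intros; assumption)+
  have U1: "open U1"
    unfolding U1_def
    by (intro open_Int open_Collect_less continuous_on_const open_vimage open_Compl closed_nonpos_Reals_complex
        Cinf_on_imp_continuous_on[OF CZ[OF open_UNIV]] Cinf_on_imp_continuous_on[OF CT[OF open_UNIV]])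
  have CW: "Cinf_on U1 W" unfolding W_def
    by (intro Cinf_intros Cinf_on_divide_real CT U1) (use d in \<open>auto simp: U1_def\<close>)
  have CE: "Cinf_on U1 E" unfolding E_def
    by (intro Cinf_intros Cinf_on_Ln CZ U1) (auto simp: U1_def)
  have CF: "Cinf_on U1 (\<lambda>p. F p $ i)" for i
    unfolding F_def cvec_def by (simp, intro Cinf_on_mult Cinf_on_Complex CE CW Cinf_intros U1)
  have Cmat: "Cinf_on U1 (\<lambda>p. spinor_mat y (F p))"
    unfolding spinor_mat_def by (intro Cinf_intros Cinf_on_divide CF U1) simp_all
  have Csq: "Cinf_on U1 (\<lambda>p. spinor_sq y (F p))"
    unfolding spinor_sq_def sphere_coord_a_def by (intro Cinf_intros Cmat U1)
  define U where "U = U1 \<inter> (\<lambda>p. spinor_sq y (F p)) -` (- \<real>\<^sub>\<le>\<^sub>0)"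
  have U: "open U" unfolding U_def
    by (rule Cinf_on_open_preimage[OF Csq U1]) (simp add: open_Compl)
  have UU1: "U \<subseteq> U1" unfolding U_def by blast
  define \<Phi> where "\<Phi> = (\<lambda>p. spinor_inv y (F p))"
  have "Cinf_on U (\<lambda>p. inverse (csqrt (spinor_sq y (F p))))"
    by (intro Cinf_on_inverse Cinf_on_csqrt Cinf_on_subset[OF Csq UU1] U) (auto simp: U_def)
  then have "Cinf_on U \<Phi>"
    unfolding \<Phi>_def spinor_inv_def cscale_def
    by (intro Cinf_intros Cinf_on_subset[OF Cmat UU1] U)
  have key: "norm (\<Phi> p') = 1 \<and> null_proj p' = sphere_gset (\<Phi> p')" if p': "p' \<in> U" "p' \<in> future_null ST" for p'
  proof -
    obtain x w z \<tau> where f: "frame x w z" and tau: "\<tau> > 0" and p'eq: "p' = ((x, z), \<tau> *\<^sub>R gdir 0 x w z)"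
      and pr': "null_proj p' = gset x w z"
      by (rule future_nullE[OF p'(2)])
    have nz: "norm z = 1" "norm z0 = 1" using f f0 by (auto simp: frame_def)
    have "T p' = \<tau> * (Re z * Re z + Im z * Im z)"
      by (simp add: T_def p'eq gdir_def algebra_simps)
    then have T: "T p' = \<tau>" using nz(1) by (simp add: cmod_def power2_eq_square)
    have Wp: "W p' = w" unfolding W_def T using tau c d by (simp add: p'eq gdir_def)
    have "norm (Z p') = 1" unfolding Z_def p'eq using nz by (simp add: norm_mult)
    then obtain \<alpha> where a: "- pi < \<alpha>" "\<alpha> \<le> pi" "Z p' = exp (\<i> * of_real \<alpha>)"
      using Arg_bounded Arg_eq[of "Z p'"] by (metis mult_1_left norm_zero of_real_1 zero_neq_one)
    then have Ln: "Ln (Z p') = \<i> * of_real \<alpha>" by (simp add: Ln_exp)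
    have z: "z = z0 * cis \<alpha>"
    proof -
      have "z0 * cnj z0 = 1" using nz(2) complex_norm_square[of z0] by simp
      moreover have "cis \<alpha> = z * cnj z0" using a(3) by (simp add: Z_def p'eq cis_conv_exp)
      ultimately show ?thesis by (simp add: mult.assoc mult.left_commute)
    qed
    let ?\<beta> = "- (\<theta> + d / c * \<alpha>)"
    have "E p' = cis ?\<beta>"
      unfolding E_def Ln by (simp add: cis_conv_exp mult_exp_exp algebra_simps)
    then have F: "F p' = cvec (rot_fst ?\<beta> x w) (rot_snd ?\<beta> x w)"
      unfolding F_def Wp cvec_rot by (simp add: p'eq)
    have "z * cis (c / d * ?\<beta>) = 1"
      unfolding z th(3) mult_1_left cis_mult using c d by (simp add: field_simps)
    then have g: "gset x w z = gset (rot_fst ?\<beta> x w) (rot_snd ?\<beta> x w) 1"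
      using gset_rot[of ?\<beta> x w z] by simp
    obtain q where q: "norm q = 1" "spinor q = F p'"
      unfolding F using frame_rot[OF f, of ?\<beta> 0] by (rule spinor_surj)
    have "null_proj p' = sphere_gset q"
      unfolding pr' g sphere_gset_def q(2) F by simp
    moreover have "spinor_sq y (spinor q) \<noteq> 0" using p'(1) unfolding q(2) U_def by auto
    \<comment> \<open>The branch of the root does not control the sign, but q and -q yield the same
      null geodesic.\<close>
    then have "\<Phi> p' = q \<or> \<Phi> p' = cscale (- 1) q"
      unfolding \<Phi>_def q(2)[symmetric] by (rule spinor_inv_spinor)
    ultimately show ?thesis
      using q(1) sphere_gset_cscale_minus[of q] by (auto simp: norm_cscale)
  qed
  have nz0: "norm z0 = 1" using f0 by (simp add: frame_def)
  have Zp: "Z p = 1" using nz0 complex_norm_square[of z0] by (simp add: Z_def p0)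
  have "T p = \<tau>0 * (Re z0 * Re z0 + Im z0 * Im z0)" by (simp add: T_def p0 gdir_def algebra_simps)
  then have Tp: "T p = \<tau>0" using nz0 by (simp add: cmod_def power2_eq_square)
  have Wp: "W p = w0" unfolding W_def Tp using tau0 c d by (simp add: p0 gdir_def)
  have "F p = cis (- \<theta>) *s cvec x0 w0" unfolding F_def E_def Zp Wp by (simp add: p0)
  also have "cvec x0 w0 = cis \<theta> *s spinor y" unfolding th(1,2) cvec_rot by simp
  finally have Fp: "F p = spinor y" by (simp add: cis_mult)
  have "p \<in> U"
    unfolding U_def U1_def using tau0 by (simp add: Fp spinor_sq_spinor sphere_coord_a_self[OF y] Tp Zp)
  moreover have "\<Phi> p = y" unfolding \<Phi>_def Fp by (rule spinor_inv_self[OF y])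
  ultimately show ?thesis
    using U \<open>Cinf_on U \<Phi>\<close> key by (intro exI[of _ U] exI[of _ \<Phi>]) auto
qed

section \<open>The bijection between null geodesics and points of the lens space\<close>

definition to_lens :: "((real^3) \<times> complex) set \<Rightarrow> (complex \<times> complex) set" where
  "to_lens A = lens_orbit (2 * c) (SOME q. norm q = 1 \<and> sphere_gset q = A)"

definition of_lens :: "(complex \<times> complex) set \<Rightarrow> ((real^3) \<times> complex) set" where
  "of_lens Q = sphere_gset (SOME q. norm q = 1 \<and> lens_orbit (2 * c) q = Q)"

text \<open>Independence of the chosen representative is
  \<open>sphere_gset_imp_lens_orbit\<close>.\<close>

lemma to_lens: "norm q = 1 \<Longrightarrow> to_lens (sphere_gset q) = lens_orbit (2 * c) q"
proof -
  assume q: "norm q = 1"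
  let ?q = "SOME q'. norm q' = 1 \<and> sphere_gset q' = sphere_gset q"
  have "norm ?q = 1 \<and> sphere_gset ?q = sphere_gset q" by (rule someI[of _ q]) (simp add: q)
  then show ?thesis unfolding to_lens_def using sphere_gset_imp_lens_orbit[of ?q q] q by blast
qed

lemma of_lens:
  assumes "gcd c d = 1" "norm q = 1"
  shows "of_lens (lens_orbit (2 * c) q) = sphere_gset q"
proof -
  let ?q = "SOME q'. norm q' = 1 \<and> lens_orbit (2 * c) q' = lens_orbit (2 * c) q"
  have "norm ?q = 1 \<and> lens_orbit (2 * c) ?q = lens_orbit (2 * c) q" by (rule someI[of _ q]) (simp add: assms)
  then show ?thesis unfolding of_lens_def using lens_orbit_imp_sphere_gset[OF assms(1), of ?q q] by blast
qed

lemma quotient_iso_lens: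
  assumes gcd: "gcd c d = 1"
  shows "quotient_iso (future_null ST) null_proj (sphere 0 1) (lens_orbit (2 * c)) to_lens of_lens"
proof
  have ex: "\<exists>q. norm q = 1 \<and> null_proj p = sphere_gset q" if p: "p \<in> future_null ST" for p
  proof -
    obtain x w z \<tau> where f: "frame x w z" and pr: "null_proj p = gset x w z"
      by (rule future_nullE[OF p])
    obtain q where "norm q = 1" "gset x w z = sphere_gset q" by (rule gset_eq_sphere_gset[OF f])
    then show ?thesis using pr by (intro exI[of _ q]) simp
  qed
  show "of_lens (to_lens (null_proj p)) = null_proj p" if p: "p \<in> future_null ST" for p
  proof -
    obtain q where q: "norm q = 1" "null_proj p = sphere_gset q" using ex[OF p] by blast
    show ?thesis unfolding q(2) to_lens[OF q(1)] of_lens[OF gcd q(1)] by (rule HOL.refl)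
  qed
  show "to_lens (of_lens (lens_orbit (2 * c) q)) = lens_orbit (2 * c) q" if "q \<in> sphere 0 1" for q
    using that to_lens of_lens[OF gcd] by auto
  show "to_lens (null_proj p) \<in> lens_orbit (2 * c) ` sphere 0 1" if p: "p \<in> future_null ST" for p
  proof -
    obtain q where q: "norm q = 1" "null_proj p = sphere_gset q" using ex[OF p] by blast
    then show ?thesis unfolding q(2) to_lens[OF q(1)] by simp
  qed
  show "of_lens (lens_orbit (2 * c) q) \<in> null_proj ` future_null ST" if "q \<in> sphere 0 1" for q
  proof -
    have q: "norm q = 1" using that by simp
    let ?x = "re_vec (spinor q)" and ?w = "nim_vec (spinor q)"
    have f: "frame ?x ?w 1" by (rule frame_spinor[OF q]) simp
    have "((?x, 1), 1 *\<^sub>R gdir 0 ?x ?w 1) \<in> future_null ST"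
      unfolding future_null_iff by (intro exI[of _ ?w] exI[of _ 1] conjI f) simp_all
    moreover have "sphere_gset q = null_proj ((?x, 1), 1 *\<^sub>R gdir 0 ?x ?w 1)"
      unfolding sphere_gset_def by (rule fst_leaf_eq[OF f, symmetric]) simp
    ultimately show ?thesis unfolding of_lens[OF gcd q] by (rule rev_image_eqI)
  qed
  fix p and q :: "complex \<times> complex"
  assume p: "p \<in> future_null ST" and q: "q \<in> sphere 0 1" and eq: "to_lens (null_proj p) = lens_orbit (2 * c) q"
  have nq: "norm q = 1" using q by simp
  \<comment> \<open>The hypothesis equates orbits, while the two lifts are stated for equal null
    geodesics; \<open>of_lens\<close> translates it back.\<close>
  have "null_proj p = sphere_gset q"
    using ex[OF p] to_lens eq of_lens[OF gcd] nq by metis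
  note pq = p nq this
  obtain U \<Phi> where U: "open U" "p \<in> U" "Cinf_on U \<Phi>" "\<Phi> p = q"
    "\<forall>p'\<in>U \<inter> future_null ST. norm (\<Phi> p') = 1 \<and> null_proj p' = sphere_gset (\<Phi> p')"
    using lift_to_sphere[OF pq] by (elim exE conjE)
  show "lift_at (future_null ST) (to_lens \<circ> null_proj) (sphere 0 1) (lens_orbit (2 * c)) p q"
    unfolding lift_at_def
  proof (intro exI conjI ballI)
    fix p' assume "p' \<in> U \<inter> future_null ST"
    then have "norm (\<Phi> p') = 1" "null_proj p' = sphere_gset (\<Phi> p')" using U(5) by auto
    then show "\<Phi> p' \<in> sphere 0 1" "lens_orbit (2 * c) (\<Phi> p') = (to_lens \<circ> null_proj) p'"
      using to_lens by simp_all
  qed (rule U)+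
  obtain \<Psi> where P: "Cinf_on UNIV \<Psi>" "\<Psi> q = p"
    "\<forall>q. norm q = 1 \<longrightarrow> \<Psi> q \<in> future_null ST \<and> null_proj (\<Psi> q) = sphere_gset q"
    using lift_from_sphere[OF pq] by (elim exE conjE)
  show "lift_at (sphere 0 1) (lens_orbit (2 * c)) (future_null ST) (to_lens \<circ> null_proj) q p"
    unfolding lift_at_def
  proof (intro exI conjI ballI)
    fix q' :: "complex \<times> complex" assume "q' \<in> UNIV \<inter> sphere 0 1"
    then have nq': "norm q' = 1" by simp
    from mp[OF spec[OF P(3)] this]
    have "\<Psi> q' \<in> future_null ST \<and> null_proj (\<Psi> q') = sphere_gset q'" .
    then show "\<Psi> q' \<in> future_null ST" "(to_lens \<circ> null_proj) (\<Psi> q') = lens_orbit (2 * c) q'"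
      unfolding comp_apply using to_lens[OF nq'] by simp_all
  qed (use P in auto)
qed

end

theorem theorem3p5:
  fixes c d :: nat
  assumes "c \<ge> 1" and "d \<ge> 1" and "gcd c d = 1"
  shows "diffeomorphic
    (null_geodesic_space (S2xS1 c d) :: (((real ^ 3) \<times> complex) set, 3) mfd)
    (lens_space (2 * c))"
proof -
  interpret rational_spacetime c d by unfold_locales (use assms in auto)
  interpret quotient_iso "future_null ST" null_proj "sphere 0 1" "lens_orbit (2 * c)" to_lens of_lens
    by (rule quotient_iso_lens[OF assms(3)])
  have "2 * c > 0" using assms(1) by simp
  from diffeomorphic_quotients[OF smooth_manifold_lens_space[OF this, unfolded lens_space_def]]
  \<comment> \<open>The underlying set is defined through maximal geodesics;
    \<open>null_geodesics_eq\<close> presents it as the image of the projection, the form used for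
    quotients.\<close>
  show ?thesis unfolding null_geodesic_space_def null_geodesics_eq lens_space_def .
qed

end
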